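(* Let $k>0$, $0<s<1$, $m:=\lfloor \frac1{2s}\rfloor$. There is a constant $C(s,k)>0$ such that for all $x\neq0$: (n=1) $|G^k_{1,s}(x)-G^k_{1,helm}(x)|\le C(s,k)\langle x\rangle^{-1-2s}$ if $s\in(\frac12,1)$; $\le C(s,k)\big(-\ln|x|\,\chi_{(0,1)}(|x|)+1\big)\langle x\rangle^{-1-2s}$ if $s=\frac12$; $\le C(s,k)|x|^{-(1-2s)}\langle x\rangle^{-4s}$ if $s\in(0,\frac12)$. (n=2) $|G^k_{2,s}(x)-G^k_{2,helm}(x)|\le C(s,k)|x|^{-1}$ if $s\in(\frac12,1)$, and $\big|G^k_{2,s}(x)-G^k_{2,helm}(x)-\sum_{j=0}^{m-1}\frac{c_{2,j}k^{2sj}}{|x|^{2-2s(j+1)}}\big|\le C(s,k)|x|^{-1}$ if $s\in(0,\frac12]$. (n=3) $|G^k_{3,s}(x)-G^k_{3,helm}(x)|\le C(s,k)|x|^{-(3-2s)}\langle x\rangle^{-4s}$ if $s\in(\frac12,1)$, and $\big|G^k_{3,s}(x)-G^k_{3,helm}(x)-\sum_{j=0}^{m-1}\frac{c_{3,j}k^{2sj}}{|x|^{3-2s(j+1)}}\big|\le C(s,k)|x|^{-(3-2sm)}$ if $s\in(0,\frac12]$.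
   Context: Fourier transform convention: $\mathcal F f(\xi)=\int_{\mathbb R^n}e^{-ix\cdot\xi}f(x)\,dx$; $(-\Delta)^s=\mathcal F^{-1}|\xi|^{2s}\mathcal F$. For $k>0$, $\epsilon>0$, $G^{k_\epsilon}_{n,s}:=\mathcal F^{-1}\big[(|\xi|^{2s}-k^{2s}-i\epsilon)^{-1}\big]$ and the outgoing fundamental solution is $G^k_{n,s}(x):=\lim_{\epsilon\to0^+}G^{k_\epsilon}_{n,s}(x)$, $x\ne0$. $G^k_{1,helm}(x)=\frac{i e^{ik|x|}}{2s k^{2s-1}}$, $G^k_{2,helm}(x)=\frac{i k^{2-2s}}{4s}H^{(1)}_0(k|x|)$, $G^k_{3,helm}(x)=\frac{k^{2-2s}}{s}\frac{e^{ik|x|}}{4\pi|x|}$ ($H^{(1)}_0$ the Hankel function of the first kind of order $0$). $\langle x\rangle:=(1+|x|^2)^{1/2}$; $\chi_{(0,1)}$ is the indicator of $(0,1)$; the Riesz constants are $c_{n,j}:=\frac{\Gamma(\frac n2-s(j+1))}{4^{s(j+1)}\pi^{n/2}\Gamma(s(j+1))}$; an empty sum is $0$. *)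

theory Defs
  imports "HOL-Analysis.Analysis"
begin

text \<open>Inverse Fourier transform (convention: F^{-1} g(x) = (2 pi)^{-n} int e^{i x.xi} g(xi) dxi),
  taken pointwise via Gauss-Weierstrass summability: the symbols used here are not integrable,
  so the (distributional) inverse transform is evaluated at x as the limit delta -> 0+ of the
  Gaussian-regularised integrals.\<close>
definition fourier_inv :: "('a::euclidean_space \<Rightarrow> complex) \<Rightarrow> 'a \<Rightarrow> complex" where
  "fourier_inv g x = Lim (at_right 0) (\<lambda>\<delta>::real.
      complex_of_real (1 / (2 * pi) ^ DIM('a)) *
      integral UNIV (\<lambda>\<xi>. cis (x \<bullet> \<xi>) * complex_of_real (exp (- \<delta> * norm \<xi> ^ 2)) * g \<xi>))"

definition G_eps :: "real \<Rightarrow> real \<Rightarrow> real \<Rightarrow> 'a::euclidean_space \<Rightarrow> complex" where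
  "G_eps s k \<epsilon> = fourier_inv (\<lambda>\<xi>::'a.
      1 / (complex_of_real (norm \<xi> powr (2 * s) - k powr (2 * s)) - \<i> * complex_of_real \<epsilon>))"

definition G_out :: "real \<Rightarrow> real \<Rightarrow> 'a::euclidean_space \<Rightarrow> complex" where
  "G_out s k x = Lim (at_right 0) (\<lambda>\<epsilon>. G_eps s k \<epsilon> x)"

text \<open>Bessel functions J_0, Y_0 (DLMF 10.2.2, 10.8.2) and Hankel H^{(1)}_0 = J_0 + i Y_0, for z > 0\<close>
definition besselJ0 :: "real \<Rightarrow> real" where
  "besselJ0 z = (\<Sum>m. (-1) ^ m * (z / 2) ^ (2 * m) / (fact m) ^ 2)"

definition besselY0 :: "real \<Rightarrow> real" where
  "besselY0 z = 2 / pi * (ln (z / 2) + euler_mascheroni) * besselJ0 z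
     + 2 / pi * (\<Sum>m. (-1) ^ m * harm (m + 1) * (z / 2) ^ (2 * (m + 1)) / (fact (m + 1)) ^ 2)"

definition hankel1_0 :: "real \<Rightarrow> complex" where
  "hankel1_0 z = Complex (besselJ0 z) (besselY0 z)"

definition G1_helm :: "real \<Rightarrow> real \<Rightarrow> real \<Rightarrow> complex" where
  "G1_helm s k x = \<i> * exp (\<i> * complex_of_real (k * \<bar>x\<bar>)) / complex_of_real (2 * s * k powr (2 * s - 1))"

definition G2_helm :: "real \<Rightarrow> real \<Rightarrow> real^2 \<Rightarrow> complex" where
  "G2_helm s k x = \<i> * complex_of_real (k powr (2 - 2 * s) / (4 * s)) * hankel1_0 (k * norm x)"

definition G3_helm :: "real \<Rightarrow> real \<Rightarrow> real^3 \<Rightarrow> complex" where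
  "G3_helm s k x = complex_of_real (k powr (2 - 2 * s) / s) * exp (\<i> * complex_of_real (k * norm x))
      / complex_of_real (4 * pi * norm x)"

definition jbr :: "'a::real_normed_vector \<Rightarrow> real" where
  "jbr x = sqrt (1 + norm x ^ 2)"

definition riesz_c :: "nat \<Rightarrow> real \<Rightarrow> nat \<Rightarrow> real" where
  "riesz_c n s j = Gamma (real n / 2 - s * real (j + 1)) /
      (4 powr (s * real (j + 1)) * pi powr (real n / 2) * Gamma (s * real (j + 1)))"

end

theory Submission
  imports Defs "HOL-Real_Asymp.Real_Asymp" "HOL-Probability.Probability" "HOL-Complex_Analysis.Complex_Analysis"
begin

text \<open>For \<open>b = k\<^sup>2\<^sup>s + i\<epsilon>\<close> the function \<open>1 / (\<lambda>\<^sup>s - b)\<close> extends to the plane slit along the negative axis, with a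
  single pole at \<open>w = b\<^sup>1\<^sup>/\<^sup>s\<close>; hence it equals \<open>(w / (s b)) / (\<lambda> - w) + \<integral>\<^sub>0\<^sup>\<infinity> \<rho>\<^sub>b(t) / (t + \<lambda>) dt\<close> with an explicit
  density \<open>\<rho>\<^sub>b\<close> of size \<open>min t\<^sup>s t\<^sup>-\<^sup>s\<close>. With \<open>\<lambda> = |\<xi>|\<^sup>2\<close> the pole term inverts, as \<open>\<epsilon> \<rightarrow> 0\<close>, exactly to the
  Helmholtz part, so that the difference is \<open>\<integral> \<rho>(t) Y\<^sub>t(x) dt\<close> with the positive Yukawa kernels \<open>Y\<^sub>t\<close> of \<open>t - \<Delta>\<close>.
  Expanding \<open>\<rho>\<close> in powers \<open>t\<^sup>-\<^sup>s\<^sup>(\<^sup>j\<^sup>+\<^sup>1\<^sup>)\<close> and using the homogeneous moments \<open>\<integral> t\<^sup>-\<^sup>\<alpha> Y\<^sub>t(x) dt = const |x|\<^sup>2\<^sup>\<alpha>\<^sup>-\<^sup>n\<close> gives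
  the Riesz terms, and the bounds follow by choosing \<open>\<alpha>\<close>.\<close>

subsection \<open>Heat kernels and regularised resolvents\<close>

text \<open>Two obstacles shape the proof. The symbol is not integrable, so every computation
  carries the Gaussian \<open>exp (- d * (norm \<xi>)\<^sup>2)\<close>. This factor is a heat flow
  of time \<open>d\<close>: a regularised resolvent is a tail of the Laplace integral of the heat
  kernel, and away from \<open>x = 0\<close> that kernel is bounded in time, which supplies the
  majorants for \<open>d -> 0\<close> and \<open>e -> 0\<close>. Secondly, the pole term is the
  resolvent at \<open>t = - w\<close> near \<open>- k\<^sup>2\<close>, where the Laplace integral
  diverges. It is therefore set up on the whole slit plane, with large times left on the Fourier
  side, and evaluated by holomorphic continuation from positive \<open>t\<close>. In dimension two
  this requires the logarithmic Bessel solution with its exact constant. The choices of exponent are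
  \<open>\<alpha> = s\<close> for small \<open>|x|\<close>, \<open>\<alpha> = - s\<close> for large
  \<open>|x|\<close>, \<open>\<alpha> = 1 / 2\<close> for the bound \<open>1 / |x|\<close> in the
  plane, and \<open>\<alpha> = s * m\<close> for the expansion in dimension three. Moments are
  finite only for \<open>\<alpha> < n / 2\<close>, so \<open>n = 1\<close> with
  \<open>s \<ge> 1 / 2\<close> is treated separately with the explicit one-dimensional Yukawa
  kernel.\<close>

definition heat :: "nat \<Rightarrow> real \<Rightarrow> real \<Rightarrow> real" where
  "heat n r u = (4 * pi * u) powr (- real n / 2) * exp (- r\<^sup>2 / (4 * u))"

lemma cis_measurable [measurable]: "cis \<in> borel_measurable borel"
  by (intro borel_measurable_continuous_onI continuous_intros)

text \<open>Rescaling by \<open>c = sqrt (2 * u)\<close> turns the integral into the characteristic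
  function of the standard normal distribution at \<open>x / c\<close>.\<close>

lemma gauss_fourier_real:
  fixes x u :: real
  assumes "u > 0"
  shows "integrable lborel (\<lambda>\<xi>. cis (x * \<xi>) * complex_of_real (exp (- u * \<xi>\<^sup>2)))" (is ?I)
    and "(LINT \<xi>|lborel. cis (x * \<xi>) * complex_of_real (exp (- u * \<xi>\<^sup>2)))
       = complex_of_real (sqrt (pi / u) * exp (- x\<^sup>2 / (4 * u)))" (is ?E)
proof -
  define c where "c = sqrt (2 * u)"
  have c: "c > 0" "c\<^sup>2 = 2 * u" using assms by (auto simp: c_def)
  let ?g = "\<lambda>y. complex_of_real (std_normal_density y) * cis (x / c * y)"
  have int: "integrable lborel ?g"
    by (rule Bochner_Integration.integrable_bound[of _ std_normal_density])
       (auto intro!: borel_measurable_times simp: norm_mult normal_density_nonneg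
         cis_conv_exp measurable_compose)
  have val: "(LINT y|lborel. ?g y) = complex_of_real (exp (- (x / c)\<^sup>2 / 2))"
  proof -
    have "(LINT y|lborel. ?g y) = (CLINT y|std_normal_distribution. iexp (x / c * y))"
      by (subst integral_density)
         (auto simp: normal_density_nonneg scaleR_conv_of_real cis_conv_exp)
    also have "\<dots> = char std_normal_distribution (x / c)"
      by (simp add: char_def)
    finally show ?thesis by (simp add: char_std_normal_distribution)
  qed
  have eq: "?g (0 + c * \<xi>) = complex_of_real (1 / sqrt (2 * pi)) * (cis (x * \<xi>) * complex_of_real (exp (- u * \<xi>\<^sup>2)))" for \<xi>
    using c by (simp add: std_normal_density_def power_mult_distrib)
  have "integrable lborel (\<lambda>\<xi>. ?g (0 + c * \<xi>))"
    by (rule lborel_integrable_real_affine[OF int]) (use c in auto)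
  from integrable_mult_right[OF this, of "complex_of_real (sqrt (2 * pi))"] show ?I
    unfolding eq by (simp add: mult.assoc[symmetric] flip: of_real_mult)
  have "(LINT y|lborel. ?g y) = \<bar>c\<bar> *\<^sub>R (LINT \<xi>|lborel. ?g (0 + c * \<xi>))"
    by (rule lborel_integral_real_affine) (use c in auto)
  also have "\<dots> = complex_of_real (c / sqrt (2 * pi)) * (LINT \<xi>|lborel. cis (x * \<xi>) * complex_of_real (exp (- u * \<xi>\<^sup>2)))"
    unfolding eq using c by (simp add: scaleR_conv_of_real)
  finally have "complex_of_real (c / sqrt (2 * pi)) * (LINT \<xi>|lborel. cis (x * \<xi>) * complex_of_real (exp (- u * \<xi>\<^sup>2)))
       = complex_of_real (exp (- (x / c)\<^sup>2 / 2))" using val by simp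
  moreover have "complex_of_real (sqrt (2 * pi) / c) * complex_of_real (c / sqrt (2 * pi)) = 1"
    using c by (simp flip: of_real_mult)
  ultimately have "(LINT \<xi>|lborel. cis (x * \<xi>) * complex_of_real (exp (- u * \<xi>\<^sup>2)))
     = complex_of_real (sqrt (2 * pi) / c) * complex_of_real (exp (- (x / c)\<^sup>2 / 2))"
    by (metis (no_types, lifting) mult.assoc mult.left_neutral)
  also have "sqrt (2 * pi) / c = sqrt (pi / u)"
    using assms by (simp add: c_def real_sqrt_divide real_sqrt_mult)
  also have "- (x / c)\<^sup>2 / 2 = - x\<^sup>2 / (4 * u)"
    using c by (simp add: power_divide)
  finally show ?E by simp
qed


text \<open>The integrand is a product over the coordinates, so \<open>lborel\<close> as an image of
  a product measure reduces both claims to dimension one. The factor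
  \<open>(2 * pi) ^ DIM('a)\<close> is the one that the normalised inverse transform
  removes.\<close>

lemma gauss_fourier:
  fixes x :: "'a::euclidean_space"
  assumes "u > 0"
  shows "integrable lborel (\<lambda>\<xi>. cis (x \<bullet> \<xi>) * complex_of_real (exp (- u * (norm \<xi>)\<^sup>2)))" (is ?I)
    and "(LINT \<xi>|lborel. cis (x \<bullet> \<xi>) * complex_of_real (exp (- u * (norm \<xi>)\<^sup>2)))
       = complex_of_real ((2 * pi) ^ DIM('a) * heat DIM('a) (norm x) u)" (is ?E)
proof -
  interpret P: product_sigma_finite "\<lambda>b::'a. lborel :: real measure" ..
  let ?f = "\<lambda>b \<xi>. cis ((x \<bullet> b) * \<xi>) * complex_of_real (exp (- u * \<xi>\<^sup>2))"
  let ?F = "\<lambda>\<xi>. cis (x \<bullet> \<xi>) * complex_of_real (exp (- u * (norm \<xi>)\<^sup>2))"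
  let ?T = "\<lambda>f. \<Sum>b\<in>Basis. f b *\<^sub>R (b::'a)"
  have cisp: "cis (\<Sum>b\<in>A. g b) = (\<Prod>b\<in>A. cis (g b))" if "finite A" for A :: "'a set" and g
    using that by (induction) (simp_all flip: cis_mult)
  have expp: "complex_of_real (exp (c * (norm y)\<^sup>2)) = (\<Prod>b\<in>Basis. complex_of_real (exp (c * (y \<bullet> b)\<^sup>2)))"
    for c and y :: 'a
  proof -
    have "(norm y)\<^sup>2 = (\<Sum>b\<in>Basis. (y \<bullet> b)\<^sup>2)"
      by (subst power2_norm_eq_inner, subst euclidean_inner) (simp add: power2_eq_square)
    then have "exp (c * (norm y)\<^sup>2) = exp (\<Sum>b\<in>Basis. c * (y \<bullet> b)\<^sup>2)"
      by (simp only: sum_distrib_left)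
    then show ?thesis by (simp only: exp_sum[OF finite_Basis] of_real_prod)
  qed
  have F: "?F \<xi> = (\<Prod>b\<in>Basis. ?f b (\<xi> \<bullet> b))" for \<xi>
    unfolding euclidean_inner[of x \<xi>] cisp[OF finite_Basis] expp prod.distrib ..
  have comp: "(\<Prod>b\<in>Basis. ?f b (?T g \<bullet> b)) = (\<Prod>b\<in>Basis. ?f b (g b))" for g
    by (rule prod.cong) (auto simp: inner_sum_left_Basis)
  have m: "?T \<in> (\<Pi>\<^sub>M b\<in>Basis. lborel) \<rightarrow>\<^sub>M borel" by measurable
  have "integrable (\<Pi>\<^sub>M b\<in>Basis. lborel) (\<lambda>g. \<Prod>b\<in>Basis. ?f b (g b))"
    by (rule P.product_integrable_prod) (use gauss_fourier_real[OF assms] in auto)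
  then show ?I
    unfolding F by (subst lborel_eq, subst integrable_distr_eq[OF m]) (auto simp: comp cis_conv_exp)
  have "(LINT \<xi>|lborel. ?F \<xi>) = integral\<^sup>L (\<Pi>\<^sub>M b\<in>Basis. lborel) (\<lambda>g. \<Prod>b\<in>Basis. ?f b (g b))"
    unfolding F by (subst lborel_eq, subst integral_distr[OF m]) (auto simp: comp cis_conv_exp)
  also have "\<dots> = (\<Prod>b\<in>Basis. (LINT \<xi>|lborel. ?f b \<xi>))"
    by (rule P.product_integral_prod) (use gauss_fourier_real[OF assms] in auto)
  also have "\<dots> = (\<Prod>b\<in>Basis. complex_of_real (sqrt (pi / u) * exp (- (x \<bullet> b)\<^sup>2 / (4 * u))))"
    by (intro prod.cong refl gauss_fourier_real assms)
  also have "\<dots> = complex_of_real (sqrt (pi / u) ^ DIM('a) * exp (- (norm x)\<^sup>2 / (4 * u)))"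
    using expp[of "- 1 / (4 * u)" x] by (simp add: prod.distrib)
  also have "sqrt (pi / u) ^ DIM('a) = (2 * pi) ^ DIM('a) * (4 * pi * u) powr (- real DIM('a) / 2)"
  proof -
    have "sqrt (pi / u) = 2 * pi * (4 * pi * u) powr (- 1 / 2)"
      using assms by (simp add: powr_minus powr_half_sqrt real_sqrt_divide real_sqrt_mult field_simps)
    then have "sqrt (pi / u) ^ DIM('a) = (2 * pi) ^ DIM('a) * ((4 * pi * u) powr (- 1 / 2)) ^ DIM('a)"
      by (simp add: power_mult_distrib)
    also have "((4 * pi * u) powr (- 1 / 2)) ^ DIM('a) = (4 * pi * u) powr (- real DIM('a) / 2)"
      using assms by (simp add: powr_power)
    finally show ?thesis .
  qed
  finally show ?E by (simp add: heat_def mult.assoc)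
qed

section \<open>Dominated limits, exchange of integrals, and elementary bounds\<close>

lemma at_within_Ioo_at_right: "a < b \<Longrightarrow> at a within {a<..<b} = at_right (a::real)"
  by (rule at_within_nhd[of _ "{..<b}"]) auto

text \<open>Dominated convergence for a continuous parameter. Convergence at the right of
  \<open>a\<close> can be tested on sequences in \<open>{a<..<b}\<close>, and only there is the
  majorant required.\<close>

lemma tendsto_integral_at_right:
  fixes f :: "real \<Rightarrow> 'a \<Rightarrow> 'b::{banach, second_countable_topology}"
  assumes "a < b"
    and meas: "\<And>d. f d \<in> borel_measurable M" "g \<in> borel_measurable M"
    and bound: "\<And>d x. a < d \<Longrightarrow> d < b \<Longrightarrow> norm (f d x) \<le> w x"
    and w: "integrable M w"
    and lim: "\<And>x. ((\<lambda>d. f d x) \<longlongrightarrow> g x) (at_right a)"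
  shows "((\<lambda>d. integral\<^sup>L M (f d)) \<longlongrightarrow> integral\<^sup>L M g) (at_right a)"
  unfolding at_within_Ioo_at_right[OF \<open>a < b\<close>, symmetric] tendsto_at_iff_sequentially comp_def
proof (intro allI impI)
  fix X assume X: "\<forall>i. X i \<in> {a<..<b} - {a}" "X \<longlonglongrightarrow> a"
  have "((\<lambda>i. f (X i) x) \<longlonglongrightarrow> g x)" for x
    using lim[of x] X unfolding at_within_Ioo_at_right[OF \<open>a < b\<close>, symmetric] tendsto_at_iff_sequentially comp_def
    by blast
  then show "(\<lambda>i. integral\<^sup>L M (f (X i))) \<longlonglongrightarrow> integral\<^sup>L M g"
    by (intro integral_dominated_convergence[where w = w]) (use meas w bound X in auto)
qed

text \<open>A majorant in product form gives integrability on the product space at once. Below, one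
  factor is a Gaussian in \<open>\<xi>\<close> and the other an integrable weight in the time or
  spectral variable.\<close>

lemma fubini_product_bound:
  fixes f :: "'a::euclidean_space \<Rightarrow> 'b::euclidean_space \<Rightarrow> complex"
  assumes meas: "case_prod f \<in> borel_measurable (lborel \<Otimes>\<^sub>M lborel)"
    and A: "integrable lborel A" and B: "integrable lborel B"
    and bound: "\<And>x y. norm (f x y) \<le> A x * B y"
  shows "(LINT x|lborel. LINT y|lborel. f x y) = (LINT y|lborel. LINT x|lborel. f x y)"
    and "integrable lborel (\<lambda>x. LINT y|lborel. f x y)"
proof -
  note [measurable] = meas
  have iy: "integrable lborel (f x)" for x
    by (rule Bochner_Integration.integrable_bound[of _ "\<lambda>y. A x * B y"])
      (use B bound in \<open>auto intro: order_trans[OF _ abs_ge_self]\<close>)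
  have int: "integrable (lborel \<Otimes>\<^sub>M lborel) (case_prod f)"
  proof (rule lborel_pair.Fubini_integrable)
    show "integrable lborel (\<lambda>x. LINT y|lborel. norm (case_prod f (x, y)))"
    proof (rule Bochner_Integration.integrable_bound[of _ "\<lambda>x. A x * (LINT y|lborel. B y)"])
      show "AE x in lborel. norm (LINT y|lborel. norm (case_prod f (x, y))) \<le> norm (A x * (LINT y|lborel. B y))"
      proof (rule AE_I2)
        fix x
        have "(LINT y|lborel. norm (f x y)) \<le> (LINT y|lborel. A x * B y)"
          by (rule integral_mono) (use iy bound B in \<open>auto intro!: integrable_norm\<close>)
        then show "norm (LINT y|lborel. norm (case_prod f (x, y))) \<le> norm (A x * (LINT y|lborel. B y))"
          using integral_nonneg_AE[of "\<lambda>y. norm (f x y)" lborel] by auto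
      qed
    qed (use A in auto)
  qed (use iy in auto)
  show "(LINT x|lborel. LINT y|lborel. f x y) = (LINT y|lborel. LINT x|lborel. f x y)"
    by (rule lborel_pair.Fubini_integral[OF int, symmetric])
  show "integrable lborel (\<lambda>x. LINT y|lborel. f x y)"
    using lborel_pair.integrable_fst[OF int] by simp
qed

lemma heat_nonneg [simp]: "0 \<le> heat n r u"
  by (simp add: heat_def)

lemma heat_measurable [measurable]: "heat n r \<in> borel_measurable borel"
  unfolding heat_def by measurable

text \<open>In the variable \<open>v = r\<^sup>2 / (4 * u)\<close> the kernel is a constant times
  \<open>v powr a * exp (- v)\<close>, whose maximum lies at \<open>v = a\<close>; this is the
  origin of \<open>exp (a * ln a - a)\<close>.\<close>

lemma heat_bounded:
  assumes "r > 0"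
  obtains C where "C > 0" "\<And>u. u > 0 \<Longrightarrow> heat n r u \<le> C"
proof
  define a where "a = real n / 2"
  let ?C = "(pi * r\<^sup>2) powr (- a) * exp (a * ln a - a)"
  show "?C > 0" using assms by simp
  fix u :: real assume u: "u > 0"
  define v where "v = r\<^sup>2 / (4 * u)"
  have v: "v > 0" "4 * pi * u = (pi * r\<^sup>2) / v" using assms u by (auto simp: v_def)
  have "a * ln v - v \<le> a * ln a - a"
  proof (cases "a = 0")
    case False
    then have a: "a > 0" by (simp add: a_def)
    have "ln (v / a) \<le> v / a - 1" using a v by (intro ln_le_minus_one) auto
    then have "a * ln (v / a) \<le> a * (v / a - 1)" using a by (intro mult_left_mono) auto
    then show ?thesis using a v by (simp add: ln_div algebra_simps)
  qed (use v in auto)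
  then have "v powr a * exp (- v) \<le> exp (a * ln a - a)"
    using v by (simp add: powr_def flip: exp_add)
  moreover have "heat n r u = (pi * r\<^sup>2) powr (- a) * (v powr a * exp (- v))"
  proof -
    have "- r\<^sup>2 / (4 * u) = - v" by (simp add: v_def)
    then show ?thesis
      using v(1) assms unfolding heat_def v(2) by (simp add: powr_divide powr_minus a_def field_simps)
  qed
  ultimately show "heat n r u \<le> ?C" by (simp add: mult_left_mono)
qed

text \<open>The constant is the distance from \<open>- t\<close> to the closed ray of nonnegative
  reals, which is positive because \<open>- t\<close> lies off it.\<close>

lemma slit_plane_bound:
  assumes "t \<notin> \<real>\<^sub>\<le>\<^sub>0"
  obtains c where "c > 0" "\<And>l. l \<ge> 0 \<Longrightarrow> c \<le> norm (complex_of_real l + t)"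
proof
  have "- t \<notin> \<real>\<^sub>\<ge>\<^sub>0" using assms by (metis minus_minus uminus_nonpos_Reals_iff)
  then show "infdist (- t) \<real>\<^sub>\<ge>\<^sub>0 > 0"
    by (intro infdist_pos_not_in_closed closed_nonneg_Reals_complex) (metis empty_iff nonneg_Reals_of_real_iff order_refl)
  fix l :: real assume "l \<ge> 0"
  then have "infdist (- t) \<real>\<^sub>\<ge>\<^sub>0 \<le> dist (- t) (complex_of_real l)"
    by (intro infdist_le) auto
  then show "infdist (- t) \<real>\<^sub>\<ge>\<^sub>0 \<le> norm (complex_of_real l + t)"
    by (simp add: dist_norm norm_minus_commute[of "- t"])
qed

lemma integrable_gauss:
  assumes "d > 0"
  shows "integrable lborel (\<lambda>\<xi>::'a::euclidean_space. exp (- d * (norm \<xi>)\<^sup>2))"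
  using integrable_norm[OF gauss_fourier(1)[OF assms, of 0]] by (simp add: norm_mult)

text \<open>Fubini for \<open>exp (- u (norm \<xi>\<^sup>2 + t))\<close>: the inner \<open>u\<close>-integral produces resolvents, the
  \<open>\<xi>\<close>-integral heat kernels.\<close>

lemma heat_fubini:
  fixes x :: "'a::euclidean_space" and t :: complex
  assumes "d > 0" and S: "S \<subseteq> {d..}" "S \<in> sets borel"
    and int: "set_integrable lborel S (\<lambda>u. exp (- Re t * u))"
  shows "(LINT u:S|lborel. exp (- t * u) * heat DIM('a) (norm x) u)
     = of_real (1 / (2 * pi) ^ DIM('a)) *
       (LINT \<xi>|lborel. cis (x \<bullet> \<xi>) * (LINT u:S|lborel. exp (- (of_real ((norm \<xi>)\<^sup>2) + t) * u)))"
proof -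
  let ?f = "\<lambda>u \<xi>. indicator S u *\<^sub>R (cis (x \<bullet> \<xi>) * exp (- (of_real ((norm \<xi>)\<^sup>2) + t) * of_real u))"
  note [measurable] = S(2)
  have norm_f: "norm (?f u \<xi>) \<le> (indicator S u *\<^sub>R exp (- Re t * u)) * exp (- d * (norm \<xi>)\<^sup>2)" for u \<xi>
  proof (cases "u \<in> S")
    case True
    then have "u \<ge> d" using S by auto
    then have "d * (norm \<xi>)\<^sup>2 \<le> u * (norm \<xi>)\<^sup>2" by (intro mult_right_mono) auto
    then show ?thesis using True
      by (simp add: norm_mult algebra_simps flip: exp_add)
  qed auto
  have "(LINT u:S|lborel. exp (- t * u) * heat DIM('a) (norm x) u) =
     of_real (1 / (2 * pi) ^ DIM('a)) * (LINT u|lborel. LINT \<xi>|lborel. ?f u \<xi>)"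
    unfolding set_lebesgue_integral_def
  proof (subst integral_mult_right_zero[symmetric], rule Bochner_Integration.integral_cong[OF refl])
    fix u
    show "indicator S u *\<^sub>R (exp (- t * u) * heat DIM('a) (norm x) u) =
      of_real (1 / (2 * pi) ^ DIM('a)) * (LINT \<xi>|lborel. ?f u \<xi>)"
    proof (cases "u \<in> S")
      case True
      then have u: "u > 0" using S \<open>d > 0\<close> by auto
      have "(LINT \<xi>|lborel. ?f u \<xi>) = (LINT \<xi>|lborel. exp (- t * u) * (cis (x \<bullet> \<xi>) * complex_of_real (exp (- u * (norm \<xi>)\<^sup>2))))"
        using True by (intro Bochner_Integration.integral_cong) (auto simp: exp_of_real[symmetric] exp_add[symmetric] algebra_simps)
      also have "\<dots> = exp (- t * u) * complex_of_real ((2 * pi) ^ DIM('a) * heat DIM('a) (norm x) u)"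
        by (simp only: integral_mult_right_zero gauss_fourier(2)[OF u])
      finally show ?thesis using True by (simp add: field_simps)
    qed auto
  qed
  also have "(LINT u|lborel. LINT \<xi>|lborel. ?f u \<xi>) = (LINT \<xi>|lborel. LINT u|lborel. ?f u \<xi>)"
  proof (rule fubini_product_bound(1)[OF _ _ _ norm_f])
    show "integrable lborel (\<lambda>u. indicator S u *\<^sub>R exp (- Re t * u))"
      using int by (simp add: set_integrable_def)
    show "integrable lborel (\<lambda>\<xi>::'a. exp (- d * (norm \<xi>)\<^sup>2))"
      using integrable_gauss[OF \<open>d > 0\<close>] .
    show "(\<lambda>(u, \<xi>). ?f u \<xi>) \<in> borel_measurable (lborel \<Otimes>\<^sub>M lborel)"
      by measurable
  qed
  also have "(\<lambda>\<xi>. LINT u|lborel. ?f u \<xi>) = (\<lambda>\<xi>. cis (x \<bullet> \<xi>) * (LINT u:S|lborel. exp (- (of_real ((norm \<xi>)\<^sup>2) + t) * u)))"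
    unfolding set_lebesgue_integral_def
    by (subst integral_mult_right_zero[symmetric]) (simp add: scaleR_conv_of_real ac_simps)
  finally show ?thesis .
qed

text \<open>This is the expression inside \<open>fourier_inv\<close> for the symbol of
  \<open>(t - Laplacian)^-1\<close>, before the limit in \<open>d\<close>. It occurs with
  \<open>t > 0\<close> under the spectral integral and with \<open>t = - w\<close> in the pole
  term.\<close>

definition resolvent_reg :: "'a::euclidean_space \<Rightarrow> real \<Rightarrow> complex \<Rightarrow> complex" where
  "resolvent_reg x d t = of_real (1 / (2 * pi) ^ DIM('a)) *
     (LINT \<xi>|lborel. cis (x \<bullet> \<xi>) * of_real (exp (- d * (norm \<xi>)\<^sup>2)) * (1 / (of_real ((norm \<xi>)\<^sup>2) + t)))"

lemma integrable_fourier_gauss_bounded: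
  fixes g :: "'a::euclidean_space \<Rightarrow> complex"
  assumes "d > 0" "g \<in> borel_measurable borel" "\<And>\<xi>. norm (g \<xi>) \<le> B"
  shows "integrable lborel (\<lambda>\<xi>. cis (x \<bullet> \<xi>) * of_real (exp (- d * (norm \<xi>)\<^sup>2)) * g \<xi>)"
proof (rule Bochner_Integration.integrable_bound[of _ "\<lambda>\<xi>::'a. B * exp (- d * (norm \<xi>)\<^sup>2)"])
  note [measurable] = assms(2)
  show "(\<lambda>\<xi>. cis (x \<bullet> \<xi>) * of_real (exp (- d * (norm \<xi>)\<^sup>2)) * g \<xi>) \<in> borel_measurable lborel"
    by measurable
  have "0 \<le> B" using assms(3)[of 0] norm_ge_zero order_trans by blast
  then show "AE \<xi> in lborel. norm (cis (x \<bullet> \<xi>) * of_real (exp (- d * (norm \<xi>)\<^sup>2)) * g \<xi>)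
      \<le> norm (B * exp (- d * (norm \<xi>)\<^sup>2))"
    using assms(3) by (auto simp: norm_mult mult.commute)
qed (use integrable_gauss[OF assms(1)] in auto)

lemma resolvent_bounded:
  fixes t :: complex
  assumes "t \<notin> \<real>\<^sub>\<le>\<^sub>0"
  obtains c where "c > 0" "\<And>\<xi>::'a::euclidean_space. norm (1 / (of_real ((norm \<xi>)\<^sup>2) + t)) \<le> 1 / c"
proof -
  obtain c where c: "c > 0" "\<And>l. l \<ge> 0 \<Longrightarrow> c \<le> norm (complex_of_real l + t)"
    using slit_plane_bound[OF assms] by metis
  have "norm (1 / (of_real ((norm \<xi>)\<^sup>2) + t)) \<le> 1 / c" for \<xi> :: 'a
    using c(1) c(2)[of "(norm \<xi>)\<^sup>2"] by (simp add: norm_divide frac_le)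
  with c(1) that show ?thesis by blast
qed

lemma integrable_resolvent_reg:
  fixes t :: complex
  assumes "d > 0" "t \<notin> \<real>\<^sub>\<le>\<^sub>0"
  shows "integrable lborel (\<lambda>\<xi>::'a::euclidean_space. cis (x \<bullet> \<xi>) * of_real (exp (- d * (norm \<xi>)\<^sup>2)) * (1 / (of_real ((norm \<xi>)\<^sup>2) + t)))"
proof -
  obtain c where "c > 0" "\<And>\<xi>::'a. norm (1 / (of_real ((norm \<xi>)\<^sup>2) + t)) \<le> 1 / c"
    using resolvent_bounded[OF assms(2)] by blast
  then show ?thesis by (intro integrable_fourier_gauss_bounded assms(1)) auto
qed

text \<open>The function \<open>exp (- (\<lambda> + t) * u) / (\<lambda> + t)\<close> of
  \<open>u\<close> has derivative \<open>- exp (- (\<lambda> + t) * u)\<close>. Changing the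
  Gaussian time from \<open>T\<close> to \<open>d\<close> hence adds a heat integral over a bounded
  time interval, which makes sense for every sign of \<open>Re t\<close>. This is what makes the
  point \<open>t = - w\<close> accessible.\<close>

lemma resolvent_reg_shift:
  fixes x :: "'a::euclidean_space" and t :: complex
  assumes "0 < d" "d \<le> T" "t \<notin> \<real>\<^sub>\<le>\<^sub>0"
  shows "exp (- t * d) * resolvent_reg x d t = exp (- t * T) * resolvent_reg x T t
     + (LINT u:{d..T}|lborel. exp (- t * u) * heat DIM('a) (norm x) u)"
proof -
  have nz: "of_real ((norm \<xi>)\<^sup>2) + t \<noteq> 0" for \<xi> :: 'a
  proof
    assume "of_real ((norm \<xi>)\<^sup>2) + t = 0"
    then have "t = of_real (- (norm \<xi>)\<^sup>2)" by (simp add: add_eq_0_iff)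
    then show False using assms(3) by (metis nonpos_Reals_of_real_iff neg_le_0_iff_le zero_le_power2)
  qed
  have inner: "(LINT u:{d..T}|lborel. exp (- z * u)) = (exp (- z * d) - exp (- z * T)) / z" if "z \<noteq> 0" for z :: complex
  proof -
    have "(LINT u:{d..T}|lborel. exp (- z * u)) = (- exp (- z * T) / z) - (- exp (- z * d) / z)"
      unfolding set_lebesgue_integral_def
    proof (rule integral_FTC_Icc[OF assms(2)])
      fix u assume "d \<le> u" "u \<le> T"
      show "((\<lambda>u. - exp (- z * complex_of_real u) / z) has_vector_derivative exp (- z * u)) (at u within {d..T})"
        using that by (auto intro!: derivative_eq_intros has_vector_derivative_real_field simp: field_simps)
    qed (intro continuous_intros)
    then show ?thesis using that by (simp add: field_simps)
  qed
  have "(LINT u:{d..T}|lborel. exp (- t * u) * heat DIM('a) (norm x) u)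
     = of_real (1 / (2 * pi) ^ DIM('a)) *
       (LINT \<xi>|lborel. cis (x \<bullet> \<xi>) * (LINT u:{d..T}|lborel. exp (- (of_real ((norm \<xi>)\<^sup>2) + t) * u)))"
    by (rule heat_fubini[OF assms(1)])
      (auto intro!: borel_integrable_atLeastAtMost' continuous_intros simp del: mult_minus_left)
  also have "(\<lambda>\<xi>::'a. cis (x \<bullet> \<xi>) * (LINT u:{d..T}|lborel. exp (- (of_real ((norm \<xi>)\<^sup>2) + t) * u))) =
    (\<lambda>\<xi>. exp (- t * d) * (cis (x \<bullet> \<xi>) * of_real (exp (- d * (norm \<xi>)\<^sup>2)) * (1 / (of_real ((norm \<xi>)\<^sup>2) + t)))
       - exp (- t * T) * (cis (x \<bullet> \<xi>) * of_real (exp (- T * (norm \<xi>)\<^sup>2)) * (1 / (of_real ((norm \<xi>)\<^sup>2) + t))))"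
  proof
    fix \<xi> :: 'a
    have e: "exp (- (of_real ((norm \<xi>)\<^sup>2) + t) * complex_of_real u) = exp (- t * u) * of_real (exp (- u * (norm \<xi>)\<^sup>2))" for u
      by (auto simp: exp_of_real[symmetric] exp_add[symmetric] algebra_simps)
    show "cis (x \<bullet> \<xi>) * (LINT u:{d..T}|lborel. exp (- (of_real ((norm \<xi>)\<^sup>2) + t) * u)) =
      exp (- t * d) * (cis (x \<bullet> \<xi>) * of_real (exp (- d * (norm \<xi>)\<^sup>2)) * (1 / (of_real ((norm \<xi>)\<^sup>2) + t)))
       - exp (- t * T) * (cis (x \<bullet> \<xi>) * of_real (exp (- T * (norm \<xi>)\<^sup>2)) * (1 / (of_real ((norm \<xi>)\<^sup>2) + t)))"
      unfolding inner[OF nz] unfolding e by (simp only: diff_divide_distrib right_diff_distrib times_divide_eq_right times_divide_eq_left mult_1_right mult.assoc mult.left_commute)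
  qed
  also have "of_real (1 / (2 * pi) ^ DIM('a)) * integral\<^sup>L lborel \<dots> = exp (- t * d) * resolvent_reg x d t - exp (- t * T) * resolvent_reg x T t"
  proof -
    define h where "h d \<xi> = cis (x \<bullet> \<xi>) * of_real (exp (- d * (norm \<xi>)\<^sup>2)) * (1 / (of_real ((norm \<xi>)\<^sup>2) + t))" for d \<xi>
    have "integrable lborel (h d)" "integrable lborel (h T)"
      unfolding h_def by (rule integrable_resolvent_reg; use assms in simp)+
    then show ?thesis
      unfolding resolvent_reg_def h_def[symmetric] by (simp add: right_diff_distrib mult.left_commute)
  qed
  finally show ?thesis by simp
qed

lemma set_integral_exp_minus:
  fixes a c :: real
  assumes "a > 0"
  shows "set_integrable lborel {c..} (\<lambda>u. exp (- a * u))"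
    and "(LINT u:{c..}|lborel. exp (- a * u)) = exp (- a * c) / a"
proof -
  have hi: "((\<lambda>u. exp (- a * u)) has_integral exp (- a * c) / a) {c..}"
    using has_integral_exp_minus_to_infinity[OF assms, of c] by simp
  then have "(\<lambda>u. exp (- a * u)) absolutely_integrable_on {c..}"
    by (intro nonnegative_absolutely_integrable_1) (auto simp: integrable_on_def)
  then show *: "set_integrable lborel {c..} (\<lambda>u. exp (- a * u))"
    unfolding set_integrable_def by (subst (asm) integrable_completion) auto
  show "(LINT u:{c..}|lborel. exp (- a * u)) = exp (- a * c) / a"
    using set_borel_integral_eq_integral(2)[OF *] hi by (simp add: integral_unique)
qed

lemma set_integrable_exp_heat:
  assumes "t > 0" "r > 0" "S \<in> sets borel" "S \<subseteq> {0<..}"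
  shows "set_integrable lborel S (\<lambda>u. exp (- t * u) * heat n r u)"
proof -
  obtain C where C: "C > 0" "\<And>u. u > 0 \<Longrightarrow> heat n r u \<le> C" using heat_bounded[OF assms(2)] by metis
  have 1: "set_integrable lborel {0..} (\<lambda>u. C * exp (- t * u))"
    using set_integral_exp_minus(1)[OF assms(1)] C by (intro set_integrable_mult_right) auto
  have "set_integrable lborel {0..} (\<lambda>u. if u \<in> S then exp (- t * u) * heat n r u else 0)"
  proof (rule set_integrable_bound[OF 1])
    show "set_borel_measurable lborel {0..} (\<lambda>u. if u \<in> S then exp (- t * u) * heat n r u else 0)"
      using assms(3) unfolding set_borel_measurable_def by measurable
    show "AE u in lborel. u \<in> {0..} \<longrightarrow> norm (if u \<in> S then exp (- t * u) * heat n r u else 0) \<le> norm (C * exp (- t * u))"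
      using C assms by (auto simp: abs_mult mult.commute)
  qed
  then show ?thesis
    unfolding set_integrable_def
    by (rule Bochner_Integration.integrable_cong[THEN iffD1, OF refl, rotated])
      (use assms(4) in \<open>auto simp: indicator_def\<close>)
qed

section \<open>Yukawa kernels and the Green function on the slit plane\<close>

definition yukawa :: "nat \<Rightarrow> real \<Rightarrow> real \<Rightarrow> real" where
  "yukawa n r t = (LINT u:{0<..}|lborel. exp (- t * u) * heat n r u)"

lemma yukawa_nonneg: "0 \<le> yukawa n r t"
  unfolding yukawa_def set_lebesgue_integral_def by (intro integral_nonneg_AE) auto

lemma yukawa_measurable [measurable]: "yukawa n r \<in> borel_measurable borel"
  unfolding yukawa_def[abs_def] set_lebesgue_integral_def by measurable

text \<open>For \<open>Re t < 0\<close> the Laplace integral defining \<open>yukawa\<close> diverges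
  at large times. Times above 1 are therefore represented on the Fourier side, where only
  \<open>t\<close> off the cut is required. By \<open>resolvent_reg_shift\<close> another splitting
  time would give the same value.\<close>

definition green :: "'a::euclidean_space \<Rightarrow> complex \<Rightarrow> complex" where
  "green x t = exp (- t) * resolvent_reg x 1 t
     + (LINT u:{0<..1}|lborel. exp (- t * complex_of_real u) * complex_of_real (heat DIM('a) (norm x) u))"

text \<open>After \<open>resolvent_reg_shift\<close> with \<open>T = 1\<close> the parameter
  \<open>d\<close> survives only in an exponential factor and in the lower end of an integral whose
  integrand is bounded, because \<open>x\<close> is not 0.\<close>

lemma resolvent_reg_tendsto:
  fixes x :: "'a::euclidean_space"
  assumes "x \<noteq> 0" "t \<notin> \<real>\<^sub>\<le>\<^sub>0"
  shows "((\<lambda>d. resolvent_reg x d t) \<longlongrightarrow> green x t) (at_right 0)"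
proof -
  obtain C where C: "C > 0" "\<And>u. u > 0 \<Longrightarrow> heat DIM('a) (norm x) u \<le> C"
    using heat_bounded[of "norm x"] assms(1) by auto
  let ?h = "\<lambda>u. exp (- t * complex_of_real u) * complex_of_real (heat DIM('a) (norm x) u)"
  have hb: "norm (?h u) \<le> exp (norm t) * C" if "0 < u" "u \<le> 1" for u
  proof -
    have "norm (exp (- t * complex_of_real u)) \<le> exp (norm (t * complex_of_real u))"
      using norm_exp[of "- t * complex_of_real u"] by simp
    also have "\<dots> \<le> exp (norm t)" using that by (simp add: norm_mult mult_left_le)
    finally show ?thesis using C(2)[OF that(1)] by (auto simp: norm_mult intro!: mult_mono)
  qed
  have "((\<lambda>d. LINT u:{d..1}|lborel. ?h u) \<longlongrightarrow> (LINT u:{0<..1}|lborel. ?h u)) (at_right 0)"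
    unfolding set_lebesgue_integral_def
  proof (rule tendsto_integral_at_right[of 0 1])
    show "norm (indicator {d..1} u *\<^sub>R ?h u) \<le> indicator {0..1} u * (exp (norm t) * C)" if "0 < d" for d u
      using hb[of u] that C(1) by (auto simp: indicator_def)
    show "((\<lambda>d. indicator {d..1} u *\<^sub>R ?h u) \<longlongrightarrow> indicator {0<..1} u *\<^sub>R ?h u) (at_right 0)" for u :: real
    proof (cases "0 < u")
      case True
      show ?thesis
        by (rule tendsto_eventually, rule eventually_at_rightI[of 0 u]) (use True in \<open>auto simp: indicator_def\<close>)
    next
      case False
      show ?thesis
        by (rule tendsto_eventually, rule eventually_at_rightI[of 0 1]) (use False in \<open>auto simp: indicator_def\<close>)
    qed
    show "(\<lambda>x. indicator {0<..1} x *\<^sub>R ?h x) \<in> borel_measurable lborel"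
      "(\<lambda>x. indicator {d..1} x *\<^sub>R ?h x) \<in> borel_measurable lborel" for d by measurable
  qed auto
  then have "((\<lambda>d. exp (t * of_real d) * (exp (- t * of_real 1) * resolvent_reg x 1 t + (LINT u:{d..1}|lborel. ?h u)))
      \<longlongrightarrow> exp (t * of_real 0) * (exp (- t * of_real 1) * resolvent_reg x 1 t + (LINT u:{0<..1}|lborel. ?h u))) (at_right 0)"
    by (intro tendsto_intros)
  then have "((\<lambda>d. exp (t * of_real d) * (exp (- t * of_real 1) * resolvent_reg x 1 t + (LINT u:{d..1}|lborel. ?h u)))
      \<longlongrightarrow> green x t) (at_right 0)"
    by (simp add: green_def)
  moreover have "eventually (\<lambda>d. exp (t * of_real d) * (exp (- t * of_real 1) * resolvent_reg x 1 t + (LINT u:{d..1}|lborel. ?h u))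
      = resolvent_reg x d t) (at_right 0)"
  proof (rule eventually_at_rightI[of 0 1])
    fix d :: real assume "d \<in> {0<..<1}"
    then have "exp (- t * of_real 1) * resolvent_reg x 1 t + (LINT u:{d..1}|lborel. ?h u) = exp (- t * d) * resolvent_reg x d t"
      using resolvent_reg_shift[of d 1 t x] assms by simp
    then show "exp (t * of_real d) * (exp (- t * of_real 1) * resolvent_reg x 1 t + (LINT u:{d..1}|lborel. ?h u))
      = resolvent_reg x d t"
      by (simp add: exp_minus field_simps)
  qed simp
  ultimately show ?thesis by (rule Lim_transform_eventually)
qed

text \<open>For positive \<open>t\<close> the Laplace integral converges up to infinite time, so
  \<open>heat_fubini\<close> applies with \<open>S = {d..}\<close> and leaves no term at a final
  time.\<close>

lemma resolvent_reg_of_real: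
  fixes x :: "'a::euclidean_space"
  assumes "d > 0" "t > 0"
  shows "resolvent_reg x d (of_real t) = of_real (exp (t * d) * (LINT u:{d..}|lborel. exp (- t * u) * heat DIM('a) (norm x) u))"
proof -
  have inner: "(LINT u:{d..}|lborel. exp (- (of_real ((norm \<xi>)\<^sup>2) + complex_of_real t) * of_real u))
     = of_real (exp (- t * d)) * (of_real (exp (- d * (norm \<xi>)\<^sup>2)) * (1 / (of_real ((norm \<xi>)\<^sup>2) + of_real t)))" for \<xi> :: 'a
  proof -
    have "(LINT u:{d..}|lborel. exp (- (of_real ((norm \<xi>)\<^sup>2) + complex_of_real t) * of_real u))
      = (LINT u:{d..}|lborel. complex_of_real (exp (- ((norm \<xi>)\<^sup>2 + t) * u)))"
      by (simp flip: exp_of_real)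
    also have "\<dots> = of_real (LINT u:{d..}|lborel. exp (- ((norm \<xi>)\<^sup>2 + t) * u))"
      by (rule set_integral_complex_of_real)
    also have "(LINT u:{d..}|lborel. exp (- ((norm \<xi>)\<^sup>2 + t) * u)) = exp (- ((norm \<xi>)\<^sup>2 + t) * d) / ((norm \<xi>)\<^sup>2 + t)"
      using assms by (intro set_integral_exp_minus) (simp add: add_nonneg_pos)
    also have "exp (- ((norm \<xi>)\<^sup>2 + t) * d) = exp (- t * d) * exp (- d * (norm \<xi>)\<^sup>2)"
      by (simp add: algebra_simps flip: exp_add)
    finally show ?thesis by (simp add: add.commute)
  qed
  have "of_real (LINT u:{d..}|lborel. exp (- t * u) * heat DIM('a) (norm x) u)
     = (LINT u:{d..}|lborel. exp (- complex_of_real t * of_real u) * of_real (heat DIM('a) (norm x) u))"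
    by (subst set_integral_complex_of_real[symmetric]) (simp flip: exp_of_real)
  also have "\<dots> = of_real (1 / (2 * pi) ^ DIM('a)) *
       (LINT \<xi>|lborel. cis (x \<bullet> \<xi>) * (LINT u:{d..}|lborel. exp (- (of_real ((norm \<xi>)\<^sup>2) + complex_of_real t) * u)))"
    using set_integral_exp_minus(1)[OF assms(2), of d] by (intro heat_fubini[OF assms(1)]) auto
  also have "(\<lambda>\<xi>::'a. cis (x \<bullet> \<xi>) * (LINT u:{d..}|lborel. exp (- (of_real ((norm \<xi>)\<^sup>2) + complex_of_real t) * u)))
     = (\<lambda>\<xi>. of_real (exp (- t * d)) * (cis (x \<bullet> \<xi>) * of_real (exp (- d * (norm \<xi>)\<^sup>2)) * (1 / (of_real ((norm \<xi>)\<^sup>2) + complex_of_real t))))"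
    unfolding inner by (simp add: ac_simps)
  also have "of_real (1 / (2 * pi) ^ DIM('a)) * integral\<^sup>L lborel \<dots> = of_real (exp (- t * d)) * resolvent_reg x d (of_real t)"
    unfolding resolvent_reg_def by (simp only: integral_mult_right_zero mult.left_commute)
  finally show ?thesis by (simp add: exp_minus field_simps)
qed

text \<open>The factor \<open>exp (t * d)\<close> cancels the decay of the tail integral, so the
  bound is uniform in \<open>d\<close>. This uniformity provides the majorant for the limit
  \<open>d -> 0\<close> under the spectral integral.\<close>

lemma resolvent_reg_bound:
  fixes x :: "'a::euclidean_space"
  assumes "x \<noteq> 0"
  obtains C where "C > 0" "\<And>d t. d > 0 \<Longrightarrow> t > 0 \<Longrightarrow> norm (resolvent_reg x d (of_real t)) \<le> C / t"
proof -
  obtain C where C: "C > 0" "\<And>u. u > 0 \<Longrightarrow> heat DIM('a) (norm x) u \<le> C"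
    using heat_bounded[of "norm x"] assms(1) by auto
  have "norm (resolvent_reg x d (of_real t)) \<le> C / t" if dt: "d > 0" "t > 0" for d t
  proof -
    have "(LINT u:{d..}|lborel. exp (- t * u) * heat DIM('a) (norm x) u) \<le> (LINT u:{d..}|lborel. C * exp (- t * u))"
      using dt C assms set_integral_exp_minus(1)[OF dt(2), of d]
      by (intro set_integral_mono set_integrable_exp_heat) (auto intro!: set_integrable_mult_right)
    also have "\<dots> = C * (exp (- t * d) / t)" using set_integral_exp_minus(2)[OF dt(2), of d] by simp
    finally have "exp (t * d) * (LINT u:{d..}|lborel. exp (- t * u) * heat DIM('a) (norm x) u) \<le> exp (t * d) * (C * (exp (- t * d) / t))"
      by (intro mult_left_mono) auto
    also have "\<dots> = C / t" by (simp add: exp_minus)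
    finally have 1: "exp (t * d) * (LINT u:{d..}|lborel. exp (- t * u) * heat DIM('a) (norm x) u) \<le> C / t" .
    have "0 \<le> (LINT u:{d..}|lborel. exp (- t * u) * heat DIM('a) (norm x) u)"
      unfolding set_lebesgue_integral_def by (intro integral_nonneg_AE) auto
    with 1 show ?thesis
      unfolding resolvent_reg_of_real[OF dt] norm_of_real by (simp add: abs_mult)
  qed
  with C(1) that show ?thesis by blast
qed

text \<open>Both sides are limits of \<open>resolvent_reg\<close> as \<open>d -> 0\<close>: the left
  by \<open>resolvent_reg_tendsto\<close>, the right by letting the lower end of the Laplace
  integral go to 0.\<close>

lemma green_of_real:
  fixes x :: "'a::euclidean_space"
  assumes "x \<noteq> 0" "t > 0"
  shows "green x (of_real t) = of_real (yukawa DIM('a) (norm x) t)"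
proof (rule tendsto_unique[OF _ resolvent_reg_tendsto])
  let ?h = "\<lambda>u. exp (- t * u) * heat DIM('a) (norm x) u"
  have "((\<lambda>d. LINT u:{d..}|lborel. ?h u) \<longlongrightarrow> (LINT u:{0<..}|lborel. ?h u)) (at_right 0)"
    unfolding set_lebesgue_integral_def
  proof (rule tendsto_integral_at_right[of 0 1])
    show "norm (indicator {d..} u *\<^sub>R ?h u) \<le> indicator {0<..} u *\<^sub>R ?h u" if "0 < d" for d u
      using that by (auto simp: indicator_def)
    show "((\<lambda>d. indicator {d..} u *\<^sub>R ?h u) \<longlongrightarrow> indicator {0<..} u *\<^sub>R ?h u) (at_right 0)" for u :: real
    proof (cases "0 < u")
      case True
      show ?thesis
        by (rule tendsto_eventually, rule eventually_at_rightI[of 0 u]) (use True in \<open>auto simp: indicator_def\<close>)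
    next
      case False
      show ?thesis
        by (rule tendsto_eventually, rule eventually_at_rightI[of 0 1]) (use False in \<open>auto simp: indicator_def\<close>)
    qed
    show "integrable lborel (\<lambda>u. indicator {0<..} u *\<^sub>R ?h u)"
      using set_integrable_exp_heat[of t "norm x" "{0<..}"] assms by (simp add: set_integrable_def)
  qed auto
  then have "((\<lambda>d. complex_of_real (exp (t * d) * (LINT u:{d..}|lborel. ?h u))) \<longlongrightarrow> of_real (exp (t * 0) * (LINT u:{0<..}|lborel. ?h u))) (at_right 0)"
    by (intro tendsto_intros)
  then have "((\<lambda>d. complex_of_real (exp (t * d) * (LINT u:{d..}|lborel. ?h u))) \<longlongrightarrow> of_real (yukawa DIM('a) (norm x) t)) (at_right 0)"
    by (simp add: yukawa_def)
  then show "((\<lambda>d. resolvent_reg x d (of_real t)) \<longlongrightarrow> of_real (yukawa DIM('a) (norm x) t)) (at_right 0)"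
    by (rule Lim_transform_eventually)
      (rule eventually_at_rightI[of 0 1], use assms resolvent_reg_of_real[of _ t x] in auto)
qed (use assms in \<open>auto simp: trivial_limit_at_right_real\<close>)

subsection \<open>Stieltjes representation of the symbol\<close>

text \<open>The boundary values of \<open>\<lambda>\<close> to the power \<open>s\<close> at
  \<open>- t\<close> are \<open>t powr s * cis (pi * s)\<close> from above and
  \<open>t powr s * cis (- (pi * s))\<close> from below. The density is the value of
  \<open>1 / (\<lambda>^s - b)\<close> below the cut minus the value above it, divided by
  \<open>2 pi i\<close>.\<close>

definition spectral_density :: "real \<Rightarrow> complex \<Rightarrow> real \<Rightarrow> complex" where
  "spectral_density s b t = of_real (sin (pi * s) / pi * t powr s) /
     ((of_real (t powr s) * cis (pi * s) - b) * (of_real (t powr s) * cis (- (pi * s)) - b))"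

lemma set_integrable_powr_0_1:
  fixes p :: real
  assumes "p > -1"
  shows "set_integrable lborel {0<..1} (\<lambda>t. t powr p)"
proof -
  have "(\<lambda>t. t powr p) absolutely_integrable_on {0<..1}"
    by (intro nonnegative_absolutely_integrable_1 integrable_on_powr_from_0' assms) auto
  then show ?thesis
    unfolding set_integrable_def by (subst (asm) integrable_completion) auto
qed

lemma set_integrable_powr_1_inf:
  fixes p :: real
  assumes "p < -1"
  shows "set_integrable lborel {1..} (\<lambda>t. t powr p)"
proof -
  have "(\<lambda>t. t powr p) absolutely_integrable_on {1..}"
    using has_integral_powr_to_inf[OF assms, of 1]
    by (intro nonnegative_absolutely_integrable_1) (auto simp: integrable_on_def)
  then show ?thesis
    unfolding set_integrable_def by (subst (asm) integrable_completion) auto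
qed

lemma set_integrable_two_powers:
  fixes f :: "real \<Rightarrow> 'a::{banach, second_countable_topology}"
  assumes [measurable]: "f \<in> borel_measurable borel" and "p > -1" "q < -1"
    and bound0: "\<And>t. 0 < t \<Longrightarrow> t \<le> 1 \<Longrightarrow> norm (f t) \<le> A * t powr p"
    and bound1: "\<And>t. 1 \<le> t \<Longrightarrow> norm (f t) \<le> B * t powr q"
  shows "set_integrable lborel {0<..} f"
proof -
  have i01: "set_integrable lborel {0<..1} f"
    by (rule set_integrable_bound[OF set_integrable_mult_right[of A, OF set_integrable_powr_0_1[OF assms(2)]]])
      (auto simp: set_borel_measurable_def intro!: order_trans[OF bound0 abs_ge_self])
  have i1: "set_integrable lborel {1..} f"
    by (rule set_integrable_bound[OF set_integrable_mult_right[of B, OF set_integrable_powr_1_inf[OF assms(3)]]])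
      (auto simp: set_borel_measurable_def intro!: order_trans[OF bound1 abs_ge_self])
  have "{0<..} = {0<..1} \<union> {1::real..}" by auto
  then show ?thesis using set_integrable_Un[OF i01 i1] by simp
qed

text \<open>Completing the square in two ways shows that the distance from the point of the ray to
  \<open>a\<close> is at least \<open>a * sin \<theta>\<close> and at least
  \<open>v * sin \<theta>\<close>, hence at least their mean. The shift by \<open>e\<close> costs at
  most \<open>sin \<theta> * a / 4\<close>, and the factor \<open>1 / 4\<close> in the claim leaves
  room for it.\<close>

lemma polar_distance_bound:
  fixes v a e \<theta> :: real
  assumes "v \<ge> 0" "a > 0" "0 < \<theta>" "\<theta> < pi" "\<bar>e\<bar> \<le> sin \<theta> * a / 4" "\<bar>\<phi>\<bar> = \<theta>"
  shows "sin \<theta> / 4 * (v + a) \<le> norm (of_real v * cis \<phi> - Complex a e)"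
proof -
  have s: "sin \<theta> > 0" using assms by (intro sin_gt_zero) auto
  have sc: "(sin \<theta>)\<^sup>2 + (cos \<theta>)\<^sup>2 = 1" by simp
  have cs: "cos \<phi> = cos \<theta>" "\<bar>sin \<phi>\<bar> = sin \<theta>" using assms s by (auto simp: abs_if split: if_splits)
  let ?z = "of_real v * cis \<phi> - of_real a"
  have n2: "(norm ?z)\<^sup>2 = (v * cos \<theta> - a)\<^sup>2 + (v * sin \<theta>)\<^sup>2"
    using cs by (auto simp: cmod_power2 power_mult_distrib) (metis power2_abs)
  have "(a * sin \<theta>)\<^sup>2 \<le> (norm ?z)\<^sup>2"
  proof -
    have "(norm ?z)\<^sup>2 - (a * sin \<theta>)\<^sup>2 = (v - a * cos \<theta>)\<^sup>2"
      unfolding n2 using sc by algebra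
    then show ?thesis using zero_le_power2[of "v - a * cos \<theta>"] by linarith
  qed
  then have 1: "a * sin \<theta> \<le> norm ?z" by (rule power2_le_imp_le) auto
  have "(v * sin \<theta>)\<^sup>2 \<le> (norm ?z)\<^sup>2" unfolding n2 by simp
  then have 2: "v * sin \<theta> \<le> norm ?z" by (rule power2_le_imp_le) auto
  have "norm ?z \<le> norm (?z - \<i> * of_real e) + norm (\<i> * of_real e)"
    by (metis norm_triangle_sub add.commute)
  then have "norm ?z \<le> norm (of_real v * cis \<phi> - Complex a e) + \<bar>e\<bar>"
    by (simp add: norm_mult Complex_eq algebra_simps)
  moreover have "sin \<theta> * v \<ge> 0" using s assms by simp
  ultimately show ?thesis using 1 2 assms(5) by (simp add: algebra_simps)
qed

text \<open>Here \<open>a\<close> stands for \<open>k\<^sup>2\<^sup>s\<close> and \<open>Complex a e\<close> for \<open>k\<^sup>2\<^sup>s + i\<epsilon>\<close>. The bound \<open>e \<le> a sin (\<pi> s) / 4\<close> keeps its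
  argument below \<open>\<pi> s\<close> and its distance from the rays \<open>v exp (\<plusminus> i \<pi> s)\<close> comparable to \<open>v + a\<close>.\<close>

locale symbol =
  fixes s a :: real
  assumes s: "0 < s" "s < 1" and a: "a > 0"
begin

lemma sin_pos: "0 < sin (pi * s)"
  using s by (intro sin_gt_zero) auto

lemma denominator_bound:
  assumes "v \<ge> 0" "\<bar>e\<bar> \<le> sin (pi * s) * a / 4"
  shows "sin (pi * s) / 4 * (v + a) \<le> norm (of_real v * cis (pi * s) - Complex a e)"
    and "sin (pi * s) / 4 * (v + a) \<le> norm (of_real v * cis (- (pi * s)) - Complex a e)"
  using polar_distance_bound[of v a "pi * s" e "pi * s"] polar_distance_bound[of v a "pi * s" e "- (pi * s)"]
    assms s a by auto

lemma denominator_nonzero: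
  assumes "v \<ge> 0" "\<bar>e\<bar> \<le> sin (pi * s) * a / 4"
  shows "of_real v * cis (pi * s) - Complex a e \<noteq> 0"
    and "of_real v * cis (- (pi * s)) - Complex a e \<noteq> 0"
proof -
  have "0 < sin (pi * s) / 4 * (v + a)" using sin_pos a assms by (intro mult_pos_pos) auto
  with denominator_bound[OF assms] show "of_real v * cis (pi * s) - Complex a e \<noteq> 0"
    "of_real v * cis (- (pi * s)) - Complex a e \<noteq> 0"
    by (metis norm_zero not_less)+
qed

lemma spectral_density_bound:
  assumes "t \<ge> 0" "\<bar>e\<bar> \<le> sin (pi * s) * a / 4"
  shows "norm (spectral_density s (Complex a e) t) \<le> 16 / (pi * sin (pi * s)) * (t powr s / (t powr s + a)\<^sup>2)"
proof -
  let ?v = "t powr s" and ?S = "sin (pi * s)"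
  let ?D1 = "norm (of_real ?v * cis (pi * s) - Complex a e)" and ?D2 = "norm (of_real ?v * cis (- (pi * s)) - Complex a e)"
  have S: "?S > 0" by (rule sin_pos)
  have "(?S / 4 * (?v + a)) * (?S / 4 * (?v + a)) \<le> ?D1 * ?D2"
    by (intro mult_mono denominator_bound assms) (use S a in auto)
  moreover have "0 < (?S / 4 * (?v + a)) * (?S / 4 * (?v + a))"
    using S a by (intro mult_pos_pos add_nonneg_pos) auto
  ultimately have "?S / pi * ?v / (?D1 * ?D2) \<le> ?S / pi * ?v / ((?S / 4 * (?v + a)) * (?S / 4 * (?v + a)))"
    using S by (intro divide_left_mono) (auto intro: mult_pos_pos less_le_trans)
  also have "\<dots> = 16 / (pi * ?S) * (?v / (?v + a)\<^sup>2)"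
    using S by (simp add: power2_eq_square mult_ac)
  finally show ?thesis
    using S by (simp add: spectral_density_def norm_divide norm_mult abs_mult)
qed

lemma spectral_density_measurable [measurable]: "spectral_density s b \<in> borel_measurable borel"
  unfolding spectral_density_def by measurable

text \<open>The density is of size \<open>t powr s\<close> near 0 and \<open>t powr (- s)\<close> at
  infinity, so each exponent between these two dominates it on the whole half-line.\<close>

lemma spectral_density_bound_powr:
  fixes p :: real
  assumes "\<bar>p\<bar> \<le> s"
  obtains C where "C > 0" "\<And>t e. t > 0 \<Longrightarrow> \<bar>e\<bar> \<le> sin (pi * s) * a / 4 \<Longrightarrow> norm (spectral_density s (Complex a e) t) \<le> C * t powr p"
proof
  let ?K = "16 / (pi * sin (pi * s))"
  let ?C = "?K * max 1 (1 / a\<^sup>2)"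
  have K: "?K > 0" using sin_pos by simp
  then show "?C > 0" by (intro mult_pos_pos) auto
  fix t e :: real assume t: "t > 0" and e: "\<bar>e\<bar> \<le> sin (pi * s) * a / 4"
  let ?v = "t powr s"
  have v: "?v > 0" using t by simp
  have "?v / (?v + a)\<^sup>2 \<le> max 1 (1 / a\<^sup>2) * t powr p"
  proof (cases "t \<le> 1")
    case True
    have "?v / (?v + a)\<^sup>2 \<le> ?v / a\<^sup>2"
      using v a by (intro frac_le power_mono) auto
    also have "\<dots> = 1 / a\<^sup>2 * ?v" by simp
    also have "\<dots> \<le> max 1 (1 / a\<^sup>2) * t powr p"
      using True t assms by (intro mult_mono powr_mono') auto
    finally show ?thesis .
  next
    case False
    have "?v / (?v + a)\<^sup>2 \<le> ?v / ?v\<^sup>2"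
      using v a by (intro frac_le power_mono) auto
    also have "\<dots> = 1 * t powr (- s)" using v by (simp add: power2_eq_square powr_minus field_simps)
    also have "\<dots> \<le> max 1 (1 / a\<^sup>2) * t powr p"
      using False t assms by (intro mult_mono powr_mono) auto
    finally show ?thesis .
  qed
  then have "?K * (?v / (?v + a)\<^sup>2) \<le> ?K * (max 1 (1 / a\<^sup>2) * t powr p)"
    using K by (intro mult_left_mono) auto
  then show "norm (spectral_density s (Complex a e) t) \<le> ?C * t powr p"
    using order_trans[OF spectral_density_bound[OF less_imp_le[OF t] e]] by (simp only: mult.assoc)
qed

end

section \<open>The contour integral behind the Stieltjes representation\<close>

lemma contour_integral_linepath_horizontal:
  assumes "p < q"
  shows "contour_integral (linepath (of_real p + c) (of_real q + c)) f = integral {p..q} (\<lambda>x. f (of_real x + c))"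
proof -
  have lp: "linepath (of_real p + c) (of_real q + c) x = linepath (of_real p) (of_real q) x + c" for x
    by (simp add: linepath_def algebra_simps scaleR_conv_of_real)
  have "contour_integral (linepath (of_real p + c) (of_real q + c)) f = contour_integral (linepath (of_real p) (of_real q)) (\<lambda>z. f (z + c))"
    by (simp add: contour_integral_integral lp)
  then show ?thesis
    using contour_integral_linepath_Reals_eq[of "of_real p" "of_real q" "\<lambda>z. f (z + c)"] assms by simp
qed

context symbol begin

text \<open>The principal value of \<open>b\<close> to the power \<open>1 / s\<close> for
  \<open>b = Complex a e\<close>, that is, the pole \<open>w\<close> of the symbol in
  \<open>\<lambda>\<close>.\<close>

definition spectral_point :: "real \<Rightarrow> complex" where
  "spectral_point e = exp (Ln (Complex a e) / of_real s)"

text \<open>Put \<open>b = Complex a e\<close> with argument \<open>\<phi>\<close>, so that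
  \<open>e = norm b * sin \<phi>\<close>. If \<open>\<phi>\<close> reached \<open>pi * s\<close>,
  monotonicity of the sine up to \<open>pi / 2\<close> would force
  \<open>e \<ge> a * sin (pi * s)\<close>, four times more than is allowed.\<close>

lemma Im_Ln_bounds:
  assumes "0 < e" "e \<le> sin (pi * s) * a / 4"
  shows "0 < Im (Ln (Complex a e))" "Im (Ln (Complex a e)) < pi * s"
proof -
  define b where "b = Complex a e"
  define \<phi> where "\<phi> = Im (Ln b)"
  have b0: "b \<noteq> 0" using a by (simp add: b_def complex_eq_iff)
  have \<phi>: "0 < \<phi>" "\<phi> < pi / 2"
    unfolding \<phi>_def using assms a Im_Ln_pos_lt_imp[of b] Re_Ln_pos_lt_imp[of b] Im_Ln_pos_lt[OF b0] Re_Ln_pos_lt[OF b0]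
    by (auto simp: b_def)
  then show "0 < Im (Ln (Complex a e))" by (simp add: \<phi>_def b_def)
  have "b = exp (Ln b)" using b0 by simp
  then have "Im b = exp (Re (Ln b)) * sin \<phi>" unfolding \<phi>_def by (metis Im_exp)
  also have "exp (Re (Ln b)) = norm b" using b0 by (simp flip: norm_exp_eq_Re)
  finally have e: "e = norm b * sin \<phi>" by (simp add: b_def)
  have "\<phi> < pi * s"
  proof (rule ccontr)
    assume "\<not> \<phi> < pi * s"
    then have "sin (pi * s) \<le> sin \<phi>" using \<phi> s by (intro sin_monotone_2pi_le) (auto intro: order_trans[of _ 0])
    moreover have "a \<le> norm b" using complex_Re_le_cmod[of b] by (simp add: b_def)
    ultimately have "a * sin (pi * s) \<le> e" unfolding e using sin_pos a by (intro mult_mono) auto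
    moreover have "0 < a * sin (pi * s)" using a sin_pos by simp
    ultimately show False using assms by (simp add: mult.commute)
  qed
  then show "Im (Ln (Complex a e)) < pi * s" by (simp add: \<phi>_def b_def)
qed

text \<open>The argument of the pole is that of \<open>Complex a e\<close> divided by
  \<open>s\<close>, which lies between 0 and \<open>pi\<close>. The pole thus sits on the principal
  sheet and above the real axis, which later selects the outgoing wave.\<close>

lemma Im_spectral_point:
  assumes "0 < e" "e \<le> sin (pi * s) * a / 4"
  shows "0 < Im (spectral_point e)"
proof -
  have "0 < Im (Ln (Complex a e)) / s" "Im (Ln (Complex a e)) / s < pi"
    using Im_Ln_bounds[OF assms] s by (auto simp: field_simps)
  then show ?thesis by (simp add: spectral_point_def Im_exp sin_gt_zero)
qed

lemma set_integrable_spectral_density_shift: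
  assumes "\<bar>e\<bar> \<le> sin (pi * s) * a / 4" "l > 0"
  shows "set_integrable lborel {0<..} (\<lambda>t. spectral_density s (Complex a e) t / of_real (t + l))"
proof -
  obtain C where C: "C > 0" "\<And>t. t > 0 \<Longrightarrow> norm (spectral_density s (Complex a e) t) \<le> C * t powr s"
    using spectral_density_bound_powr[of s] assms s by (metis abs_of_pos order_refl)
  obtain D where D: "D > 0" "\<And>t. t > 0 \<Longrightarrow> norm (spectral_density s (Complex a e) t) \<le> D * t powr (- s)"
    using spectral_density_bound_powr[of "- s"] assms s by (metis abs_minus_cancel abs_of_pos order_refl)
  show ?thesis
  proof (rule set_integrable_two_powers)
    show "norm (spectral_density s (Complex a e) t / of_real (t + l)) \<le> (C / l) * t powr s" if "0 < t" "t \<le> 1" for t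
    proof -
      have "norm (spectral_density s (Complex a e) t) / (t + l) \<le> C * t powr s / l"
        using C that assms by (intro frac_le) auto
      then show ?thesis using that assms by (simp add: norm_divide del: of_real_add)
    qed
    show "norm (spectral_density s (Complex a e) t / of_real (t + l)) \<le> D * t powr (- s - 1)" if "1 \<le> t" for t
    proof -
      have "norm (spectral_density s (Complex a e) t) / (t + l) \<le> D * t powr (- s) / t"
        using D that assms by (intro frac_le) auto
      also have "\<dots> = D * t powr (- s - 1)" using that by (simp add: powr_diff)
      finally show ?thesis using that assms by (simp add: norm_divide del: of_real_add)
    qed
  qed (use s in \<open>measurable, auto\<close>)
qed

text \<open>In the variable \<open>z = log \<lambda>\<close> the two sides of the cut become the lines \<open>Im z = \<plusminus> \<pi>\<close>, so a
  rectangle replaces the keyhole contour.\<close>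

lemma contour_identity:
  assumes e: "0 < e" "e \<le> sin (pi * s) * a / 4" and l: "l > 0"
    and f_def: "f = (\<lambda>z. exp z / ((exp (of_real s * z) - Complex a e) * (exp z - of_real l)))"
  obtains R0 where "\<And>R. R > R0 \<Longrightarrow> 
      contour_integral (rectpath (Complex (- R) (- pi)) (Complex R pi)) f =
      2 * of_real pi * \<i> * (1 / (of_real (l powr s) - Complex a e) - spectral_point e / (of_real s * Complex a e) / (of_real l - spectral_point e))"
    "\<And>R z. z \<in> path_image (rectpath (Complex (- R) (- pi)) (Complex R pi)) \<Longrightarrow> R > R0 \<Longrightarrow> isCont f z"
proof -
  define b where "b = Complex a e"
  define \<phi> where "\<phi> = Im (Ln b)"
  define w where "w = spectral_point e"
  have b0: "b \<noteq> 0" using a by (simp add: b_def complex_eq_iff)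
  have \<phi>: "0 < \<phi>" "\<phi> < pi * s" using Im_Ln_bounds[OF e] by (auto simp: \<phi>_def b_def)
  have pis: "pi * s < pi" using s by simp
  \<comment> \<open>\<open>c\<close> is the half-height of an open strip that contains the closed
    rectangle, since \<open>pi < c\<close>. The bound \<open>2 * pi\<close> excludes all logarithms
    of \<open>l\<close> but the real one. The bound \<open>(2 * pi - \<phi>) / s\<close> excludes
    all other solutions of \<open>exp (s * z) = b\<close>, whose imaginary parts are
    \<open>(\<phi> + 2 * n * pi) / s\<close>; the case \<open>n = - 1\<close> lies exactly on the
    boundary.\<close>
  define c where "c = min (2 * pi) ((2 * pi - \<phi>) / s)"
  have c: "pi < c"
  proof -
    have "pi * s < 2 * pi - \<phi>" using \<phi> pis by linarith
    then have "pi < (2 * pi - \<phi>) / s" using s by (simp add: field_simps)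
    then show ?thesis by (simp add: c_def)
  qed
  define S where "S = {z. Im z < c} \<inter> {z. Im z > - c}"
  define p1 where "p1 = complex_of_real (ln l)"
  define p2 where "p2 = Ln b / of_real s"
  have S: "open S" "connected S"
    unfolding S_def by (auto intro!: convex_connected convex_Int convex_halfspace_Im_lt convex_halfspace_Im_gt open_Int open_halfspace_Im_lt open_halfspace_Im_gt)
  have Im_p2: "0 < Im p2" "Im p2 < pi" using \<phi> s by (auto simp: p2_def \<phi>_def field_simps)
  have pS: "p1 \<in> S" "p2 \<in> S" using c Im_p2 by (auto simp: S_def p1_def)
  have p12: "p1 \<noteq> p2" using Im_p2 by (auto simp: p1_def)
  have ep1: "exp p1 = of_real l" using l by (simp add: p1_def exp_of_real)
  have ep2: "exp (of_real s * p2) = b" using s b0 by (simp add: p2_def)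
  have w: "exp p2 = w" by (simp add: w_def p2_def spectral_point_def b_def)
  have zl: "z = p1" if zS: "z \<in> S" and ez: "exp z = of_real l" for z
  proof -
    have "exp z = exp p1" using ez ep1 by simp
    then obtain n :: int where n: "z = p1 + of_int (2 * n) * of_real pi * \<i>" unfolding exp_eq by auto
    then have "Im z = 2 * n * pi" by (simp add: p1_def)
    moreover have "\<bar>Im z\<bar> < 2 * pi" using zS by (auto simp: S_def c_def)
    ultimately have "\<bar>real_of_int n\<bar> < 1" by (simp add: abs_mult)
    then have "n = 0" by linarith
    then show ?thesis using n by simp
  qed
  have zb: "z = p2" if zS: "z \<in> S" and ez: "exp (of_real s * z) = b" for z
  proof -
    have "exp (of_real s * z) = exp (Ln b)" using ez b0 by simp
    then obtain n :: int where n: "of_real s * z = Ln b + of_int (2 * n) * of_real pi * \<i>" unfolding exp_eq by auto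
    then have "Im (of_real s * z) = Im (Ln b + of_int (2 * n) * of_real pi * \<i>)" by (rule arg_cong)
    then have "s * Im z = \<phi> + 2 * n * pi" by (simp add: \<phi>_def)
    moreover have "\<bar>s * Im z\<bar> < 2 * pi - \<phi>"
    proof -
      have "\<bar>Im z\<bar> < (2 * pi - \<phi>) / s" using zS by (auto simp: S_def c_def)
      then show ?thesis using s by (simp add: abs_mult field_simps)
    qed
    ultimately have "\<bar>\<phi> + 2 * n * pi\<bar> < 2 * pi - \<phi>" by simp
    then have "2 * n * pi < 2 * pi" "- (2 * pi) < 2 * n * pi" using \<phi> by linarith+
    then have "pi * real_of_int n < pi * 1" "pi * (- 1) < pi * real_of_int n" by (simp_all add: mult.commute)
    then have "real_of_int n < 1" "-1 < real_of_int n" unfolding mult_less_cancel_left_pos[OF pi_gt_zero] by simp_all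
    then have "n = 0" by linarith
    then show ?thesis using n s by (auto simp: p2_def field_simps)
  qed
  have fdef: "f = (\<lambda>z. exp z / ((exp (of_real s * z) - b) * (exp z - of_real l)))" by (simp add: f_def b_def)
  have holo: "f holomorphic_on S - {p1, p2}"
    unfolding fdef using zl zb by (intro holomorphic_intros) auto
  have ball: "\<exists>r>0. ball p r \<subseteq> S - {q}" if "p \<in> S" "p \<noteq> q" for p q
  proof -
    have "open (S - {q})" using S(1) by auto
    then show ?thesis using that open_contains_ball[of "S - {q}"] by auto
  qed
  have res1: "residue f p1 = 1 / (of_real (l powr s) - b)"
  proof -
    obtain r where r: "r > 0" "ball p1 r \<subseteq> S - {p2}" using ball[OF pS(1) p12] by blast
    have eps: "exp (of_real s * p1) = of_real (l powr s)" using l by (simp add: p1_def powr_def exp_of_real[symmetric])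
    have nz: "exp (of_real s * p1) - b \<noteq> 0" using zb[OF pS(1)] p12 by auto
    have "residue (\<lambda>z. (exp z / (exp (of_real s * z) - b)) / (exp z - of_real l)) p1 = (exp p1 / (exp (of_real s * p1) - b)) / exp p1"
    proof (rule residue_simple_pole_deriv[of _ "ball p1 r"])
      show "(\<lambda>z. exp z / (exp (of_real s * z) - b)) holomorphic_on ball p1 r"
        using r zb by (intro holomorphic_intros) auto
      show "((\<lambda>z. exp z - of_real l) has_field_derivative exp p1) (at p1)"
        by (auto intro!: derivative_eq_intros)
    qed (use r nz ep1 in \<open>auto intro!: holomorphic_intros\<close>)
    then show ?thesis by (simp add: fdef eps)
  qed
  have wl: "w \<noteq> of_real l" using Im_spectral_point[OF e] by (auto simp: w_def)
  have res2: "residue f p2 = w / (w - of_real l) / (of_real s * b)"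
  proof -
    obtain r where r: "r > 0" "ball p2 r \<subseteq> S - {p1}" using ball[OF pS(2) p12[symmetric]] by blast
    have "residue (\<lambda>z. (exp z / (exp z - of_real l)) / (exp (of_real s * z) - b)) p2 = (exp p2 / (exp p2 - of_real l)) / (of_real s * b)"
    proof (rule residue_simple_pole_deriv[of _ "ball p2 r"])
      show "(\<lambda>z. exp z / (exp z - of_real l)) holomorphic_on ball p2 r"
        using r zl by (intro holomorphic_intros) auto
      show "((\<lambda>z. exp (of_real s * z) - b) has_field_derivative of_real s * b) (at p2)"
        using ep2 by (auto intro!: derivative_eq_intros)
    qed (use r wl w ep2 s b0 in \<open>auto intro!: holomorphic_intros\<close>)
    then show ?thesis by (simp add: fdef w mult.commute)
  qed
  define R0 where "R0 = max \<bar>Re p1\<bar> \<bar>Re p2\<bar>"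
  have R0: "R0 \<ge> 0" by (simp add: R0_def)
  let ?P = "\<lambda>R. rectpath (Complex (- R) (- pi)) (Complex R pi)"
  have box: "p1 \<in> box (Complex (- R) (- pi)) (Complex R pi)" "p2 \<in> box (Complex (- R) (- pi)) (Complex R pi)" if "R > R0" for R
  proof -
    have R: "\<bar>Re p1\<bar> < R" "\<bar>Re p2\<bar> < R" using that by (auto simp: R0_def)
    show "p1 \<in> box (Complex (- R) (- pi)) (Complex R pi)" "p2 \<in> box (Complex (- R) (- pi)) (Complex R pi)"
      using R Im_p2 by (auto simp: in_box_complex_iff p1_def)
  qed
  have cboxS: "cbox (Complex (- R) (- pi)) (Complex R pi) \<subseteq> S" for R
    using c by (auto simp: in_cbox_complex_iff S_def)
  have img: "path_image (?P R) \<subseteq> S - {p1, p2}" if "R > R0" for R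
  proof -
    have "path_image (?P R) = cbox (Complex (- R) (- pi)) (Complex R pi) - box (Complex (- R) (- pi)) (Complex R pi)"
      using that R0 by (intro path_image_rectpath_cbox_minus_box) auto
    then show ?thesis using box[OF that] cboxS[of R] by auto
  qed
  have "contour_integral (?P R) f =
      2 * of_real pi * \<i> * (1 / (of_real (l powr s) - Complex a e) - spectral_point e / (of_real s * Complex a e) / (of_real l - spectral_point e))"
    if R: "R > R0" for R
  proof -
    have "contour_integral (?P R) f = 2 * pi * \<i> * (\<Sum>p\<in>{p1, p2}. winding_number (?P R) p * residue f p)"
    proof (rule Residue_theorem[OF S _ holo])
      show "\<forall>z. z \<notin> S \<longrightarrow> winding_number (?P R) z = 0"
        using cboxS[of R] R R0 by (auto intro!: winding_number_rectpath_outside)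
    qed (use img[OF R] in auto)
    also have "\<dots> = 2 * pi * \<i> * (residue f p1 + residue f p2)"
      using p12 winding_number_rectpath[OF box(1)[OF R]] winding_number_rectpath[OF box(2)[OF R]] by simp
    also have "residue f p2 = - (w / (of_real s * b) / (of_real l - w))"
      unfolding res2 using wl by (simp add: divide_simps) (simp add: algebra_simps)?
    finally show ?thesis unfolding res1 by (simp add: b_def w_def)
  qed
  moreover have "isCont f z" if "z \<in> path_image (?P R)" "R > R0" for R z
  proof -
    have "continuous_on (S - {p1, p2}) f" using holo by (rule holomorphic_on_imp_continuous_on)
    moreover have "open (S - {p1, p2})" using S(1) by auto
    ultimately show ?thesis using img[OF that(2)] that(1) continuous_on_eq_continuous_at by blast
  qed
  ultimately show ?thesis using that by blast
qed


text \<open>The two horizontal sides of the rectangle carry the boundary values on the two sides of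
  the cut. Their difference becomes the density integral under \<open>t = exp x\<close>, while the
  vertical sides vanish as the rectangle grows. The residues at \<open>ln l\<close> and
  \<open>Ln b / s\<close> give the symbol itself and the pole term.\<close>

theorem stieltjes_representation:
  assumes e: "0 < e" "e \<le> sin (pi * s) * a / 4" and l: "l > 0"
  shows "1 / (of_real (l powr s) - Complex a e) =
     spectral_point e / (of_real s * Complex a e) / (of_real l - spectral_point e)
     + (LINT t:{0<..}|lborel. spectral_density s (Complex a e) t / of_real (t + l))"
proof -
  define b where "b = Complex a e"
  define f where "f = (\<lambda>z. exp z / ((exp (of_real s * z) - Complex a e) * (exp z - complex_of_real l)))"
  define h where "h = (\<lambda>t. spectral_density s b t / of_real (t + l))"
  define V where "V = 1 / (of_real (l powr s) - b) - spectral_point e / (of_real s * b) / (of_real l - spectral_point e)"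
  have b0: "b \<noteq> 0" using a by (simp add: b_def complex_eq_iff)
  have e': "\<bar>e\<bar> \<le> sin (pi * s) * a / 4" using e by simp
  let ?P = "\<lambda>R. rectpath (Complex (- R) (- pi)) (Complex R pi)"
  obtain R0 where R0: "\<And>R. R > R0 \<Longrightarrow> contour_integral (?P R) f = 2 * of_real pi * \<i> * V"
    and cont: "\<And>R z. z \<in> path_image (?P R) \<Longrightarrow> R > R0 \<Longrightarrow> isCont f z"
    using contour_identity[OF e l f_def] unfolding V_def b_def by metis
  have h_cont: "continuous_on {0<..} h"
    unfolding h_def spectral_density_def b_def using denominator_nonzero[OF _ e'] l
    by (intro continuous_intros) (auto simp del: of_real_add)
  have jump: "f (of_real x - \<i> * of_real pi) - f (of_real x + \<i> * of_real pi) = 2 * of_real pi * \<i> * (exp x *\<^sub>R h (exp x))" for x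
  proof -
    let ?v = "exp x powr s"
    have ee: "exp (complex_of_real x - \<i> * of_real pi) = - of_real (exp x)" "exp (complex_of_real x + \<i> * of_real pi) = - of_real (exp x)"
      by (simp_all add: exp_diff exp_add exp_of_real)
    have es: "exp (of_real s * (complex_of_real x - \<i> * of_real pi)) = of_real ?v * cis (- (pi * s))"
      "exp (of_real s * (complex_of_real x + \<i> * of_real pi)) = of_real ?v * cis (pi * s)"
      by (simp_all add: powr_def cis_conv_exp exp_of_real[symmetric] exp_add[symmetric] algebra_simps)
    have nz: "of_real ?v * cis (pi * s) - b \<noteq> 0" "of_real ?v * cis (- (pi * s)) - b \<noteq> 0"
      unfolding b_def by (intro denominator_nonzero e'; simp)+
    have nl: "- of_real (exp x) - complex_of_real l \<noteq> 0" "complex_of_real (exp x) + of_real l \<noteq> 0"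
    proof -
      have "exp x + l > 0" using l by (simp add: add_pos_pos)
      then show "complex_of_real (exp x) + of_real l \<noteq> 0" by (metis of_real_add of_real_eq_0_iff less_irrefl)
      then show "- of_real (exp x) - complex_of_real l \<noteq> 0" by (metis add_uminus_conv_diff minus_add_distrib neg_0_equal_iff_equal add.inverse_neutral)
    qed
    have ed: "cis (pi * s) - cis (- (pi * s)) = 2 * \<i> * of_real (sin (pi * s))"
      by (simp add: complex_eq_iff)
    define A where "A = of_real ?v * cis (pi * s) - b"
    define B where "B = of_real ?v * cis (- (pi * s)) - b"
    define X where "X = complex_of_real (exp x)"
    have AB: "A - B = of_real ?v * (2 * \<i> * of_real (sin (pi * s)))"
      by (simp add: A_def B_def flip: ed) (simp add: algebra_simps)
    have "f (of_real x - \<i> * of_real pi) - f (of_real x + \<i> * of_real pi) = - X / (B * (- X - of_real l)) - - X / (A * (- X - of_real l))"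
      unfolding f_def ee es A_def B_def b_def[symmetric] X_def ..
    also have "\<dots> = X * (A - B) / (A * B * (X + of_real l))"
    proof -
      have "- X - of_real l = - (X + of_real l)" by simp
      then show ?thesis using nz nl unfolding A_def[symmetric] B_def[symmetric] X_def[symmetric]
        by (simp add: divide_simps) (simp add: algebra_simps)?
    qed
    also have "\<dots> = 2 * of_real pi * \<i> * (X * (of_real (sin (pi * s) / pi * ?v) / (A * B) / (X + of_real l)))"
      unfolding AB by (simp add: mult_ac)
    also have "\<dots> = 2 * of_real pi * \<i> * (exp x *\<^sub>R h (exp x))"
      unfolding h_def spectral_density_def A_def B_def X_def by (simp add: scaleR_conv_of_real)
    finally show ?thesis .
  qed
  have hint: "set_integrable lborel {0<..} h"
    using set_integrable_spectral_density_shift[OF e' l] by (simp add: h_def b_def)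
  \<comment> \<open>\<open>E R\<close> equals the contribution of the two vertical sides. Showing
    that it tends to 0 identifies \<open>V\<close> with the full density integral.\<close>
  define E where "E R = 2 * of_real pi * \<i> * (V - (LINT t:{exp (- R)..exp R}|lborel. h t))" for R
  \<comment> \<open>The size conditions on \<open>R\<close> keep each factor of the denominator at
    least half as large as its dominant term: the exponential on the right side, the constants
    \<open>b\<close> and \<open>l\<close> on the left side.\<close>
  have E: "norm (E R) \<le> 2 * pi * (4 * exp (- (s * R)) + 4 / (norm b * l) * exp (- R))"
    if R: "R > R0" "R > 0" "exp (s * R) \<ge> 2 * norm b" "exp R \<ge> 2 * l" "exp (- (s * R)) \<le> norm b / 2" "exp (- R) \<le> l / 2" for R
  proof -
    let ?a1 = "Complex (- R) (- pi)" and ?a2 = "Complex R (- pi)" and ?a3 = "Complex R pi" and ?a4 = "Complex (- R) pi"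
    have rp: "?P R = linepath ?a1 ?a2 +++ linepath ?a2 ?a3 +++ linepath ?a3 ?a4 +++ linepath ?a4 ?a1"
      by (simp add: rectpath_def Let_def)
    have pim: "path_image (?P R) = closed_segment ?a1 ?a2 \<union> closed_segment ?a2 ?a3 \<union> closed_segment ?a3 ?a4 \<union> closed_segment ?a4 ?a1"
      by (simp add: rp path_image_join Un_assoc)
    have cs: "continuous_on (closed_segment ?a1 ?a2) f" "continuous_on (closed_segment ?a2 ?a3) f"
      "continuous_on (closed_segment ?a3 ?a4) f" "continuous_on (closed_segment ?a4 ?a1) f"
      using cont[OF _ R(1)] unfolding pim by (auto intro!: continuous_at_imp_continuous_on)
    note ci = cs[THEN contour_integrable_continuous_linepath]
    have sum: "contour_integral (?P R) f = contour_integral (linepath ?a1 ?a2) f + contour_integral (linepath ?a2 ?a3) f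
       + contour_integral (linepath ?a3 ?a4) f + contour_integral (linepath ?a4 ?a1) f"
      unfolding rp using ci by (simp add: contour_integral_join contour_integrable_join)
    have bot: "contour_integral (linepath ?a1 ?a2) f = integral {- R..R} (\<lambda>x. f (of_real x - \<i> * of_real pi))"
      using contour_integral_linepath_horizontal[of "- R" R "- \<i> * of_real pi" f] R(2)
      by (simp add: Complex_eq)
    have top: "contour_integral (linepath ?a3 ?a4) f = - integral {- R..R} (\<lambda>x. f (of_real x + \<i> * of_real pi))"
    proof -
      have "contour_integral (linepath ?a3 ?a4) f = - contour_integral (linepath ?a4 ?a3) f"
        using cs(3) by (metis contour_integral_reverse_linepath closed_segment_commute minus_minus)
      then show ?thesis
        using contour_integral_linepath_horizontal[of "- R" R "\<i> * of_real pi" f] R(2)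
        by (simp add: Complex_eq)
    qed
    have int_bt: "(\<lambda>x. f (of_real x - \<i> * of_real pi)) integrable_on {- R..R}" "(\<lambda>x. f (of_real x + \<i> * of_real pi)) integrable_on {- R..R}"
    proof -
      have "continuous_on {- R..R} (\<lambda>x. f (of_real x - \<i> * of_real pi))"
        by (rule continuous_on_compose2[OF cs(1)])
          (auto intro!: continuous_intros simp: closed_segment_same_Im closed_segment_eq_real_ivl)
      moreover have "continuous_on {- R..R} (\<lambda>x. f (of_real x + \<i> * of_real pi))"
        by (rule continuous_on_compose2[OF cs(3)])
          (auto intro!: continuous_intros simp: closed_segment_same_Im closed_segment_eq_real_ivl)
      ultimately show "(\<lambda>x. f (of_real x - \<i> * of_real pi)) integrable_on {- R..R}" "(\<lambda>x. f (of_real x + \<i> * of_real pi)) integrable_on {- R..R}"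
        by (auto intro: integrable_continuous_real)
    qed
    have "integral {- R..R} (\<lambda>x. f (of_real x - \<i> * of_real pi)) - integral {- R..R} (\<lambda>x. f (of_real x + \<i> * of_real pi))
       = integral {- R..R} (\<lambda>x. 2 * of_real pi * \<i> * (exp x *\<^sub>R h (exp x)))"
      by (subst integral_diff[symmetric, OF int_bt]) (simp add: jump)
    also have "\<dots> = 2 * of_real pi * \<i> * integral {- R..R} (\<lambda>x. exp x *\<^sub>R h (exp x))"
      by (rule integral_mult_right)
    also have "integral {- R..R} (\<lambda>x. exp x *\<^sub>R h (exp x)) = integral {exp (- R)..exp R} h"
      by (rule integral_unique, rule has_integral_substitution[where c = "exp (- R)" and d = "exp R"])
        (use R(2) in \<open>auto intro!: derivative_eq_intros continuous_on_subset[OF h_cont] simp: has_real_derivative_iff_has_vector_derivative[symmetric] intro: less_le_trans[OF exp_gt_zero]\<close>)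
    also have "\<dots> = (LINT t:{exp (- R)..exp R}|lborel. h t)"
      by (rule set_borel_integral_eq_integral(2)[symmetric], rule set_integrable_subset[OF hint])
        (auto intro: less_le_trans[OF exp_gt_zero])
    finally have "E R = contour_integral (linepath ?a2 ?a3) f + contour_integral (linepath ?a4 ?a1) f"
      using sum R0[OF R(1)] unfolding E_def bot top by (simp add: algebra_simps)
    also have "norm \<dots> \<le> 4 * exp (- (s * R)) * norm (?a3 - ?a2) + 4 / (norm b * l) * exp (- R) * norm (?a1 - ?a4)"
    proof (rule order_trans[OF norm_triangle_ineq], rule add_mono; rule contour_integral_bound_linepath)
      fix z assume "z \<in> closed_segment ?a2 ?a3"
      then have z: "Re z = R" by (auto simp: closed_segment_same_Re)
      have "exp (s * R) / 2 \<le> norm (exp (of_real s * z) - b)"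
        using norm_triangle_ineq2[of "exp (of_real s * z)" b] R(3) z by simp
      moreover have "exp R / 2 \<le> norm (exp z - of_real l)"
        using norm_triangle_ineq2[of "exp z" "of_real l"] R(4) z l by simp
      ultimately have "norm (f z) \<le> exp R / (exp (s * R) / 2 * (exp R / 2))"
        unfolding f_def norm_divide norm_mult b_def[symmetric] using z by (intro frac_le mult_mono) auto
      then show "norm (f z) \<le> 4 * exp (- (s * R))" by (simp add: exp_minus field_simps)
    next
      fix z assume "z \<in> closed_segment ?a4 ?a1"
      then have z: "Re z = - R" by (auto simp: closed_segment_same_Re)
      have "norm b / 2 \<le> norm (exp (of_real s * z) - b)"
        using norm_triangle_ineq2[of b "exp (of_real s * z)"] R(5) z by (simp add: norm_minus_commute)
      moreover have "l / 2 \<le> norm (exp z - of_real l)"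
        using norm_triangle_ineq2[of "of_real l" "exp z"] R(6) z l by (simp add: norm_minus_commute)
      ultimately have "norm (f z) \<le> exp (- R) / (norm b / 2 * (l / 2))"
        unfolding f_def norm_divide norm_mult b_def[symmetric] using z l b0 by (intro frac_le mult_mono) auto
      then show "norm (f z) \<le> 4 / (norm b * l) * exp (- R)" by (simp add: field_simps)
    qed (use ci l in auto)
    also have "\<dots> = 2 * pi * (4 * exp (- (s * R)) + 4 / (norm b * l) * exp (- R))"
    proof -
      have "?a3 - ?a2 = \<i> * of_real (2 * pi)" "?a1 - ?a4 = - (\<i> * of_real (2 * pi))"
        by (simp_all add: complex_eq_iff)
      then have "norm (?a3 - ?a2) = 2 * pi" "norm (?a1 - ?a4) = 2 * pi"
        by (simp_all only: norm_minus_cancel norm_mult norm_of_real norm_ii) auto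
      then show ?thesis by (simp only: distrib_left mult_ac)
    qed
    finally show ?thesis .
  qed
  have lim0: "(\<lambda>n. exp (- (s * real n))) \<longlonglongrightarrow> 0" "(\<lambda>n. exp (- real n)) \<longlonglongrightarrow> 0"
    using s by real_asymp+
  have "(\<lambda>n. E (real n)) \<longlonglongrightarrow> 0"
  proof (rule Lim_null_comparison)
    have ev1: "eventually (\<lambda>n. exp (- (s * real n)) < norm b / 2 \<and> exp (- real n) < l / 2 \<and> exp (- (s * real n)) < 1 / (2 * norm b) \<and> exp (- real n) < 1 / (2 * l)) sequentially"
      using lim0 b0 l by (intro eventually_conj; intro order_tendstoD) auto
    have ev2: "eventually (\<lambda>n. real n > R0 \<and> real n > 0) sequentially"
      by (intro eventually_conj eventually_gt_at_top filterlim_real_sequentially[unfolded filterlim_at_top_dense, rule_format])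
    show "eventually (\<lambda>n. norm (E (real n)) \<le> 2 * pi * (4 * exp (- (s * real n)) + 4 / (norm b * l) * exp (- real n))) sequentially"
      using ev1 ev2
    proof eventually_elim
      case (elim n)
      then show ?case using b0 l by (intro E) (auto simp: exp_minus field_simps)
    qed
    have "(\<lambda>n. 2 * pi * (4 * exp (- (s * real n)) + 4 / (norm b * l) * exp (- real n))) \<longlonglongrightarrow> 2 * pi * (4 * 0 + 4 / (norm b * l) * 0)"
      by (intro tendsto_intros lim0)
    then show "(\<lambda>n. 2 * pi * (4 * exp (- (s * real n)) + 4 / (norm b * l) * exp (- real n))) \<longlonglongrightarrow> 0" by simp
  qed
  moreover have "(\<lambda>n. E (real n)) \<longlonglongrightarrow> 2 * of_real pi * \<i> * (V - (LINT t:{0<..}|lborel. h t))"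
  proof -
    have "(\<lambda>n. LINT t:{exp (- real n)..exp (real n)}|lborel. h t) \<longlonglongrightarrow> (LINT t:{0<..}|lborel. h t)"
      unfolding set_lebesgue_integral_def
    proof (rule integral_dominated_convergence[where w = "\<lambda>t. norm (indicator {0<..} t *\<^sub>R h t)"])
      have [measurable]: "h \<in> borel_measurable borel" unfolding h_def by measurable
      show "(\<lambda>t. indicator {0<..} t *\<^sub>R h t) \<in> borel_measurable lborel"
        "\<And>n. (\<lambda>t. indicator {exp (- real n)..exp (real n)} t *\<^sub>R h t) \<in> borel_measurable lborel" by measurable
      show "integrable lborel (\<lambda>t. norm (indicator {0<..} t *\<^sub>R h t))"
        using hint by (simp add: set_integrable_def integrable_norm del: norm_scaleR)
      show "AE t in lborel. (\<lambda>n. indicator {exp (- real n)..exp (real n)} t *\<^sub>R h t) \<longlonglongrightarrow> indicator {0<..} t *\<^sub>R h t"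
      proof (rule AE_I2)
        fix t :: real
        show "(\<lambda>n. indicator {exp (- real n)..exp (real n)} t *\<^sub>R h t) \<longlonglongrightarrow> indicator {0<..} t *\<^sub>R h t"
        proof (cases "t > 0")
          case True
          have "eventually (\<lambda>n. exp (- real n) < t \<and> exp (- real n) < 1 / t) sequentially"
            using lim0(2) True by (intro eventually_conj; intro order_tendstoD) auto
          then have "eventually (\<lambda>n. indicator {exp (- real n)..exp (real n)} t *\<^sub>R h t = indicator {0<..} t *\<^sub>R h t) sequentially"
            by eventually_elim (use True in \<open>auto simp: indicator_def exp_minus field_simps\<close>)
          then show ?thesis by (rule tendsto_eventually)
        next
          case False
          then have "t < exp (- real n)" for n using less_le_trans[OF exp_gt_zero, of _ t] by (meson not_less)
          then show ?thesis using False by (auto simp: indicator_def not_le intro!: tendsto_eventually always_eventually)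
        qed
      qed
      show "\<And>n. AE t in lborel. norm (indicator {exp (- real n)..exp (real n)} t *\<^sub>R h t) \<le> norm (indicator {0<..} t *\<^sub>R h t)"
        by (auto simp: indicator_def intro: less_le_trans[OF exp_gt_zero])
    qed
    then show ?thesis unfolding E_def by (intro tendsto_intros)
  qed
  ultimately have "2 * of_real pi * \<i> * (V - (LINT t:{0<..}|lborel. h t)) = 0"
    by (rule LIMSEQ_unique[symmetric])
  then have "V = (LINT t:{0<..}|lborel. h t)" by simp
  then show ?thesis unfolding V_def h_def b_def by (simp only: diff_eq_eq add.commute)
qed

end

subsection \<open>The outgoing fundamental solution\<close>

text \<open>The estimate of \<open>resolvent_reg_bound\<close> is uniform in \<open>d\<close> and
  survives the limit. The decay \<open>1 / t\<close> matches the integrability of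
  \<open>envelope t / t\<close>.\<close>

lemma yukawa_bound:
  fixes x :: "'a::euclidean_space"
  assumes "x \<noteq> 0"
  obtains C where "C > 0" "\<And>t. t > 0 \<Longrightarrow> \<bar>yukawa DIM('a) (norm x) t\<bar> \<le> C / t"
proof -
  obtain C where C: "C > 0" "\<And>d t. d > 0 \<Longrightarrow> t > 0 \<Longrightarrow> norm (resolvent_reg x d (of_real t)) \<le> C / t"
    using resolvent_reg_bound[OF assms] by blast
  have "\<bar>yukawa DIM('a) (norm x) t\<bar> \<le> C / t" if t: "t > 0" for t
  proof -
    have "((\<lambda>d. resolvent_reg x d (of_real t)) \<longlongrightarrow> green x (of_real t)) (at_right 0)"
      using t assms by (intro resolvent_reg_tendsto) auto
    then have "norm (green x (of_real t)) \<le> C / t"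
      by (rule Lim_norm_ubound[rotated]) (auto intro!: eventually_at_rightI[of 0 1] C t)
    then show ?thesis using green_of_real[OF assms t] by simp
  qed
  with C(1) that show ?thesis by blast
qed

context symbol begin

text \<open>A majorant of the density that does not depend on \<open>e\<close> in the admissible
  range, so that one function dominates both the limit \<open>d -> 0\<close> and the limit
  \<open>e -> 0\<close>.\<close>

definition envelope :: "real \<Rightarrow> real" where
  "envelope t = 16 / (pi * sin (pi * s)) * (t powr s / (t powr s + a)\<^sup>2)"

lemma envelope:
  assumes "t \<ge> 0" "\<bar>e\<bar> \<le> sin (pi * s) * a / 4"
  shows "norm (spectral_density s (Complex a e) t) \<le> envelope t"
  unfolding envelope_def by (rule spectral_density_bound[OF assms])

lemma envelope_nonneg: "0 \<le> envelope t"
  using sin_pos by (simp add: envelope_def)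

lemma envelope_bounds:
  assumes "t > 0"
  shows "envelope t \<le> 16 / (pi * sin (pi * s)) / a\<^sup>2 * t powr s"
    and "envelope t \<le> 16 / (pi * sin (pi * s)) * t powr (- s)"
proof -
  let ?v = "t powr s" and ?K = "16 / (pi * sin (pi * s))"
  have K: "?K \<ge> 0" using sin_pos by simp
  have v: "?v > 0" using assms by simp
  have "?v / (?v + a)\<^sup>2 \<le> ?v / a\<^sup>2"
    using v a by (intro frac_le power_mono) auto
  from mult_left_mono[OF this K] show "envelope t \<le> ?K / a\<^sup>2 * t powr s"
    by (simp add: envelope_def)
  have "?v / (?v + a)\<^sup>2 \<le> ?v / ?v\<^sup>2"
    using v a by (intro frac_le power_mono) auto
  also have "\<dots> = t powr (- s)" using v by (simp add: power2_eq_square powr_minus field_simps)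
  finally show "envelope t \<le> ?K * t powr (- s)"
    unfolding envelope_def using K by (rule mult_left_mono)
qed

lemma envelope_measurable [measurable]: "envelope \<in> borel_measurable borel"
  unfolding envelope_def by measurable

lemma set_integrable_envelope: "set_integrable lborel {0<..} (\<lambda>t. envelope t / t)"
proof (rule set_integrable_two_powers)
  show "norm (envelope t / t) \<le> 16 / (pi * sin (pi * s)) / a\<^sup>2 * t powr (s - 1)" if "0 < t" for t
    using divide_right_mono[OF envelope_bounds(1)[OF that], of t] that envelope_nonneg[of t]
    by (simp add: powr_diff)
  show "norm (envelope t / t) \<le> 16 / (pi * sin (pi * s)) * t powr (- s - 1)" if "1 \<le> t" for t
    using divide_right_mono[OF envelope_bounds(2)[of t], of t] that envelope_nonneg[of t]
    by (simp add: powr_diff)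
qed (use s in auto)

text \<open>The Stieltjes representation is inserted at \<open>l = (norm \<xi>)\<^sup>2\<close>
  under the Gaussian integral, and the \<open>t\<close>-integral is pulled out by Fubini with the
  majorant \<open>envelope t / t\<close> times a Gaussian.\<close>

lemma regularised_symbol:
  fixes x :: "'a::euclidean_space" and k :: real
  assumes e: "0 < e" "e \<le> sin (pi * s) * a / 4" and d: "d > 0" and ak: "a = k powr (2 * s)"
  shows "complex_of_real (1 / (2 * pi) ^ DIM('a)) *
      integral UNIV (\<lambda>\<xi>. cis (x \<bullet> \<xi>) * complex_of_real (exp (- d * norm \<xi> ^ 2)) *
        (1 / (complex_of_real (norm \<xi> powr (2 * s) - k powr (2 * s)) - \<i> * complex_of_real e)))
    = spectral_point e / (of_real s * Complex a e) * resolvent_reg x d (- spectral_point e)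
      + (LINT t:{0<..}|lborel. spectral_density s (Complex a e) t * resolvent_reg x d (of_real t))"
proof -
  define b where "b = Complex a e"
  define w where "w = spectral_point e"
  define g where "g = (\<lambda>\<xi>::'a. 1 / (complex_of_real (norm \<xi> powr (2 * s) - k powr (2 * s)) - \<i> * complex_of_real e))"
  define G where "G = (\<lambda>\<xi>::'a. cis (x \<bullet> \<xi>) * complex_of_real (exp (- d * (norm \<xi>)\<^sup>2)))"
  define H where "H = (\<lambda>\<xi>::'a. LINT t:{0<..}|lborel. spectral_density s b t / of_real (t + (norm \<xi>)\<^sup>2))"
  have gm: "g \<in> borel_measurable borel" unfolding g_def by measurable
  have gb: "norm (g \<xi>) \<le> 1 / e" for \<xi>
  proof -
    have "e \<le> norm (complex_of_real (norm \<xi> powr (2 * s) - k powr (2 * s)) - \<i> * complex_of_real e)"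
      using abs_Im_le_cmod[of "complex_of_real (norm \<xi> powr (2 * s) - k powr (2 * s)) - \<i> * complex_of_real e"] e by simp
    then show ?thesis unfolding g_def norm_divide using e by (simp add: frac_le)
  qed
  have ig: "integrable lborel (\<lambda>\<xi>. G \<xi> * g \<xi>)"
    unfolding G_def by (rule integrable_fourier_gauss_bounded[OF d gm gb])
  have Imw: "Im w > 0" using Im_spectral_point[OF e] by (simp add: w_def)
  then have slit: "- w \<notin> \<real>\<^sub>\<le>\<^sub>0" by (auto simp: complex_nonpos_Reals_iff)
  have iw: "integrable lborel (\<lambda>\<xi>. G \<xi> * (1 / (of_real ((norm \<xi>)\<^sup>2) + (- w))))"
    unfolding G_def by (rule integrable_resolvent_reg[OF d slit])
  have split: "G \<xi> * g \<xi> = w / (of_real s * b) * (G \<xi> * (1 / (of_real ((norm \<xi>)\<^sup>2) + (- w)))) + G \<xi> * H \<xi>" if "\<xi> \<noteq> 0" for \<xi>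
  proof -
    have "g \<xi> = 1 / (of_real (((norm \<xi>)\<^sup>2) powr s) - b)"
    proof -
      have "((norm \<xi>)\<^sup>2) powr s = norm \<xi> powr (2 * s)"
        using that by (simp add: powr_powr[symmetric])
      then show ?thesis by (simp add: g_def b_def Complex_eq ak algebra_simps)
    qed
    also have "\<dots> = w / (of_real s * b) / (of_real ((norm \<xi>)\<^sup>2) - w) + H \<xi>"
      using stieltjes_representation[OF e, of "(norm \<xi>)\<^sup>2"] that by (simp add: H_def w_def b_def)
    finally have "g \<xi> = w / (of_real s * b) / (of_real ((norm \<xi>)\<^sup>2) - w) + H \<xi>" .
    then show ?thesis by (simp add: distrib_left)
  qed
  have [measurable]: "G \<in> borel_measurable borel" unfolding G_def by measurable
  have [measurable]: "H \<in> borel_measurable borel"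
    unfolding H_def set_lebesgue_integral_def by measurable
  note [measurable] = gm
  have e': "\<bar>e\<bar> \<le> sin (pi * s) * a / 4" using e by simp
  have AE0: "AE \<xi> in lborel. \<xi> \<noteq> (0::'a)" by (rule AE_lborel_singleton)
  have "integral UNIV (\<lambda>\<xi>. G \<xi> * g \<xi>) = (LINT \<xi>|lborel. G \<xi> * g \<xi>)"
    by (rule integral_lborel[OF ig])
  also have "\<dots> = w / (of_real s * b) * (LINT \<xi>|lborel. G \<xi> * (1 / (of_real ((norm \<xi>)\<^sup>2) + (- w)))) + (LINT \<xi>|lborel. G \<xi> * H \<xi>)"
  proof -
    \<comment> \<open>The product \<open>G * H\<close> agrees off the null set \<open>{0}\<close>
      with the difference of two integrable functions, so its integral is read off from
      theirs.\<close>
    have "(LINT \<xi>|lborel. G \<xi> * H \<xi>) = (LINT \<xi>|lborel. G \<xi> * g \<xi> - w / (of_real s * b) * (G \<xi> * (1 / (of_real ((norm \<xi>)\<^sup>2) + (- w)))))"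
      using AE0 split by (intro integral_cong_AE) auto
    also have "\<dots> = (LINT \<xi>|lborel. G \<xi> * g \<xi>) - w / (of_real s * b) * (LINT \<xi>|lborel. G \<xi> * (1 / (of_real ((norm \<xi>)\<^sup>2) + (- w))))"
      by (subst Bochner_Integration.integral_diff[OF ig integrable_mult_right[OF iw]]) (simp only: integral_mult_right_zero)
    finally show ?thesis by simp
  qed
  also have "(LINT \<xi>|lborel. G \<xi> * H \<xi>) = (LINT \<xi>|lborel. LINT t|lborel. indicator {0<..} t *\<^sub>R (spectral_density s b t * (G \<xi> * (1 / (of_real ((norm \<xi>)\<^sup>2) + of_real t)))))"
    unfolding H_def set_lebesgue_integral_def
    by (subst integral_mult_right_zero[symmetric]) (simp add: scaleR_conv_of_real mult_ac add.commute)
  also have "\<dots> = (LINT t|lborel. LINT \<xi>|lborel. indicator {0<..} t *\<^sub>R (spectral_density s b t * (G \<xi> * (1 / (of_real ((norm \<xi>)\<^sup>2) + of_real t)))))"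
  proof (rule fubini_product_bound(1)[symmetric])
    show "integrable lborel (\<lambda>t. indicator {0<..} t *\<^sub>R (envelope t / t))"
      using set_integrable_envelope by (simp add: set_integrable_def)
    show "integrable lborel (\<lambda>\<xi>::'a. exp (- d * (norm \<xi>)\<^sup>2))" by (rule integrable_gauss[OF d])
    show "norm (indicator {0<..} t *\<^sub>R (spectral_density s b t * (G \<xi> * (1 / (of_real ((norm \<xi>)\<^sup>2) + of_real t)))))
      \<le> indicator {0<..} t *\<^sub>R (envelope t / t) * exp (- d * (norm \<xi>)\<^sup>2)" for t \<xi>
    proof (cases "t > 0")
      case True
      have "norm (complex_of_real ((norm \<xi>)\<^sup>2) + of_real t) = (norm \<xi>)\<^sup>2 + t"
        using True by (simp flip: of_real_add of_real_power)
      moreover have "norm (spectral_density s b t) / ((norm \<xi>)\<^sup>2 + t) \<le> envelope t / t"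
        using True envelope[OF _ e', of t] envelope_nonneg[of t] by (intro frac_le) (auto simp: b_def)
      ultimately show ?thesis
        using True mult_right_mono[of "norm (spectral_density s b t) / ((norm \<xi>)\<^sup>2 + t)" "envelope t / t" "exp (- d * (norm \<xi>)\<^sup>2)"]
        by (simp add: norm_mult norm_divide G_def del: of_real_power)
    qed auto
  qed measurable
  also have "\<dots> = (LINT t:{0<..}|lborel. spectral_density s b t * (LINT \<xi>|lborel. G \<xi> * (1 / (of_real ((norm \<xi>)\<^sup>2) + of_real t))))"
    unfolding set_lebesgue_integral_def by (simp only: integral_scaleR_right integral_mult_right_zero)
  finally have "complex_of_real (1 / (2 * pi) ^ DIM('a)) * integral UNIV (\<lambda>\<xi>. G \<xi> * g \<xi>)
     = complex_of_real (1 / (2 * pi) ^ DIM('a)) * (w / (of_real s * b) * (LINT \<xi>|lborel. G \<xi> * (1 / (of_real ((norm \<xi>)\<^sup>2) + (- w)))) 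
       + (LINT t:{0<..}|lborel. spectral_density s b t * (LINT \<xi>|lborel. G \<xi> * (1 / (of_real ((norm \<xi>)\<^sup>2) + of_real t)))))"
    by (rule arg_cong)
  also have "\<dots> = w / (of_real s * b) * resolvent_reg x d (- w)
     + (LINT t:{0<..}|lborel. spectral_density s b t * resolvent_reg x d (of_real t))"
  proof -
    define c where "c = complex_of_real (1 / (2 * pi) ^ DIM('a))"
    define R where "R = (\<lambda>t. LINT \<xi>|lborel. G \<xi> * (1 / (of_real ((norm \<xi>)\<^sup>2) + t)))"
    have "resolvent_reg x d t = c * R t" for t
      by (simp only: resolvent_reg_def R_def G_def c_def)
    moreover have "(LINT t:{0<..}|lborel. spectral_density s b t * (c * R (of_real t))) = c * (LINT t:{0<..}|lborel. spectral_density s b t * R (of_real t))"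
      by (simp only: mult.left_commute[of _ c] set_integral_mult_right)
    ultimately show ?thesis
      unfolding c_def[symmetric] by (simp only: R_def distrib_left mult.left_commute[of _ c])
  qed
  finally show ?thesis unfolding G_def g_def w_def b_def .
qed

text \<open>The limit \<open>d -> 0\<close> in \<open>regularised_symbol\<close>: the pole term
  converges because the spectral point is not real, the integral by domination with
  \<open>C * (envelope t / t)\<close>.\<close>

lemma G_eps_eq:
  fixes x :: "'a::euclidean_space"
  assumes e: "0 < e" "e \<le> sin (pi * s) * a / 4" and ak: "a = k powr (2 * s)" and x: "x \<noteq> 0"
  shows "G_eps s k e x = spectral_point e / (of_real s * Complex a e) * green x (- spectral_point e)
      + (LINT t:{0<..}|lborel. spectral_density s (Complex a e) t * of_real (yukawa DIM('a) (norm x) t))"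
proof -
  have e': "\<bar>e\<bar> \<le> sin (pi * s) * a / 4" using e by simp
  obtain C where C: "C > 0" "\<And>d t. d > 0 \<Longrightarrow> t > 0 \<Longrightarrow> norm (resolvent_reg x d (of_real t)) \<le> C / t"
    using resolvent_reg_bound[OF x] by blast
  have slit: "- spectral_point e \<notin> \<real>\<^sub>\<le>\<^sub>0" using Im_spectral_point[OF e] by (auto simp: complex_nonpos_Reals_iff)
  have [measurable]: "(\<lambda>t. resolvent_reg x d (of_real t)) \<in> borel_measurable borel" for d
    unfolding resolvent_reg_def by measurable
  have "((\<lambda>d. LINT t:{0<..}|lborel. spectral_density s (Complex a e) t * resolvent_reg x d (of_real t)) \<longlongrightarrow>
      (LINT t:{0<..}|lborel. spectral_density s (Complex a e) t * of_real (yukawa DIM('a) (norm x) t))) (at_right 0)"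
    unfolding set_lebesgue_integral_def
  proof (rule tendsto_integral_at_right[of 0 1])
    show "integrable lborel (\<lambda>t. C * (indicator {0<..} t *\<^sub>R (envelope t / t)))"
      using set_integrable_envelope by (intro integrable_mult_right) (simp add: set_integrable_def)
    show "norm (indicator {0<..} t *\<^sub>R (spectral_density s (Complex a e) t * resolvent_reg x d (of_real t)))
      \<le> C * (indicator {0<..} t *\<^sub>R (envelope t / t))" if "0 < d" for d t
    proof (cases "t > 0")
      case True
      have "norm (spectral_density s (Complex a e) t) * norm (resolvent_reg x d (of_real t)) \<le> envelope t * (C / t)"
        using True by (intro mult_mono envelope e' C that envelope_nonneg) auto
      then show ?thesis using True by (simp add: norm_mult mult.commute)
    qed auto
    show "((\<lambda>d. indicator {0<..} t *\<^sub>R (spectral_density s (Complex a e) t * resolvent_reg x d (of_real t))) \<longlongrightarrow>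
       indicator {0<..} t *\<^sub>R (spectral_density s (Complex a e) t * of_real (yukawa DIM('a) (norm x) t))) (at_right 0)" for t
    proof (cases "t > 0")
      case True
      have "((\<lambda>d. resolvent_reg x d (of_real t)) \<longlongrightarrow> green x (of_real t)) (at_right 0)"
        using True x by (intro resolvent_reg_tendsto) auto
      then show ?thesis unfolding green_of_real[OF x True] by (intro tendsto_intros)
    qed auto
  qed (auto intro: measurable_compose)
  then have "((\<lambda>d. spectral_point e / (of_real s * Complex a e) * resolvent_reg x d (- spectral_point e)
      + (LINT t:{0<..}|lborel. spectral_density s (Complex a e) t * resolvent_reg x d (of_real t)))
     \<longlongrightarrow> spectral_point e / (of_real s * Complex a e) * green x (- spectral_point e)
      + (LINT t:{0<..}|lborel. spectral_density s (Complex a e) t * of_real (yukawa DIM('a) (norm x) t))) (at_right 0)"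
    by (intro tendsto_intros resolvent_reg_tendsto x slit)
  then have "((\<lambda>d. complex_of_real (1 / (2 * pi) ^ DIM('a)) *
      integral UNIV (\<lambda>\<xi>. cis (x \<bullet> \<xi>) * complex_of_real (exp (- d * norm \<xi> ^ 2)) *
        (1 / (complex_of_real (norm \<xi> powr (2 * s) - k powr (2 * s)) - \<i> * complex_of_real e))))
     \<longlongrightarrow> spectral_point e / (of_real s * Complex a e) * green x (- spectral_point e)
      + (LINT t:{0<..}|lborel. spectral_density s (Complex a e) t * of_real (yukawa DIM('a) (norm x) t))) (at_right 0)"
    by (rule Lim_transform_eventually)
      (rule eventually_at_rightI[of 0 1], use regularised_symbol[OF e _ ak, of _ x] in auto)
  then show ?thesis
    unfolding G_eps_def fourier_inv_def by (intro tendsto_Lim trivial_limit_at_right_real)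
qed

text \<open>The assumption on \<open>L\<close> isolates the limit of the pole term, the only
  ingredient that depends on an explicit formula in each dimension. The density integral passes to
  \<open>e = 0\<close> by the same majorant as before.\<close>

lemma G_out_eq:
  fixes x :: "'a::euclidean_space"
  assumes ak: "a = k powr (2 * s)" and x: "x \<noteq> 0"
    and L: "((\<lambda>e. spectral_point e / (of_real s * Complex a e) * green x (- spectral_point e)) \<longlongrightarrow> L) (at_right 0)"
  shows "G_out s k x = L + (LINT t:{0<..}|lborel. spectral_density s (of_real a) t * of_real (yukawa DIM('a) (norm x) t))"
proof -
  define e0 where "e0 = sin (pi * s) * a / 4"
  have e0: "e0 > 0" using sin_pos a unfolding e0_def by (intro divide_pos_pos mult_pos_pos) auto
  obtain C where C: "C > 0" "\<And>t. t > 0 \<Longrightarrow> \<bar>yukawa DIM('a) (norm x) t\<bar> \<le> C / t"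
    using yukawa_bound[OF x] by blast
  have a0: "complex_of_real a = Complex a 0" by (rule complex_of_real_def)
  have "((\<lambda>e. LINT t:{0<..}|lborel. spectral_density s (Complex a e) t * of_real (yukawa DIM('a) (norm x) t)) \<longlongrightarrow>
      (LINT t:{0<..}|lborel. spectral_density s (of_real a) t * of_real (yukawa DIM('a) (norm x) t))) (at_right 0)"
    unfolding set_lebesgue_integral_def
  proof (rule tendsto_integral_at_right[OF e0])
    show "integrable lborel (\<lambda>t. C * (indicator {0<..} t *\<^sub>R (envelope t / t)))"
      using set_integrable_envelope by (intro integrable_mult_right) (simp add: set_integrable_def)
    show "norm (indicator {0<..} t *\<^sub>R (spectral_density s (Complex a e) t * of_real (yukawa DIM('a) (norm x) t)))
      \<le> C * (indicator {0<..} t *\<^sub>R (envelope t / t))" if "0 < e" "e < e0" for e t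
    proof (cases "t > 0")
      case True
      have "norm (spectral_density s (Complex a e) t) * \<bar>yukawa DIM('a) (norm x) t\<bar> \<le> envelope t * (C / t)"
        using True that by (intro mult_mono envelope C that envelope_nonneg) (auto simp: e0_def)
      then show ?thesis using True by (simp add: norm_mult mult.commute)
    qed auto
    show "((\<lambda>e. indicator {0<..} t *\<^sub>R (spectral_density s (Complex a e) t * of_real (yukawa DIM('a) (norm x) t))) \<longlongrightarrow>
       indicator {0<..} t *\<^sub>R (spectral_density s (of_real a) t * of_real (yukawa DIM('a) (norm x) t))) (at_right 0)" for t
      unfolding a0 spectral_density_def
      by (intro tendsto_intros no_zero_divisors denominator_nonzero) (use sin_pos a in auto)
  qed (auto intro: measurable_compose)
  from tendsto_add[OF L this] have "((\<lambda>e. G_eps s k e x) \<longlongrightarrow> L + (LINT t:{0<..}|lborel. spectral_density s (of_real a) t * of_real (yukawa DIM('a) (norm x) t))) (at_right 0)"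
    by (rule Lim_transform_eventually)
      (rule eventually_at_rightI[OF _ e0], use G_eps_eq[OF _ _ ak x] in \<open>auto simp: e0_def\<close>)
  then show ?thesis
    unfolding G_out_def by (intro tendsto_Lim trivial_limit_at_right_real)
qed

end

subsection \<open>Explicit Green functions of the Laplacian in dimensions one, two and three\<close>

text \<open>A quadratic remainder with an integrable weight makes the difference quotient converge
  directly. The field is left general: the lemma serves holomorphy in the complex \<open>t\<close>
  as well as differentiation in the real \<open>y\<close> of \<open>macdonald\<close>.\<close>

lemma has_field_derivative_integral:
  fixes f :: "'b::{real_normed_field, banach, second_countable_topology} \<Rightarrow> 'a::euclidean_space \<Rightarrow> 'b"
  assumes r: "r > 0"
    and f: "\<And>h. norm h < r \<Longrightarrow> integrable M (f (t + h))"
    and f': "integrable M f'" and w: "integrable M w"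
    and bound: "\<And>h \<omega>. norm h < r \<Longrightarrow> norm (f (t + h) \<omega> - f t \<omega> - h * f' \<omega>) \<le> (norm h)\<^sup>2 * w \<omega>"
  shows "((\<lambda>z. LINT \<omega>|M. f z \<omega>) has_field_derivative (LINT \<omega>|M. f' \<omega>)) (at t)"
  unfolding DERIV_def
proof (rule LIM_zero_cancel, rule Lim_null_comparison)
  show "\<forall>\<^sub>F h in at 0. norm (((LINT \<omega>|M. f (t + h) \<omega>) - (LINT \<omega>|M. f t \<omega>)) / h - (LINT \<omega>|M. f' \<omega>))
      \<le> norm h * (LINT \<omega>|M. w \<omega>)"
    unfolding eventually_at
  proof (intro exI[of _ r] conjI ballI impI r)
    fix h :: 'b assume h: "h \<noteq> 0 \<and> dist h 0 < r"
    then have hr: "norm h < r" by simp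
    have ft: "integrable M (f t)" using f[of 0] r by simp
    have "(LINT \<omega>|M. f (t + h) \<omega>) - (LINT \<omega>|M. f t \<omega>) - h * (LINT \<omega>|M. f' \<omega>) = (LINT \<omega>|M. f (t + h) \<omega> - f t \<omega> - h * f' \<omega>)"
      using f[OF hr] ft f' by simp
    also have "norm \<dots> \<le> (LINT \<omega>|M. (norm h)\<^sup>2 * w \<omega>)"
      using f[OF hr] ft f' w bound[OF hr] by (intro Bochner_Integration.integral_norm_bound_integral) auto
    finally have "norm ((LINT \<omega>|M. f (t + h) \<omega>) - (LINT \<omega>|M. f t \<omega>) - h * (LINT \<omega>|M. f' \<omega>)) \<le> (norm h)\<^sup>2 * (LINT \<omega>|M. w \<omega>)"
      by simp
    then have "norm ((LINT \<omega>|M. f (t + h) \<omega>) - (LINT \<omega>|M. f t \<omega>) - h * (LINT \<omega>|M. f' \<omega>)) / norm h \<le> norm h * (LINT \<omega>|M. w \<omega>)"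
      using h by (simp add: field_simps power2_eq_square)
    moreover have "((LINT \<omega>|M. f (t + h) \<omega>) - (LINT \<omega>|M. f t \<omega>)) / h - (LINT \<omega>|M. f' \<omega>)
       = ((LINT \<omega>|M. f (t + h) \<omega>) - (LINT \<omega>|M. f t \<omega>) - h * (LINT \<omega>|M. f' \<omega>)) / h"
      using h by (simp add: diff_divide_distrib)
    ultimately show "norm (((LINT \<omega>|M. f (t + h) \<omega>) - (LINT \<omega>|M. f t \<omega>)) / h - (LINT \<omega>|M. f' \<omega>))
      \<le> norm h * (LINT \<omega>|M. w \<omega>)" by (simp add: norm_divide)
  qed
  show "((\<lambda>h. norm h * (LINT \<omega>|M. w \<omega>)) \<longlongrightarrow> 0) (at (0::'b))"
    by (auto intro!: tendsto_eq_intros)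
qed

lemma exp_linear_remainder:
  fixes z :: "'a::{banach, real_normed_field}"
  shows "norm (exp z - 1 - z) \<le> exp (norm z) * (norm z)\<^sup>2"
  using Taylor_exp_field[of z 1] by (simp add: algebra_simps power2_eq_square)

text \<open>The remainder of \<open>1 / (A + h)\<close> to first order is
  \<open>h\<^sup>2 / ((A + h) * A\<^sup>2)\<close>. With \<open>norm A \<ge> c\<close> and
  \<open>norm h < c / 2\<close> it is at most \<open>2 / c ^ 3\<close> times
  \<open>(norm h)\<^sup>2\<close>.\<close>

lemma holomorphic_resolvent_reg:
  fixes x :: "'a::euclidean_space"
  assumes "d > 0"
  shows "(\<lambda>t. resolvent_reg x d t) holomorphic_on (- \<real>\<^sub>\<le>\<^sub>0)"
  unfolding resolvent_reg_def
proof (intro holomorphic_intros)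
  let ?G = "\<lambda>\<xi>. cis (x \<bullet> \<xi>) * of_real (exp (- d * (norm \<xi>)\<^sup>2))"
  let ?f = "\<lambda>t \<xi>. ?G \<xi> * (1 / (of_real ((norm \<xi>)\<^sup>2) + t))"
  show "(\<lambda>t. LINT \<xi>|lborel. ?f t \<xi>) holomorphic_on (- \<real>\<^sub>\<le>\<^sub>0)"
    unfolding holomorphic_on_def
  proof
    fix t :: complex assume "t \<in> - \<real>\<^sub>\<le>\<^sub>0"
    then have t: "t \<notin> \<real>\<^sub>\<le>\<^sub>0" by simp
    obtain c where c: "c > 0" "\<And>l. l \<ge> 0 \<Longrightarrow> c \<le> norm (complex_of_real l + t)"
      using slit_plane_bound[OF t] by metis
    have nb: "c / 2 \<le> norm (complex_of_real l + (t + h))" if "norm h < c / 2" "l \<ge> 0" for l h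
      using norm_triangle_ineq4[of "complex_of_real l + (t + h)" h] c(2)[OF that(2)] that(1)
      by (simp add: algebra_simps)
    have slit: "t + h \<notin> \<real>\<^sub>\<le>\<^sub>0" if "norm h < c / 2" for h
    proof
      assume "t + h \<in> \<real>\<^sub>\<le>\<^sub>0"
      then obtain y where y: "t + h = of_real y" "y \<le> 0" by (auto elim: nonpos_Reals_cases)
      then have "complex_of_real (- y) + (t + h) = 0" by simp
      then show False using nb[OF that, of "- y"] y c(1) by (metis norm_zero half_gt_zero neg_0_le_iff_le not_less)
    qed
    have "((\<lambda>t. LINT \<xi>|lborel. ?f t \<xi>) has_field_derivative (LINT \<xi>|lborel. ?G \<xi> * - (1 / (of_real ((norm \<xi>)\<^sup>2) + t)\<^sup>2))) (at t)"
    proof (rule has_field_derivative_integral[where r = "c / 2" and w = "\<lambda>\<xi>. 2 / c ^ 3 * exp (- d * (norm \<xi>)\<^sup>2)"])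
      show "integrable lborel (?f (t + h))" if "norm h < c / 2" for h
        by (rule integrable_resolvent_reg[OF assms slit[OF that]])
      show "integrable lborel (\<lambda>\<xi>::'a. 2 / c ^ 3 * exp (- d * (norm \<xi>)\<^sup>2))"
        by (intro integrable_mult_right integrable_gauss assms)
      show "integrable lborel (\<lambda>\<xi>. ?G \<xi> * - (1 / (of_real ((norm \<xi>)\<^sup>2) + t)\<^sup>2))"
      proof (rule integrable_fourier_gauss_bounded[OF assms, where B = "1 / c\<^sup>2"])
        show "norm (- (1 / (of_real ((norm \<xi>)\<^sup>2) + t)\<^sup>2)) \<le> 1 / c\<^sup>2" for \<xi> :: 'a
          using c(2)[of "(norm \<xi>)\<^sup>2"] c(1) by (auto simp: norm_divide norm_power intro!: divide_left_mono power_mono mult_pos_pos)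
      qed measurable
      fix h :: complex and \<xi> :: 'a assume h: "norm h < c / 2"
      define A where "A = of_real ((norm \<xi>)\<^sup>2) + t"
      have A: "c \<le> norm A" "c / 2 \<le> norm (A + h)"
        using c(2)[of "(norm \<xi>)\<^sup>2"] nb[OF h, of "(norm \<xi>)\<^sup>2"] by (auto simp: A_def add.assoc)
      then have nz: "A \<noteq> 0" "A + h \<noteq> 0" using c(1) by (metis norm_zero not_less half_gt_zero)+
      have "?f (t + h) \<xi> - ?f t \<xi> - h * (?G \<xi> * - (1 / (of_real ((norm \<xi>)\<^sup>2) + t)\<^sup>2)) = ?G \<xi> * (1 / (A + h) - 1 / A + h / A\<^sup>2)"
        unfolding A_def by (simp add: algebra_simps)
      also have "1 / (A + h) - 1 / A + h / A\<^sup>2 = h\<^sup>2 / ((A + h) * A\<^sup>2)"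
        using nz by (simp add: divide_simps) (simp add: algebra_simps power2_eq_square)
      finally have eq: "?f (t + h) \<xi> - ?f t \<xi> - h * (?G \<xi> * - (1 / (of_real ((norm \<xi>)\<^sup>2) + t)\<^sup>2)) = ?G \<xi> * (h\<^sup>2 / ((A + h) * A\<^sup>2))" .
      have "(norm h)\<^sup>2 / (norm (A + h) * (norm A)\<^sup>2) \<le> (norm h)\<^sup>2 / (c / 2 * c\<^sup>2)"
        using A c(1) by (intro divide_left_mono mult_mono power_mono mult_pos_pos) (auto intro: less_le_trans)
      also have "\<dots> = (norm h)\<^sup>2 * (2 / c ^ 3)" by (simp add: power2_eq_square power3_eq_cube)
      finally have "(norm h)\<^sup>2 / (norm (A + h) * (norm A)\<^sup>2) * exp (- d * (norm \<xi>)\<^sup>2) \<le> (norm h)\<^sup>2 * (2 / c ^ 3) * exp (- d * (norm \<xi>)\<^sup>2)"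
        by (rule mult_right_mono) simp
      then show "norm (?f (t + h) \<xi> - ?f t \<xi> - h * (?G \<xi> * - (1 / (of_real ((norm \<xi>)\<^sup>2) + t)\<^sup>2))) \<le> (norm h)\<^sup>2 * (2 / c ^ 3 * exp (- d * (norm \<xi>)\<^sup>2))"
        unfolding eq by (simp add: norm_mult norm_divide norm_power mult_ac)
    qed (use c in auto)
    then show "(\<lambda>t. LINT \<xi>|lborel. ?f t \<xi>) field_differentiable at t within - \<real>\<^sub>\<le>\<^sub>0"
      by (meson field_differentiable_def field_differentiable_at_within)
  qed
qed

text \<open>Over bounded times with a bounded heat kernel the transform is entire in
  \<open>t\<close>, hence holomorphic on any set \<open>A\<close>.\<close>

lemma holomorphic_heat_transform:
  assumes "r > 0"
  shows "(\<lambda>t. LINT u:{0<..1}|lborel. exp (- t * complex_of_real u) * complex_of_real (heat n r u)) holomorphic_on A"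
  unfolding holomorphic_on_def
proof
  fix t :: complex
  obtain C where C: "C > 0" "\<And>u. u > 0 \<Longrightarrow> heat n r u \<le> C" using heat_bounded[OF assms] by metis
  let ?f = "\<lambda>t u. indicator {0<..1} u *\<^sub>R (exp (- t * complex_of_real u) * complex_of_real (heat n r u))"
  let ?f' = "\<lambda>u. indicator {0<..1} u *\<^sub>R (- of_real u * exp (- t * complex_of_real u) * complex_of_real (heat n r u))"
  have eb: "norm (exp (- z * complex_of_real u)) \<le> exp (norm z)" if "0 < u" "u \<le> 1" for u z
  proof -
    have "norm (exp (- z * complex_of_real u)) \<le> exp (norm (z * complex_of_real u))"
      using norm_exp[of "- z * complex_of_real u"] by simp
    also have "\<dots> \<le> exp (norm z)" using that by (simp add: norm_mult mult_left_le)
    finally show ?thesis .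
  qed
  have "((\<lambda>t. LINT u|lborel. ?f t u) has_field_derivative (LINT u|lborel. ?f' u)) (at t)"
  proof (rule has_field_derivative_integral[where r = 1 and w = "\<lambda>u. indicator {0..1} u *\<^sub>R (exp (norm t) * exp 1 * C)"])
    show "integrable lborel (?f (t + h))" for h
    proof (rule Bochner_Integration.integrable_bound[of _ "\<lambda>u. indicator {0..1::real} u *\<^sub>R (exp (norm (t + h)) * C)"])
      show "AE u in lborel. norm (?f (t + h) u) \<le> norm (indicator {0..1::real} u *\<^sub>R (exp (norm (t + h)) * C))"
      proof (rule AE_I2)
        fix u :: real
        show "norm (?f (t + h) u) \<le> norm (indicator {0..1::real} u *\<^sub>R (exp (norm (t + h)) * C))"
        proof (cases "0 < u \<and> u \<le> 1")
          case True
          then have "norm (exp (- (t + h) * complex_of_real u)) * heat n r u \<le> exp (norm (t + h)) * C"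
            using eb[of u "t + h"] C by (intro mult_mono) auto
          then show ?thesis using True C by (simp add: norm_mult abs_mult)
        qed auto
      qed
    qed auto
    show "integrable lborel ?f'"
    proof (rule Bochner_Integration.integrable_bound[of _ "\<lambda>u. indicator {0..1::real} u *\<^sub>R (1 * exp (norm t) * C)"])
      show "AE u in lborel. norm (?f' u) \<le> norm (indicator {0..1::real} u *\<^sub>R (1 * exp (norm t) * C))"
      proof (rule AE_I2)
        fix u :: real
        show "norm (?f' u) \<le> norm (indicator {0..1::real} u *\<^sub>R (1 * exp (norm t) * C))"
        proof (cases "0 < u \<and> u \<le> 1")
          case True
          then have "u * norm (exp (- t * complex_of_real u)) * heat n r u \<le> 1 * exp (norm t) * C"
            using eb[of u t] C by (intro mult_mono) auto
          then show ?thesis using True C by (simp add: norm_mult abs_mult)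
        qed auto
      qed
    qed auto
    fix h :: complex and u :: real assume h: "norm h < 1"
    show "norm (?f (t + h) u - ?f t u - h * ?f' u) \<le> (norm h)\<^sup>2 * (indicator {0..1} u *\<^sub>R (exp (norm t) * exp 1 * C))"
    proof (cases "0 < u \<and> u \<le> 1")
      case True
      define z where "z = - h * complex_of_real u"
      have "norm z \<le> norm h" using True by (simp add: z_def norm_mult mult_left_le)
      with h have z: "norm z \<le> norm h" "norm z \<le> 1" by auto
      have "exp (- (t + h) * complex_of_real u) = exp (- t * complex_of_real u) * exp z"
        by (simp add: z_def exp_add[symmetric] algebra_simps)
      then have "?f (t + h) u - ?f t u - h * ?f' u = exp (- t * complex_of_real u) * (exp z - 1 - z) * complex_of_real (heat n r u)"
        using True by (simp add: z_def algebra_simps)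
      also have "norm \<dots> = norm (exp (- t * complex_of_real u)) * norm (exp z - 1 - z) * heat n r u"
        by (simp add: norm_mult)
      also have "\<dots> \<le> exp (norm t) * (exp 1 * (norm h)\<^sup>2) * C"
      proof (intro mult_mono)
        have "norm (exp z - 1 - z) \<le> exp (norm z) * (norm z)\<^sup>2" by (rule exp_linear_remainder)
        also have "\<dots> \<le> exp 1 * (norm h)\<^sup>2" using z by (intro mult_mono power_mono) auto
        finally show "norm (exp z - 1 - z) \<le> exp 1 * (norm h)\<^sup>2" .
      qed (use eb[of u t] C True in auto)
      finally show ?thesis using True by (simp add: mult_ac)
    qed (use C in auto)
  qed auto
  then show "(\<lambda>t. LINT u:{0<..1}|lborel. exp (- t * complex_of_real u) * complex_of_real (heat n r u)) field_differentiable at t within A"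
    unfolding set_lebesgue_integral_def by (meson field_differentiable_def field_differentiable_at_within)
qed

lemma holomorphic_green:
  fixes x :: "'a::euclidean_space"
  assumes "x \<noteq> 0"
  shows "green x holomorphic_on (- \<real>\<^sub>\<le>\<^sub>0)"
  unfolding green_def[abs_def]
  using assms by (intro holomorphic_intros holomorphic_resolvent_reg holomorphic_heat_transform) auto

lemma connected_slit_plane: "connected (- \<real>\<^sub>\<le>\<^sub>0 :: complex set)"
proof -
  have "(\<real>\<^sub>\<le>\<^sub>0 :: complex set) = complex_of_real ` {..0}" by (auto simp: nonpos_Reals_def)
  then show ?thesis using starlike_slotted_complex_plane_left[of 0] by (metis starlike_imp_connected)
qed

text \<open>The identity theorem on the connected slit plane: agreement on a short real interval
  \<open>(0, T)\<close> is enough. A finite \<open>T\<close> matters in dimension two, where the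
  explicit formula is first proved for small \<open>t\<close> only.\<close>

lemma green_eqI:
  fixes x :: "'a::euclidean_space"
  assumes x: "x \<noteq> 0" and E: "E holomorphic_on (- \<real>\<^sub>\<le>\<^sub>0)" and T: "T > 0"
    and eq: "\<And>t. 0 < t \<Longrightarrow> t < T \<Longrightarrow> E (of_real t) = of_real (yukawa DIM('a) (norm x) t)"
    and t: "t \<notin> \<real>\<^sub>\<le>\<^sub>0"
  shows "green x t = E t"
proof -
  have "green x t - E t = 0"
  proof (rule analytic_continuation[where f = "\<lambda>t. green x t - E t" and S = "- \<real>\<^sub>\<le>\<^sub>0" and U = "complex_of_real ` {0<..<T}" and \<xi> = "of_real (T / 2)"])
    show "of_real (T / 2) islimpt complex_of_real ` {0<..<T}"
      unfolding islimpt_approachable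
    proof (intro allI impI)
      fix e :: real assume e: "e > 0"
      define y where "y = T / 2 + min (e / 2) (T / 4)"
      have "y \<in> {0<..<T}" "y \<noteq> T / 2" "dist y (T / 2) < e" using e T by (auto simp: y_def dist_real_def)
      then show "\<exists>x'\<in>complex_of_real ` {0<..<T}. x' \<noteq> of_real (T / 2) \<and> dist x' (of_real (T / 2)) < e"
        by (intro bexI[of _ "of_real y"]) (auto simp: dist_of_real simp del: of_real_divide)
    qed
    show "green x z - E z = 0" if "z \<in> complex_of_real ` {0<..<T}" for z
      using that eq green_of_real[OF x] by auto
  qed (use T t connected_slit_plane in \<open>auto intro!: holomorphic_intros holomorphic_green x E simp: open_Compl closed_nonpos_Reals_complex simp del: of_real_divide\<close>)
  then show ?thesis by simp
qed

section \<open>Explicit kernels in dimensions one and three\<close>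

lemma set_integral_FTC_0_inf:
  fixes f F :: "real \<Rightarrow> real"
  assumes F: "\<And>u. u > 0 \<Longrightarrow> (F has_real_derivative f u) (at u)"
    and f: "\<And>u. u > 0 \<Longrightarrow> isCont f u"
    and int: "set_integrable lborel {0<..} f"
    and A: "(F \<longlongrightarrow> A) (at_right 0)" and B: "(F \<longlongrightarrow> B) at_top"
  shows "(LINT u:{0<..}|lborel. f u) = B - A"
proof -
  have e: "einterval 0 \<infinity> = {0<..}" by (auto simp: einterval_def)
  have "(LBINT u=0..\<infinity>. f u) = B - A"
    by (rule interval_integral_FTC_integrable[where F = F])
      (use assms in \<open>auto simp: e has_real_derivative_iff_has_vector_derivative[symmetric] zero_ereal_def ereal_tendsto_simps\<close>)
  then show ?thesis by (simp add: interval_lebesgue_integral_def e)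
qed

text \<open>The map \<open>u -> c / u\<close> reverses orientation, so the substitution is made with
  the increasing map \<open>u -> - c / u\<close> onto the negative half-line, followed by a
  reflection.\<close>

lemma set_integral_inversion:
  fixes f :: "real \<Rightarrow> real"
  assumes c: "c > 0" and f: "\<And>u. u > 0 \<Longrightarrow> isCont f u"
    and int: "set_integrable lborel {0<..} f"
    and int': "set_integrable lborel {0<..} (\<lambda>u. c / u\<^sup>2 * f (c / u))"
  shows "(LINT u:{0<..}|lborel. f u) = (LINT u:{0<..}|lborel. c / u\<^sup>2 * f (c / u))"
proof -
  have e: "einterval 0 \<infinity> = {0<..}" "einterval (- \<infinity>) 0 = {..<0}" by (auto simp: einterval_def)
  have int2: "set_integrable lborel {..<0} (\<lambda>x. f (- x))"
    using lborel_integrable_real_affine[OF int[unfolded set_integrable_def], of "-1" 0]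
    unfolding set_integrable_def by (rule Bochner_Integration.integrable_cong[THEN iffD1, OF refl, rotated]) (auto simp: indicator_def)
  have "(LBINT x=-\<infinity>..0. f (- x)) = (LBINT u=0..\<infinity>. (c / u\<^sup>2) *\<^sub>R f (- (- c / u)))"
  proof (rule interval_integral_substitution_integrable[where g = "\<lambda>u. - c / u"])
    show "((\<lambda>u. - c / u) has_real_derivative c / u\<^sup>2) (at u)" if "0 < ereal u" for u
      using that by (auto intro!: derivative_eq_intros simp: power2_eq_square)
    show "isCont (\<lambda>x. f (- x)) (- c / u)" if "0 < ereal u" for u
    proof -
      have "isCont f (- (- c / u))" using that c by (simp add: f)
      then show ?thesis by (rule isCont_o2[rotated]) (rule isCont_minus, rule continuous_ident)
    qed
    show "((ereal \<circ> (\<lambda>u. - c / u) \<circ> real_of_ereal) \<longlongrightarrow> - \<infinity>) (at_right 0)"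
    proof -
      have "filterlim (\<lambda>u. - c / u) at_bot (at_right 0)" using c by real_asymp
      then show ?thesis by (simp add: zero_ereal_def ereal_tendsto_simps)
    qed
    show "((ereal \<circ> (\<lambda>u. - c / u) \<circ> real_of_ereal) \<longlongrightarrow> 0) (at_left \<infinity>)"
    proof -
      have "((\<lambda>u. - c / u) \<longlongrightarrow> 0) at_top" using c by real_asymp
      then show ?thesis by (simp add: zero_ereal_def ereal_tendsto_simps)
    qed
    show "isCont (\<lambda>u. c / u\<^sup>2) u" if "0 < ereal u" for u
      using that by (auto intro!: continuous_intros)
    show "set_integrable lborel (einterval 0 \<infinity>) (\<lambda>u. (c / u\<^sup>2) *\<^sub>R f (- (- c / u)))"
      using int' by (simp add: e)
    show "set_integrable lborel (einterval (- \<infinity>) 0) (\<lambda>x. f (- x))" using int2 by (simp add: e)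
  qed (use c in auto)
  then have "(LINT x:{..<0}|lborel. f (- x)) = (LINT u:{0<..}|lborel. c / u\<^sup>2 * f (c / u))"
    by (simp add: interval_lebesgue_integral_def e)
  moreover have "(LINT u:{0<..}|lborel. f u) = (LINT x:{..<0}|lborel. f (- x))"
    unfolding set_lebesgue_integral_def
    by (subst lborel_integral_real_affine[of "-1" _ 0]) (auto intro!: Bochner_Integration.integral_cong simp: indicator_def)
  ultimately show ?thesis by simp
qed

lemma lborel_gaussian:
  "integrable lborel (\<lambda>x::real. exp (- x\<^sup>2))" "(LINT x|lborel. exp (- x\<^sup>2)) = sqrt pi"
proof -
  show "integrable lborel (\<lambda>x::real. exp (- x\<^sup>2))"
    using integrable_norm[OF gauss_fourier_real(1)[of 1 0]] by simp
  have "complex_of_real (LINT x|lborel. exp (- x\<^sup>2)) = complex_of_real (sqrt pi)"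
    using gauss_fourier_real(2)[of 1 0] by simp
  then show "(LINT x|lborel. exp (- x\<^sup>2)) = sqrt pi" by (simp only: of_real_eq_iff)
qed

lemma heat_1_3:
  assumes "u > 0"
  shows "heat 1 r u = exp (- r\<^sup>2 / (4 * u)) / (2 * sqrt pi * sqrt u)"
    and "heat 3 r u = exp (- r\<^sup>2 / (4 * u)) / (8 * pi * sqrt pi * (u * sqrt u))"
proof -
  have s: "(4 * pi * u) powr (1 / 2) = 2 * sqrt pi * sqrt u"
    using assms by (simp add: powr_half_sqrt real_sqrt_mult)
  then show "heat 1 r u = exp (- r\<^sup>2 / (4 * u)) / (2 * sqrt pi * sqrt u)"
    by (simp add: heat_def powr_minus field_simps)
  have "(4 * pi * u) powr (3 / 2) = (4 * pi * u) powr (1 + 1 / 2)" by simp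
  also have "\<dots> = 8 * pi * sqrt pi * (u * sqrt u)"
    using assms unfolding powr_add s by simp
  finally show "heat 3 r u = exp (- r\<^sup>2 / (4 * u)) / (8 * pi * sqrt pi * (u * sqrt u))"
    by (simp add: heat_def powr_minus field_simps)
qed

lemma isCont_exp_heat: "u > 0 \<Longrightarrow> isCont (\<lambda>u. exp (- t * u) * heat n r u) u"
  unfolding heat_def by (intro continuous_intros) auto

text \<open>Two linear relations determine both kernels. Inversion \<open>u -> c / u\<close> with
  \<open>c = r\<^sup>2 / (4 * t)\<close> exchanges the two exponents and turns the one-dimensional
  integrand into a multiple of the three-dimensional one. A Gaussian integral after a substitution
  provides the second relation.\<close>

lemma yukawa_1_3:
  assumes r: "r > 0" and t: "t > 0"
  shows "yukawa 1 r t = exp (- (sqrt t * r)) / (2 * sqrt t)" "yukawa 3 r t = exp (- (sqrt t * r)) / (4 * pi * r)"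
proof -
  define h where "h n u = exp (- t * u) * heat n r u" for n u
  have hint: "set_integrable lborel {0<..} (h n)" for n
    unfolding h_def using set_integrable_exp_heat[OF t r, of "{0<..}"] by simp
  have Y: "yukawa n r t = (LINT u:{0<..}|lborel. h n u)" for n by (simp add: yukawa_def h_def)
  define c where "c = r\<^sup>2 / (4 * t)"
  have c: "c > 0" using r t by (simp add: c_def)
  have sc: "sqrt c = r / (2 * sqrt t)" using r t by (simp add: c_def real_sqrt_divide real_sqrt_mult)
  have inv: "c / u\<^sup>2 * h 1 (c / u) = 2 * pi * r / sqrt t * h 3 u" if "u > 0" for u
  proof -
    have "c / u > 0" using c that by simp
    have e: "- t * (c / u) = - r\<^sup>2 / (4 * u)" "- r\<^sup>2 / (4 * (c / u)) = - t * u"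
      using r t that by (auto simp: c_def)
    have "c / u\<^sup>2 * h 1 (c / u) = exp (- r\<^sup>2 / (4 * u)) * exp (- t * u) * (c / u\<^sup>2 / (2 * sqrt pi * sqrt (c / u)))"
      unfolding h_def heat_1_3(1)[OF \<open>c / u > 0\<close>] e by simp
    also have "c / u\<^sup>2 / (2 * sqrt pi * sqrt (c / u)) = sqrt c / (2 * sqrt pi * (u * sqrt u))"
    proof -
      have "c = sqrt c * sqrt c" "u = sqrt u * sqrt u" using c that by auto
      then have "c / u\<^sup>2 / (2 * sqrt pi * sqrt (c / u)) = (sqrt c * sqrt c) / (u * (sqrt u * sqrt u)) / (2 * sqrt pi * (sqrt c / sqrt u))"
        by (simp add: power2_eq_square real_sqrt_divide)
      also have "\<dots> = sqrt c / (2 * sqrt pi * (u * sqrt u))"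
        using c that by (simp add: divide_simps del: real_sqrt_mult_self)
      finally show ?thesis .
    qed
    also have "\<dots> = 2 * pi * r / sqrt t / (8 * pi * sqrt pi * (u * sqrt u))"
      unfolding sc by simp
    finally show ?thesis unfolding h_def heat_1_3(2)[OF that] by simp
  qed
  have "yukawa 1 r t = (LINT u:{0<..}|lborel. c / u\<^sup>2 * h 1 (c / u))"
    unfolding Y
  proof (rule set_integral_inversion[OF c _ hint])
    have "set_integrable lborel {0<..} (\<lambda>u. 2 * pi * r / sqrt t * h 3 u)"
      by (intro set_integrable_mult_right hint)
    then show "set_integrable lborel {0<..} (\<lambda>u. c / u\<^sup>2 * h 1 (c / u))"
      using inv by (subst set_integrable_cong[OF refl]) auto
    show "isCont (h 1) u" if "0 < u" for u
      unfolding h_def[abs_def] using that by (rule isCont_exp_heat)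
  qed
  also have "\<dots> = (LINT u:{0<..}|lborel. 2 * pi * r / sqrt t * h 3 u)"
    using inv by (intro set_lebesgue_integral_cong) auto
  finally have rel: "yukawa 1 r t = 2 * pi * r / sqrt t * yukawa 3 r t" by (simp add: Y)
  \<comment> \<open>\<open>g\<close> maps the half-line increasingly onto the real line, and
    \<open>(g u)\<^sup>2\<close> is \<open>t * u + r\<^sup>2 / (4 * u)\<close> up to the constant
    \<open>sqrt t * r\<close>. Its derivative contains the powers \<open>-1/2\<close> and
    \<open>-3/2\<close> of \<open>u\<close>, so the total Gaussian mass \<open>sqrt pi\<close>
    becomes a combination of both Yukawa kernels.\<close>
  define g where "g u = sqrt t * sqrt u - r / 2 / sqrt u" for u
  define g' where "g' u = sqrt t / (2 * sqrt u) + r / (4 * (u * sqrt u))" for u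
  have gg: "exp (- (g u)\<^sup>2) * g' u = exp (sqrt t * r) * sqrt pi * (sqrt t * h 1 u + 2 * pi * r * h 3 u)" if "u > 0" for u
  proof -
    have "(g u)\<^sup>2 = t * u + r\<^sup>2 / (4 * u) - sqrt t * r"
      using that t by (simp add: g_def power2_diff power_mult_distrib power_divide)
    then have "exp (- (g u)\<^sup>2) = exp (sqrt t * r) * exp (- t * u) * exp (- r\<^sup>2 / (4 * u))"
      by (simp flip: exp_add)
    moreover have "g' u = sqrt pi * (sqrt t * (1 / (2 * sqrt pi * sqrt u)) + 2 * pi * r * (1 / (8 * pi * sqrt pi * (u * sqrt u))))"
      using that by (simp add: g'_def field_simps)
    ultimately show ?thesis
      unfolding h_def heat_1_3[OF that] by (simp add: algebra_simps)
  qed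
  have e: "einterval 0 \<infinity> = {0<..}" "einterval (- \<infinity>) \<infinity> = UNIV" by (auto simp: einterval_def)
  have "(LBINT x=-\<infinity>..\<infinity>. exp (- x\<^sup>2)) = (LBINT u=0..\<infinity>. exp (- (g u)\<^sup>2) * g' u)"
  proof (rule interval_integral_substitution_nonneg(2))
    show "(g has_real_derivative g' u) (at u)" if "0 < ereal u" for u
    proof -
      have "((\<lambda>u. sqrt t * sqrt u - r / 2 / sqrt u) has_real_derivative sqrt t * (inverse (sqrt u) / 2) - - (r / 2 * (inverse (sqrt u) / 2)) / (sqrt u * sqrt u)) (at u)"
        using that by (auto intro!: derivative_eq_intros)
      moreover have "sqrt t * (inverse (sqrt u) / 2) - - (r / 2 * (inverse (sqrt u) / 2)) / (sqrt u * sqrt u) = g' u"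
        using that by (simp add: g'_def field_simps)
      ultimately show ?thesis by (simp add: g_def[abs_def])
    qed
    show "isCont g' u" if "0 < ereal u" for u
      unfolding g'_def using that by (auto intro!: continuous_intros)
    show "0 \<le> g' u" if "0 \<le> ereal u" for u
      unfolding g'_def using that t r by auto
    show "((ereal \<circ> g \<circ> real_of_ereal) \<longlongrightarrow> - \<infinity>) (at_right 0)"
    proof -
      have "filterlim g at_bot (at_right 0)" unfolding g_def using r t by real_asymp
      then show ?thesis by (simp add: zero_ereal_def ereal_tendsto_simps)
    qed
    show "((ereal \<circ> g \<circ> real_of_ereal) \<longlongrightarrow> \<infinity>) (at_left \<infinity>)"
    proof -
      have "filterlim g at_top at_top" unfolding g_def using r t by real_asymp
      then show ?thesis by (simp add: zero_ereal_def ereal_tendsto_simps)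
    qed
    have "set_integrable lborel {0<..} (\<lambda>u. exp (sqrt t * r) * sqrt pi * (sqrt t * h 1 u + 2 * pi * r * h 3 u))"
      by (intro set_integrable_mult_right set_integral_add(1) hint)
    then show "set_integrable lborel (einterval 0 \<infinity>) (\<lambda>u. exp (- (g u)\<^sup>2) * g' u)"
      unfolding e by (rule iffD2[OF set_integrable_cong, OF refl refl, rotated]) (simp only: gg greaterThan_iff)
  qed (auto intro!: continuous_intros)
  then have "sqrt pi = (LINT u:{0<..}|lborel. exp (- (g u)\<^sup>2) * g' u)"
    using lborel_gaussian by (simp add: interval_lebesgue_integral_def e set_lebesgue_integral_def)
  also have "\<dots> = (LINT u:{0<..}|lborel. exp (sqrt t * r) * sqrt pi * (sqrt t * h 1 u + 2 * pi * r * h 3 u))"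
    using gg by (intro set_lebesgue_integral_cong) auto
  also have "\<dots> = exp (sqrt t * r) * sqrt pi * (sqrt t * yukawa 1 r t + 2 * pi * r * yukawa 3 r t)"
    unfolding Y by (simp add: set_integral_add hint set_integrable_mult_right)
  finally have "sqrt pi * 1 = sqrt pi * (exp (sqrt t * r) * (sqrt t * yukawa 1 r t + 2 * pi * r * yukawa 3 r t))" by simp
  then have "1 = exp (sqrt t * r) * (sqrt t * yukawa 1 r t + 2 * pi * r * yukawa 3 r t)" by simp
  then have "exp (- (sqrt t * r)) = sqrt t * yukawa 1 r t + 2 * pi * r * yukawa 3 r t"
    by (simp add: exp_minus field_simps)
  then have main: "exp (- (sqrt t * r)) = 4 * pi * r * yukawa 3 r t" using rel t by simp
  show "yukawa 3 r t = exp (- (sqrt t * r)) / (4 * pi * r)" using main r by (simp add: field_simps)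
  show "yukawa 1 r t = exp (- (sqrt t * r)) / (2 * sqrt t)" unfolding rel main using r t by (simp add: field_simps)
qed

lemma green_1:
  assumes "(x::real) \<noteq> 0" "t \<notin> \<real>\<^sub>\<le>\<^sub>0"
  shows "green x t = exp (- (csqrt t * \<bar>x\<bar>)) / (2 * csqrt t)"
proof (rule green_eqI[OF assms(1) _ zero_less_one _ assms(2)])
  show "(\<lambda>t. exp (- (csqrt t * of_real \<bar>x\<bar>)) / (2 * csqrt t)) holomorphic_on - \<real>\<^sub>\<le>\<^sub>0"
    by (intro holomorphic_intros) auto
  show "exp (- (csqrt (of_real t) * of_real \<bar>x\<bar>)) / (2 * csqrt (of_real t)) = of_real (yukawa DIM(real) (norm x) t)" if "0 < t" for t
    using that assms(1) yukawa_1_3(1)[of "\<bar>x\<bar>" t] by (simp add: csqrt_of_real_nonneg exp_of_real[symmetric])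
qed

lemma green_3:
  assumes "(x::real^3) \<noteq> 0" "t \<notin> \<real>\<^sub>\<le>\<^sub>0"
  shows "green x t = exp (- (csqrt t * norm x)) / (4 * pi * norm x)"
proof (rule green_eqI[OF assms(1) _ zero_less_one _ assms(2)])
  show "(\<lambda>t. exp (- (csqrt t * of_real (norm x))) / (4 * pi * norm x)) holomorphic_on - \<real>\<^sub>\<le>\<^sub>0"
    using assms(1) by (intro holomorphic_intros) auto
  show "exp (- (csqrt (of_real t) * of_real (norm x))) / (4 * pi * norm x) = of_real (yukawa DIM(real^3) (norm x) t)" if "0 < t" for t
    using that assms(1) yukawa_1_3(2)[of "norm x" t] by (simp add: csqrt_of_real_nonneg exp_of_real[symmetric])
qed

section \<open>Power series of Bessel type\<close>

definition entire_coeffs :: "(nat \<Rightarrow> real) \<Rightarrow> bool" where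
  "entire_coeffs c \<longleftrightarrow> (\<exists>K. \<forall>n. \<bar>c n\<bar> \<le> K / fact n)"

text \<open>Real coefficients evaluated in an arbitrary field: the differential equation is handled
  over the reals and the continuation over the complex numbers with the same series. The growth
  condition \<open>entire_coeffs\<close> compares with the exponential series and is stable under
  \<open>diffs\<close>.\<close>

definition entire_series :: "(nat \<Rightarrow> real) \<Rightarrow> 'a::{real_normed_field, banach} \<Rightarrow> 'a" where
  "entire_series c z = (\<Sum>n. of_real (c n) * z ^ n)"

lemma summable_entire_series:
  fixes z :: "'a::{real_normed_field, banach}"
  assumes "entire_coeffs c"
  shows "summable (\<lambda>n. of_real (c n) * z ^ n)"
proof -
  obtain K where K: "\<And>n. \<bar>c n\<bar> \<le> K / fact n" using assms by (auto simp: entire_coeffs_def)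
  show ?thesis
  proof (rule summable_comparison_test')
    show "summable (\<lambda>n. K * (norm z ^ n /\<^sub>R fact n))" by (intro summable_mult summable_exp_generic)
    show "norm (of_real (c n) * z ^ n) \<le> K * (norm z ^ n /\<^sub>R fact n)" for n
      using mult_right_mono[OF K[of n], of "norm z ^ n"] by (simp add: norm_mult norm_power field_simps)
  qed
qed

lemma entire_coeffs_diffs: "entire_coeffs c \<Longrightarrow> entire_coeffs (diffs c)"
proof -
  assume "entire_coeffs c"
  then obtain K where K: "\<And>n. \<bar>c n\<bar> \<le> K / fact n" by (auto simp: entire_coeffs_def)
  have "\<bar>diffs c n\<bar> \<le> K / fact n" for n
  proof -
    have "real (Suc n) * \<bar>c (Suc n)\<bar> \<le> real (Suc n) * (K / fact (Suc n))" by (intro mult_left_mono K) auto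
    also have "\<dots> = K / fact n" by (simp add: field_simps del: of_nat_Suc)
    finally show ?thesis by (simp add: diffs_def abs_mult)
  qed
  then show ?thesis by (auto simp: entire_coeffs_def)
qed

lemma DERIV_entire_series:
  fixes z :: "'a::{real_normed_field, banach}"
  assumes "entire_coeffs c"
  shows "(entire_series c has_field_derivative entire_series (diffs c) z) (at z)"
  using termdiffs_strong_converges_everywhere[OF summable_entire_series[OF assms], of z]
  by (simp add: entire_series_def[abs_def] diffs_of_real)

lemma isCont_entire_series: "entire_coeffs c \<Longrightarrow> isCont (entire_series c) z"
  by (rule DERIV_isCont[OF DERIV_entire_series])

lemma entire_series_of_real:
  assumes "entire_coeffs c"
  shows "entire_series c (of_real y :: 'a::{real_normed_field, banach}) = of_real (entire_series c y)"
  unfolding entire_series_def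
  by (subst bounded_linear.suminf[OF bounded_linear_of_real]) (use summable_entire_series[OF assms, of y] in simp_all)

lemma entire_series_0: "entire_series c 0 = of_real (c 0)"
  using suminf_finite[of "{0}" "\<lambda>n. of_real (c n) * 0 ^ n"] by (auto simp: entire_series_def)

lemma entire_series_diffs_times:
  fixes z :: "'a::{real_normed_field, banach}"
  assumes c: "entire_coeffs c"
  shows "summable (\<lambda>n. of_real (real n * c n) * z ^ n)" "z * entire_series (diffs c) z = entire_series (\<lambda>n. real n * c n) z"
proof -
  have eq: "z * (of_real (diffs c n) * z ^ n) = of_real (real (Suc n) * c (Suc n)) * z ^ Suc n" for n
    by (simp add: diffs_def mult_ac)
  have s: "summable (\<lambda>n. of_real (real (Suc n) * c (Suc n)) * z ^ Suc n)"
    using summable_mult[OF summable_entire_series[OF entire_coeffs_diffs[OF c]], of z z] by (simp only: eq)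
  then show s': "summable (\<lambda>n. of_real (real n * c n) * z ^ n)"
    by (subst (asm) summable_Suc_iff)
  have "z * entire_series (diffs c) z = (\<Sum>n. z * (of_real (diffs c n) * z ^ n))"
    unfolding entire_series_def by (rule suminf_mult[symmetric, OF summable_entire_series[OF entire_coeffs_diffs[OF c]]])
  also have "\<dots> = (\<Sum>n. of_real (real (Suc n) * c (Suc n)) * z ^ Suc n)" by (simp only: eq)
  also have "\<dots> = entire_series (\<lambda>n. real n * c n) z"
    unfolding entire_series_def using suminf_split_head[OF s'] by simp
  finally show "z * entire_series (diffs c) z = entire_series (\<lambda>n. real n * c n) z" .
qed

text \<open>The operator \<open>f -> (z f')'\<close> sends the coefficients \<open>c n\<close> to
  \<open>(n + 1)\<^sup>2 * c (n + 1)\<close>. It is the modified Bessel operator of order 0 in the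
  variable \<open>y = z\<^sup>2 / 4\<close>.\<close>

lemma DERIV_entire_series_euler:
  fixes z :: "'a::{real_normed_field, banach}"
  assumes c: "entire_coeffs c" and b: "\<And>n. real (Suc n) * diffs c n = b n"
  shows "((\<lambda>z. z * entire_series (diffs c) z) has_field_derivative entire_series b z) (at z)"
proof -
  note d = entire_coeffs_diffs[OF c]
  have "((\<lambda>z. z * entire_series (diffs c) z) has_field_derivative 1 * entire_series (diffs c) z + entire_series (diffs (diffs c)) z * z) (at z)"
    by (intro DERIV_mult DERIV_ident DERIV_entire_series d)
  also have "1 * entire_series (diffs c) z + entire_series (diffs (diffs c)) z * z = entire_series (diffs c) z + entire_series (\<lambda>n. real n * diffs c n) z"
    using entire_series_diffs_times(2)[OF d, of z] by (simp add: mult.commute)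
  also have "\<dots> = (\<Sum>n. of_real (diffs c n) * z ^ n + of_real (real n * diffs c n) * z ^ n)"
    unfolding entire_series_def by (rule suminf_add[OF summable_entire_series[OF d] entire_series_diffs_times(1)[OF d]])
  also have "\<dots> = entire_series b z"
    unfolding entire_series_def b[symmetric] by (simp add: algebra_simps)
  finally show ?thesis .
qed

text \<open>The series with these coefficients is \<open>I_0 (2 * sqrt y)\<close>, and at
  \<open>- z\<^sup>2 / 4\<close> it is \<open>J_0 z\<close>. The harmonic variant below is the
  non-logarithmic part of the second solution.\<close>

definition bessel_coeff :: "nat \<Rightarrow> real" where "bessel_coeff n = 1 / (fact n)\<^sup>2"
definition bessel_harm_coeff :: "nat \<Rightarrow> real" where "bessel_harm_coeff n = harm n / (fact n)\<^sup>2"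

lemma entire_bessel_coeff: "entire_coeffs bessel_coeff"
  unfolding entire_coeffs_def bessel_coeff_def
  by (intro exI[of _ 1]) (auto intro!: divide_left_mono simp: power2_eq_square mult_ge1_I)

lemma harm_le_fact: "harm n \<le> (fact n :: real)"
proof (induction n)
  case (Suc n)
  show ?case
  proof (cases n)
    case (Suc m)
    have "inverse (real (Suc n)) \<le> 1" by (simp add: field_simps)
    then have "harm (Suc n) \<le> fact n + (1::real)" using Suc.IH by (simp add: harm_Suc)
    also have "\<dots> \<le> 2 * fact n" using fact_ge_1[of n, where 'a = real] by linarith
    also have "\<dots> \<le> real (Suc n) * fact n" using Suc by (intro mult_right_mono) auto
    finally show ?thesis by simp
  qed (simp add: harm_def)
qed (simp add: harm_def)

lemma entire_bessel_harm_coeff: "entire_coeffs bessel_harm_coeff"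
  unfolding entire_coeffs_def
proof (intro exI allI)
  fix n
  have "harm n / (fact n)\<^sup>2 \<le> fact n / (fact n :: real)\<^sup>2" by (intro divide_right_mono harm_le_fact) auto
  then show "\<bar>bessel_harm_coeff n\<bar> \<le> 1 / fact n" by (simp add: bessel_harm_coeff_def harm_nonneg power2_eq_square)
qed

lemma euler_bessel_coeff: "real (Suc n) * diffs bessel_coeff n = bessel_coeff n"
  by (simp add: diffs_def bessel_coeff_def field_simps power2_eq_square del: of_nat_Suc)

text \<open>With \<open>f\<close> and \<open>h\<close> the series of \<open>bessel_coeff\<close> and
  \<open>bessel_harm_coeff\<close>, this is \<open>(y h')' = h + f'\<close>. The surplus
  \<open>f'\<close> cancels the terms that arise when the logarithm in the second solution is
  differentiated.\<close>

lemma euler_bessel_harm_coeff: "real (Suc n) * diffs bessel_harm_coeff n = bessel_harm_coeff n + diffs bessel_coeff n"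
proof -
  have "real (Suc n) * diffs bessel_harm_coeff n = harm (Suc n) / (fact n)\<^sup>2"
    by (simp add: diffs_def bessel_harm_coeff_def field_simps power2_eq_square del: of_nat_Suc)
  also have "\<dots> = bessel_harm_coeff n + diffs bessel_coeff n"
  proof -
    have "diffs bessel_coeff n = inverse (real (Suc n)) / (fact n)\<^sup>2"
      by (simp add: diffs_def bessel_coeff_def power2_eq_square field_simps del: of_nat_Suc)
    then show ?thesis by (simp add: bessel_harm_coeff_def harm_Suc add_divide_distrib)
  qed
  finally show ?thesis .
qed

text \<open>The Frobenius solution of \<open>(y S')' = S\<close> with logarithmic singularity, normalised as
  \<open>S y = 2 K\<^sub>0 (2 sqrt y)\<close>.\<close>

definition log_solution :: "real \<Rightarrow> real" where
  "log_solution y = - (ln y + 2 * euler_mascheroni) * entire_series bessel_coeff y + 2 * entire_series bessel_harm_coeff y"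

text \<open>This is \<open>y\<close> times the derivative of \<open>log_solution\<close>; with it
  the second-order equation becomes a first-order system to which
  \<open>bessel_system_unique\<close> applies.\<close>

definition log_solution_flux :: "real \<Rightarrow> real" where
  "log_solution_flux y = - entire_series bessel_coeff y - (ln y + 2 * euler_mascheroni) * (y * entire_series (diffs bessel_coeff) y) + 2 * (y * entire_series (diffs bessel_harm_coeff) y)"

lemma DERIV_log_solution:
  assumes "y > 0"
  shows "(log_solution has_real_derivative log_solution_flux y / y) (at y)" "(log_solution_flux has_real_derivative log_solution y) (at y)"
proof -
  note [derivative_intros] = DERIV_entire_series[OF entire_bessel_coeff, THEN DERIV_chain2] DERIV_entire_series[OF entire_bessel_harm_coeff, THEN DERIV_chain2]
  have "(log_solution has_real_derivative - (1 / y) * entire_series bessel_coeff y - (ln y + 2 * euler_mascheroni) * entire_series (diffs bessel_coeff) y + 2 * entire_series (diffs bessel_harm_coeff) y) (at y)"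
    unfolding log_solution_def[abs_def] using assms by (auto intro!: derivative_eq_intros simp: algebra_simps)
  also have "- (1 / y) * entire_series bessel_coeff y - (ln y + 2 * euler_mascheroni) * entire_series (diffs bessel_coeff) y + 2 * entire_series (diffs bessel_harm_coeff) y = log_solution_flux y / y"
    using assms by (simp add: log_solution_flux_def field_simps)
  finally show "(log_solution has_real_derivative log_solution_flux y / y) (at y)" .
  have split: "entire_series (\<lambda>n. bessel_harm_coeff n + diffs bessel_coeff n) y = entire_series bessel_harm_coeff y + entire_series (diffs bessel_coeff) y"
    unfolding entire_series_def using suminf_add[OF summable_entire_series[OF entire_bessel_harm_coeff] summable_entire_series[OF entire_coeffs_diffs[OF entire_bessel_coeff]], of y y]
    by (simp add: algebra_simps)
  have "(log_solution_flux has_real_derivative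
      - entire_series (diffs bessel_coeff) y - (1 / y * (y * entire_series (diffs bessel_coeff) y) + entire_series bessel_coeff y * (ln y + 2 * euler_mascheroni)) + 2 * entire_series (\<lambda>n. bessel_harm_coeff n + diffs bessel_coeff n) y) (at y)"
    unfolding log_solution_flux_def[abs_def]
    by (intro DERIV_add DERIV_diff DERIV_minus DERIV_mult DERIV_cmult DERIV_entire_series[OF entire_bessel_coeff]
        DERIV_entire_series_euler[OF entire_bessel_coeff euler_bessel_coeff] DERIV_entire_series_euler[OF entire_bessel_harm_coeff euler_bessel_harm_coeff])
      (use assms in \<open>auto intro!: derivative_eq_intros\<close>)
  also have "- entire_series (diffs bessel_coeff) y - (1 / y * (y * entire_series (diffs bessel_coeff) y) + entire_series bessel_coeff y * (ln y + 2 * euler_mascheroni)) + 2 * entire_series (\<lambda>n. bessel_harm_coeff n + diffs bessel_coeff n) y = log_solution y"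
    unfolding split log_solution_def using assms by (simp add: algebra_simps)
  finally show "(log_solution_flux has_real_derivative log_solution y) (at y)" .
qed

text \<open>These are the initial data at the singular point: the constant next to the logarithm and
  the limit of the flux together single out the solution.\<close>

lemma log_solution_limits:
  "((\<lambda>y. log_solution y + ln y) \<longlongrightarrow> - 2 * euler_mascheroni) (at_right 0)" "(log_solution_flux \<longlongrightarrow> - 1) (at_right 0)"
proof -
  have lim: "(entire_series c \<longlongrightarrow> entire_series c 0) (at_right (0::real))" if "entire_coeffs c" for c
    using isCont_entire_series[OF that, of 0] by (auto simp: isCont_def intro: tendsto_mono[OF at_le])
  have yl: "((\<lambda>y::real. y * ln y) \<longlongrightarrow> 0) (at_right 0)" by real_asymp
  have y0: "((\<lambda>y::real. y) \<longlongrightarrow> 0) (at_right 0)" by real_asymp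
  \<comment> \<open>After adding \<open>ln y\<close>, the logarithm multiplies
    \<open>entire_series bessel_coeff y - 1\<close>. Splitting this as \<open>y * ln y\<close> times
    a difference quotient shows that it vanishes in the limit.\<close>
  have q: "((\<lambda>y::real. (entire_series bessel_coeff y - 1) / y) \<longlongrightarrow> entire_series (diffs bessel_coeff) 0) (at_right 0)"
    using DERIV_entire_series[OF entire_bessel_coeff, of "0::real"]
    by (auto simp: DERIV_def entire_series_0 bessel_coeff_def intro: tendsto_mono[OF at_le])
  have "((\<lambda>y. - (y * ln y) * ((entire_series bessel_coeff y - 1) / y) - 2 * euler_mascheroni * entire_series bessel_coeff y + 2 * entire_series bessel_harm_coeff y) \<longlongrightarrow>
      - 0 * entire_series (diffs bessel_coeff) 0 - 2 * euler_mascheroni * entire_series bessel_coeff 0 + 2 * entire_series bessel_harm_coeff 0) (at_right (0::real))"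
    by (intro tendsto_intros lim entire_bessel_coeff entire_bessel_harm_coeff q yl)
  also have "- 0 * entire_series (diffs bessel_coeff) 0 - 2 * euler_mascheroni * entire_series bessel_coeff 0 + 2 * entire_series bessel_harm_coeff (0::real) = - 2 * euler_mascheroni"
    by (simp add: entire_series_0 bessel_coeff_def bessel_harm_coeff_def harm_def)
  finally show "((\<lambda>y. log_solution y + ln y) \<longlongrightarrow> - 2 * euler_mascheroni) (at_right 0)"
    by (rule Lim_transform_eventually) (rule eventually_at_rightI[of 0 1], auto simp: log_solution_def field_simps)
  have "((\<lambda>y. - entire_series bessel_coeff y - (y * ln y + 2 * euler_mascheroni * y) * entire_series (diffs bessel_coeff) y + 2 * (y * entire_series (diffs bessel_harm_coeff) y)) \<longlongrightarrow>
      - entire_series bessel_coeff 0 - (0 + 2 * euler_mascheroni * 0) * entire_series (diffs bessel_coeff) 0 + 2 * (0 * entire_series (diffs bessel_harm_coeff) 0)) (at_right (0::real))"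
    by (intro tendsto_intros lim entire_bessel_coeff entire_bessel_harm_coeff entire_coeffs_diffs yl y0)
  also have "- entire_series bessel_coeff 0 - (0 + 2 * euler_mascheroni * 0) * entire_series (diffs bessel_coeff) 0 + 2 * (0 * entire_series (diffs bessel_harm_coeff) (0::real)) = - 1"
    by (simp add: entire_series_0 bessel_coeff_def)
  finally show "(log_solution_flux \<longlongrightarrow> - 1) (at_right 0)"
    by (rule Lim_transform_eventually) (auto simp: log_solution_flux_def algebra_simps)
qed

text \<open>The mean value inequality is applied on \<open>{e..x}\<close> and \<open>e\<close> is
  sent to 0, since \<open>f\<close> is controlled at 0 only through its limit.\<close>

lemma bound_from_zero:
  fixes f :: "real \<Rightarrow> real"
  assumes f: "\<And>x. 0 < x \<Longrightarrow> x \<le> x0 \<Longrightarrow> (f has_real_derivative f' x) (at x)"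
    and b: "\<And>x. 0 < x \<Longrightarrow> x \<le> x0 \<Longrightarrow> \<bar>f' x\<bar> \<le> K"
    and lim: "(f \<longlongrightarrow> 0) (at_right 0)" and x: "0 < x" "x \<le> x0"
  shows "\<bar>f x\<bar> \<le> K * x"
proof -
  have K: "K \<ge> 0" using b[of x] x by auto
  have "((\<lambda>e. \<bar>f x - f e\<bar>) \<longlongrightarrow> \<bar>f x - 0\<bar>) (at_right 0)" by (intro tendsto_intros lim)
  then have "\<bar>f x - 0\<bar> \<le> K * x"
  proof (rule tendsto_upperbound)
    show "\<forall>\<^sub>F e in at_right 0. \<bar>f x - f e\<bar> \<le> K * x"
    proof (rule eventually_at_rightI[of 0 x])
      fix e assume e: "e \<in> {0<..<x}"
      have "norm (f x - f e) \<le> K * norm (x - e)"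
        by (rule field_differentiable_bound[of "{e..x}" f f' K])
          (use f b x e in \<open>auto intro: has_field_derivative_at_within\<close>)
      also have "\<dots> \<le> K * x" using e K by (intro mult_left_mono) auto
      finally show "\<bar>f x - f e\<bar> \<le> K * x" by simp
    qed (use x in auto)
  qed simp
  then show ?thesis by simp
qed

text \<open>A contraction argument that tolerates the singular coefficient \<open>1 / x\<close>: a
  bound \<open>K\<close> on \<open>D\<close> gives \<open>K * x\<close> for \<open>P\<close>, so
  \<open>P x / x\<close> is again bounded by \<open>K\<close> and \<open>D\<close> by
  \<open>K * x \<le> x0 * K\<close>. Iteration with \<open>x0 < 1\<close> forces \<open>D\<close> to
  vanish.\<close>

lemma bessel_system_unique:
  fixes D P :: "real \<Rightarrow> real"
  assumes D: "\<And>x. x > 0 \<Longrightarrow> (D has_real_derivative P x / x) (at x)"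
    and P: "\<And>x. x > 0 \<Longrightarrow> (P has_real_derivative D x) (at x)"
    and D0: "(D \<longlongrightarrow> 0) (at_right 0)" and P0: "(P \<longlongrightarrow> 0) (at_right 0)"
    and x0: "0 < x0" "x0 < 1"
  shows "D x0 = 0"
proof -
  have step: "\<bar>D x\<bar> \<le> x0 * K" if K: "\<And>x. 0 < x \<Longrightarrow> x \<le> x0 \<Longrightarrow> \<bar>D x\<bar> \<le> K" and x: "0 < x" "x \<le> x0" for x K
  proof -
    have "K \<ge> 0" using K[OF x] by auto
    have Pb: "\<bar>P x\<bar> \<le> K * x" if "0 < x" "x \<le> x0" for x
      by (rule bound_from_zero[OF P _ P0]) (use K that in auto)
    have "\<bar>D x\<bar> \<le> K * x"
      by (rule bound_from_zero[OF D _ D0]) (use Pb x in \<open>auto simp: field_simps\<close>)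
    also have "\<dots> \<le> x0 * K" using x \<open>K \<ge> 0\<close> by (simp add: mult.commute mult_left_mono)
    finally show ?thesis .
  qed
  obtain K where K: "\<And>x. 0 < x \<Longrightarrow> x \<le> x0 \<Longrightarrow> \<bar>D x\<bar> \<le> K"
  proof -
    have "eventually (\<lambda>x. \<bar>D x\<bar> < 1) (at_right 0)"
      using order_tendstoD(2)[OF tendsto_rabs_zero[OF D0], of 1] by simp
    then obtain e where e: "e > 0" "\<And>x. 0 < x \<Longrightarrow> x < e \<Longrightarrow> \<bar>D x\<bar> < 1"
      unfolding eventually_at_right_field by auto
    have "continuous_on {e..x0} D"
      using e by (intro continuous_at_imp_continuous_on ballI DERIV_isCont[OF D]) auto
    then have "bounded (D ` {e..x0})" by (intro compact_imp_bounded compact_continuous_image) auto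
    then obtain B where B: "\<forall>x\<in>{e..x0}. \<bar>D x\<bar> \<le> B" unfolding bounded_iff by auto
    have "\<bar>D x\<bar> \<le> max 1 B" if "0 < x" "x \<le> x0" for x
      using e(2)[of x] B that by (cases "x < e") (auto simp: le_max_iff_disj)
    then show ?thesis using that by blast
  qed
  have "\<bar>D x\<bar> \<le> x0 ^ n * K" if "0 < x" "x \<le> x0" for x n
    using that
  proof (induction n arbitrary: x)
    case (Suc n)
    then show ?case using step[of "x0 ^ n * K"] by (simp add: mult.assoc)
  qed (use K in auto)
  moreover have "(\<lambda>n. x0 ^ n * K) \<longlonglongrightarrow> 0 * K" using x0 by (intro tendsto_intros LIMSEQ_realpow_zero) auto
  ultimately have "\<bar>D x0\<bar> \<le> 0 * K" using x0 by (intro tendsto_lowerbound) auto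
  then show ?thesis by simp
qed

section \<open>The integrals \<open>2 * y powr ((1 - m) / 2) * K_(m-1) (2 * sqrt y)\<close> and the
  planar kernel\<close>

definition macdonald :: "nat \<Rightarrow> real \<Rightarrow> real" where
  "macdonald m y = (LINT u:{0<..}|lborel. exp (- u - y / u) / u ^ m)"

text \<open>The integrand is a weighted heat kernel in dimension \<open>2 * m\<close> at radius
  \<open>2 * sqrt y\<close>, so its integrability is a case of
  \<open>set_integrable_exp_heat\<close>.\<close>

lemma exp_heat_even:
  assumes "u > 0" "y > 0"
  shows "exp (- a * u - y / u) / u ^ m = (4 * pi) ^ m * (exp (- a * u) * heat (2 * m) (2 * sqrt y) u)"
proof -
  have "(4 * pi * u) powr (- real (2 * m) / 2) = 1 / ((4 * pi) ^ m * u ^ m)"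
    using assms by (simp add: powr_minus powr_realpow power_mult_distrib field_simps)
  moreover have "- (2 * sqrt y)\<^sup>2 / (4 * u) = - (y / u)" using assms by simp
  ultimately show ?thesis
    unfolding heat_def by (simp add: field_simps flip: exp_add)
qed

lemma set_integrable_macdonaldonald_gen:
  fixes a y :: real
  assumes "a > 0" "y > 0"
  shows "set_integrable lborel {0<..} (\<lambda>u. exp (- a * u - y / u) / u ^ m)"
proof -
  have "set_integrable lborel {0<..} (\<lambda>u. (4 * pi) ^ m * (exp (- a * u) * heat (2 * m) (2 * sqrt y) u))"
    using assms by (intro set_integrable_mult_right set_integrable_exp_heat) auto
  then show ?thesis
    by (rule iffD2[OF set_integrable_cong, OF refl refl, rotated]) (use exp_heat_even assms in auto)
qed

lemma set_integrable_macdonald: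
  fixes y :: real
  assumes "y > 0"
  shows "set_integrable lborel {0<..} (\<lambda>u. exp (- u - y / u) / u ^ m)"
  using set_integrable_macdonaldonald_gen[of 1 y m, OF zero_less_one] assms by simp

lemma yukawa_2:
  assumes "r > 0" "t > 0"
  shows "yukawa 2 r t = macdonald 1 (t * r\<^sup>2 / 4) / (4 * pi)"
proof -
  have "macdonald 1 (t * r\<^sup>2 / 4) = t * (LINT u|lborel. indicator {0<..} (0 + t * u) *\<^sub>R (exp (- (0 + t * u) - (t * r\<^sup>2 / 4) / (0 + t * u)) / (0 + t * u) ^ 1))"
    unfolding macdonald_def set_lebesgue_integral_def
    by (subst lborel_integral_real_affine[of t _ 0]) (use assms in auto)
  also have "\<dots> = (LINT u|lborel. 4 * pi * (indicator {0<..} u *\<^sub>R (exp (- t * u) * heat 2 r u)))"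
  proof (subst integral_mult_right_zero[symmetric], rule Bochner_Integration.integral_cong[OF refl])
    fix u :: real
    show "t * (indicator {0<..} (0 + t * u) *\<^sub>R (exp (- (0 + t * u) - (t * r\<^sup>2 / 4) / (0 + t * u)) / (0 + t * u) ^ 1))
      = 4 * pi * (indicator {0<..} u *\<^sub>R (exp (- t * u) * heat 2 r u))"
    proof (cases "u > 0")
      case True
      then have tu: "t * u > 0" using assms by simp
      have h: "heat 2 r u = exp (- r\<^sup>2 / (4 * u)) / (4 * pi * u)"
        using True by (simp add: heat_def powr_minus_divide)
      have "(t * r\<^sup>2 / 4) / (t * u) = r\<^sup>2 / (4 * u)" using assms by simp
      then have "exp (- (t * u) - (t * r\<^sup>2 / 4) / (t * u)) = exp (- t * u) * exp (- r\<^sup>2 / (4 * u))"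
        by (simp flip: exp_add)
      then show ?thesis unfolding h using True tu assms by simp
    next
      case False
      then have "\<not> t * u > 0" using assms by (simp add: zero_less_mult_iff)
      then show ?thesis using False by simp
    qed
  qed
  also have "\<dots> = 4 * pi * yukawa 2 r t" by (simp add: yukawa_def set_lebesgue_integral_def)
  finally show ?thesis by simp
qed

text \<open>Half of the decay \<open>exp (- y / u)\<close> is given away to absorb the factor
  \<open>exp (norm h / u)\<close> in the Taylor remainder; the other half keeps the weight
  integrable near \<open>u = 0\<close>.\<close>

lemma DERIV_macdonald:
  assumes y: "y > 0"
  shows "(macdonald m has_real_derivative - macdonald (Suc m) y) (at y)"
proof -
  have "((\<lambda>y. LINT u|lborel. indicator {0<..} u *\<^sub>R (exp (- u - y / u) / u ^ m)) has_real_derivative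
      (LINT u|lborel. indicator {0<..} u *\<^sub>R (- (exp (- u - y / u) / u ^ Suc m)))) (at y)"
  proof (rule has_field_derivative_integral[where r = "y / 2" and w = "\<lambda>u. indicator {0<..} u *\<^sub>R (exp (- u - (y / 2) / u) / u ^ (m + 2))"])
    show "integrable lborel (\<lambda>u. indicator {0<..} u *\<^sub>R (exp (- u - (y + h) / u) / u ^ m))" if "norm h < y / 2" for h
      using set_integrable_macdonald[of "y + h" m] that by (simp add: set_integrable_def)
    show "integrable lborel (\<lambda>u. indicator {0<..} u *\<^sub>R (- (exp (- u - y / u) / u ^ Suc m)))"
      using integrable_minus[OF set_integrable_macdonald[OF y, of "Suc m", unfolded set_integrable_def]] by simp
    show "integrable lborel (\<lambda>u. indicator {0<..} u *\<^sub>R (exp (- u - (y / 2) / u) / u ^ (m + 2)))"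
      using set_integrable_macdonald[of "y / 2" "m + 2"] y by (simp add: set_integrable_def)
    fix h u :: real assume h: "norm h < y / 2"
    show "norm (indicator {0<..} u *\<^sub>R (exp (- u - (y + h) / u) / u ^ m) - indicator {0<..} u *\<^sub>R (exp (- u - y / u) / u ^ m)
        - h * (indicator {0<..} u *\<^sub>R (- (exp (- u - y / u) / u ^ Suc m))))
        \<le> (norm h)\<^sup>2 * (indicator {0<..} u *\<^sub>R (exp (- u - (y / 2) / u) / u ^ (m + 2)))"
    proof (cases "u > 0")
      case True
      define z where "z = - h / u"
      define E where "E = exp (- u - y / u) / u ^ m"
      have E: "E > 0" using True by (simp add: E_def)
      have "exp (- u - (y + h) / u) / u ^ m - exp (- u - y / u) / u ^ m - h * (- (exp (- u - y / u) / u ^ Suc m)) = E * (exp z - 1 - z)"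
      proof -
        have "exp (- u - (y + h) / u) = exp (- u - y / u) * exp z"
          by (simp add: z_def diff_divide_distrib add_divide_distrib flip: exp_add)
        then show ?thesis using True by (simp add: E_def z_def field_simps)
      qed
      also have "norm (E * (exp z - 1 - z)) \<le> E * (exp (norm z) * (norm z)\<^sup>2)"
        unfolding norm_mult using E exp_linear_remainder[of z] by (simp add: mult_left_mono)
      also have "\<dots> \<le> E * (exp ((y / 2) / u) * (norm z)\<^sup>2)"
      proof -
        have "norm z \<le> (y / 2) / u" using h True divide_right_mono[of "\<bar>h\<bar>" "y / 2" u] by (simp add: z_def)
        then show ?thesis using E by (intro mult_left_mono mult_right_mono) auto
      qed
      also have "\<dots> = (norm h)\<^sup>2 * (exp (- u - (y / 2) / u) / u ^ (m + 2))"
      proof -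
        have "exp (- u - y / u) * exp ((y / 2) / u) = exp (- u - (y / 2) / u)"
          unfolding exp_add[symmetric] by (simp add: field_simps)
        then show ?thesis using True by (simp add: E_def z_def power_divide power_add power2_eq_square field_simps)
      qed
      finally show ?thesis using True by simp
    qed auto
  qed (use y in auto)
  then show ?thesis unfolding macdonald_def[abs_def] set_lebesgue_integral_def by simp
qed

text \<open>The difference of the two sides is the integral of the derivative of
  \<open>exp (- u - y / u)\<close>, which vanishes at both ends. It makes
  \<open>- macdonald 0\<close> the flux belonging to \<open>macdonald 1\<close>.\<close>

lemma macdonald_0_2:
  assumes y: "y > 0"
  shows "macdonald 0 y = y * macdonald 2 y"
proof -
  have "(LINT u:{0<..}|lborel. y * (exp (- u - y / u) / u ^ 2) - exp (- u - y / u) / u ^ 0) = 0 - 0"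
  proof (rule set_integral_FTC_0_inf[where F = "\<lambda>u. exp (- u - y / u)"])
    show "((\<lambda>u. exp (- u - y / u)) has_real_derivative y * (exp (- u - y / u) / u ^ 2) - exp (- u - y / u) / u ^ 0) (at u)" if "u > 0" for u
      using that by (auto intro!: derivative_eq_intros simp: power2_eq_square field_simps)
    show "set_integrable lborel {0<..} (\<lambda>u. y * (exp (- u - y / u) / u ^ 2) - exp (- u - y / u) / u ^ 0)"
      by (intro set_integral_diff(1) set_integrable_mult_right set_integrable_macdonald y)
    show "((\<lambda>u. exp (- u - y / u)) \<longlongrightarrow> 0) (at_right 0)" "((\<lambda>u. exp (- u - y / u)) \<longlongrightarrow> 0) at_top"
      using y by real_asymp+
  qed (auto intro!: continuous_intros)
  moreover have "(LINT u:{0<..}|lborel. y * (exp (- u - y / u) / u ^ 2) - exp (- u - y / u) / u ^ 0) = y * macdonald 2 y - macdonald 0 y"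
    unfolding macdonald_def set_integral_mult_right[symmetric]
    by (intro set_integral_diff(2) set_integrable_mult_right set_integrable_macdonald y)
  ultimately show ?thesis by simp
qed

lemma abs_ln_le: "u > 0 \<Longrightarrow> \<bar>ln u\<bar> \<le> u + 1 / (u::real)"
proof -
  assume u: "u > 0"
  have "ln u \<le> u - 1" "ln (1 / u) \<le> 1 / u - 1" using u by (auto intro: ln_le_minus_one)
  moreover have "0 < 1 / u" "ln (1 / u) = - ln u" using u by (simp_all add: ln_div)
  ultimately show ?thesis using u by linarith
qed

lemma set_integrable_ln_macdonald:
  fixes y :: real
  assumes y: "y > 0"
  shows "set_integrable lborel {0<..} (\<lambda>u. ln u * (exp (- u - y / u) / u ^ m))"
proof (rule set_integrable_bound)
  show "set_integrable lborel {0<..} (\<lambda>u. 2 * (exp (- (1/2) * u - y / u) / u ^ m) + exp (- u - y / u) / u ^ Suc m)"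
    by (intro set_integral_add(1) set_integrable_mult_right set_integrable_macdonald set_integrable_macdonaldonald_gen y) auto
  show "AE u in lborel. u \<in> {0<..} \<longrightarrow> norm (ln u * (exp (- u - y / u) / u ^ m))
     \<le> norm (2 * (exp (- (1/2) * u - y / u) / u ^ m) + exp (- u - y / u) / u ^ Suc m)"
  proof (intro AE_I2 impI)
    fix u :: real assume "u \<in> {0<..}"
    then have u: "u > 0" by simp
    have "u * exp (- u - y / u) \<le> 2 * exp (- (1/2) * u - y / u)"
    proof -
      have "u / 2 \<le> exp (u / 2)" using exp_ge_add_one_self[of "u / 2"] by linarith
      then have "u * exp (- u - y / u) \<le> 2 * exp (u / 2) * exp (- u - y / u)" by (intro mult_right_mono) auto
      also have "\<dots> = 2 * exp (- (1/2) * u - y / u)" by (simp flip: exp_add)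
      finally show ?thesis .
    qed
    then have "u * exp (- u - y / u) / u ^ m \<le> 2 * exp (- (1/2) * u - y / u) / u ^ m"
      using u by (intro divide_right_mono) auto
    moreover have "\<bar>ln u\<bar> * (exp (- u - y / u) / u ^ m) \<le> (u + 1 / u) * (exp (- u - y / u) / u ^ m)"
      using u by (intro mult_right_mono abs_ln_le) auto
    moreover have "(u + 1 / u) * (exp (- u - y / u) / u ^ m) = u * exp (- u - y / u) / u ^ m + exp (- u - y / u) / u ^ Suc m"
      using u by (simp add: field_simps)
    ultimately show "norm (ln u * (exp (- u - y / u) / u ^ m))
     \<le> norm (2 * (exp (- (1/2) * u - y / u) / u ^ m) + exp (- u - y / u) / u ^ Suc m)"
      using u by (simp add: abs_mult)
  qed
qed (auto simp: set_borel_measurable_def)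

text \<open>\<open>macdonald 1\<close> diverges at 0; the right-hand side displays the logarithm
  explicitly next to a convergent integral. Integration by parts gives one relation between the
  logarithmic integrals \<open>L 0\<close> and \<open>L 2\<close>, inversion
  \<open>u -> y / u\<close> gives another, and eliminating \<open>L 2\<close> yields the
  claim.\<close>

lemma macdonald_1_ln:
  assumes y: "y > 0"
  shows "macdonald 1 y = 2 * (LINT u:{0<..}|lborel. ln u * exp (- u - y / u)) - macdonald 0 y * ln y"
proof -
  define e where "e m u = exp (- u - y / u) / u ^ m" for m :: nat and u
  define L where "L m = (LINT u:{0<..}|lborel. ln u * e m u)" for m
  have ie: "set_integrable lborel {0<..} (e m)" "set_integrable lborel {0<..} (\<lambda>u. ln u * e m u)" for m
    unfolding e_def using set_integrable_macdonald[OF y] set_integrable_ln_macdonald[OF y] by auto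
  have M: "macdonald m y = (LINT u:{0<..}|lborel. e m u)" for m by (simp add: macdonald_def e_def)
  have "(LINT u:{0<..}|lborel. e 1 u - ln u * e 0 u + y * (ln u * e 2 u)) = 0 - 0"
  proof (rule set_integral_FTC_0_inf[where F = "\<lambda>u. ln u * exp (- u - y / u)"])
    show "((\<lambda>u. ln u * exp (- u - y / u)) has_real_derivative e 1 u - ln u * e 0 u + y * (ln u * e 2 u)) (at u)" if "u > 0" for u
      using that unfolding e_def by (auto intro!: derivative_eq_intros simp: power2_eq_square field_simps)
    show "set_integrable lborel {0<..} (\<lambda>u. e 1 u - ln u * e 0 u + y * (ln u * e 2 u))"
      by (intro set_integral_diff(1) set_integral_add(1) set_integrable_mult_right ie)
    show "((\<lambda>u. ln u * exp (- u - y / u)) \<longlongrightarrow> 0) (at_right 0)" "((\<lambda>u. ln u * exp (- u - y / u)) \<longlongrightarrow> 0) at_top"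
      using y by real_asymp+
    show "isCont (\<lambda>u. e 1 u - ln u * e 0 u + y * (ln u * e 2 u)) u" if "u > 0" for u
      unfolding e_def using that by (auto intro!: continuous_intros)
  qed
  then have FTC: "macdonald 1 y - L 0 + y * L 2 = 0"
    by (simp add: set_integral_diff set_integral_add set_integrable_mult_right ie M L_def del: One_nat_def)
  have inv: "y / u\<^sup>2 * (ln (y / u) * e 0 (y / u)) = y * ln y * e 2 u - y * (ln u * e 2 u)" if "u > 0" for u
  proof -
    have "e 0 (y / u) = exp (- u - y / u)" using y that by (simp add: e_def algebra_simps)
    moreover have "e 2 u = exp (- u - y / u) / u\<^sup>2" by (simp add: e_def)
    ultimately show ?thesis using y that by (simp add: ln_div algebra_simps diff_divide_distrib)
  qed
  have "L 0 = (LINT u:{0<..}|lborel. y / u\<^sup>2 * (ln (y / u) * e 0 (y / u)))"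
    unfolding L_def
  proof (rule set_integral_inversion[OF y _ ie(2)])
    show "isCont (\<lambda>u. ln u * e 0 u) u" if "u > 0" for u
      unfolding e_def using that by (auto intro!: continuous_intros)
    have "set_integrable lborel {0<..} (\<lambda>u. y * ln y * e 2 u - y * (ln u * e 2 u))"
      by (intro set_integral_diff(1) set_integrable_mult_right ie)
    then show "set_integrable lborel {0<..} (\<lambda>u. y / u\<^sup>2 * (ln (y / u) * e 0 (y / u)))"
      by (rule iffD2[OF set_integrable_cong, OF refl refl, rotated]) (simp only: inv greaterThan_iff)
  qed
  also have "\<dots> = (LINT u:{0<..}|lborel. y * ln y * e 2 u - y * (ln u * e 2 u))"
    using inv by (intro set_lebesgue_integral_cong) auto
  also have "\<dots> = ln y * (y * macdonald 2 y) - y * L 2"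
    by (simp add: set_integral_diff set_integrable_mult_right ie M L_def)
  also have "y * macdonald 2 y = macdonald 0 y" using macdonald_0_2[OF y] by simp
  finally have "macdonald 1 y = 2 * L 0 - macdonald 0 y * ln y" using FTC by (simp add: mult.commute)
  then show ?thesis by (simp add: L_def e_def)
qed

lemma exp_minus_le_inverse_square: "(u::real) > 0 \<Longrightarrow> exp (- u) \<le> 2 / u\<^sup>2"
  using exp_lower_Taylor_quadratic[of u] by (simp add: exp_minus field_simps)

lemma exp_minus_le_inverse_cube: "(u::real) > 0 \<Longrightarrow> exp (- u) \<le> 6 / u ^ 3"
proof -
  assume u: "u > 0"
  have "u ^ 3 /\<^sub>R fact 3 \<le> (\<Sum>n. u ^ n /\<^sub>R fact n)"
    using sum_le_suminf[OF summable_exp_generic[of u], of "{3}"] u by simp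
  then have "u ^ 3 / 6 \<le> exp u" by (simp add: exp_def fact_numeral)
  then show ?thesis using u by (simp add: exp_minus field_simps)
qed

lemma set_integrable_powr_exp:
  "set_integrable lborel {0<..} (\<lambda>u::real. u powr (- 1 / 2) * exp (- u))"
proof (rule set_integrable_two_powers[where p = "- 1 / 2" and q = "- 2" and A = 1 and B = 2])
  show "norm (u powr (- 1 / 2) * exp (- u)) \<le> 2 * u powr (- 2)" if "1 \<le> u" for u :: real
  proof -
    have "u powr (- 1 / 2) * exp (- u) \<le> 1 * (2 / u\<^sup>2)"
      using that exp_minus_le_inverse_square[of u] powr_mono[of "- 1 / 2" 0 u] by (intro mult_mono) auto
    then show ?thesis using that by (simp add: abs_mult powr_minus_divide)
  qed
qed (auto simp: abs_mult mult_left_le)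

lemma set_integrable_ln_exp:
  "set_integrable lborel {0<..} (\<lambda>u::real. ln u * exp (- u))"
proof (rule set_integrable_two_powers[where p = "- 1 / 2" and q = "- 2" and A = 2 and B = 6])
  show "norm (ln u * exp (- u)) \<le> 2 * u powr (- 1 / 2)" if "0 < u" "u \<le> 1" for u :: real
  proof -
    have "ln (u powr (- 1 / 2)) \<le> u powr (- 1 / 2) - 1" using that by (intro ln_le_minus_one) auto
    then have "- ln u \<le> 2 * u powr (- 1 / 2)" using that by (simp add: ln_powr)
    then have "- ln u * exp (- u) \<le> 2 * u powr (- 1 / 2) * 1" using that by (intro mult_mono) auto
    then show ?thesis using that by (simp add: abs_mult)
  qed
  show "norm (ln u * exp (- u)) \<le> 6 * u powr (- 2)" if "1 \<le> u" for u :: real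
  proof -
    have "ln u * exp (- u) \<le> u * (6 / u ^ 3)"
      using that exp_minus_le_inverse_cube[of u] ln_le_minus_one[of u] by (intro mult_mono) auto
    also have "\<dots> = 6 * u powr (- 2)" using that by (simp add: powr_minus_divide power2_eq_square power3_eq_cube)
    finally show ?thesis using that by (simp add: abs_mult)
  qed
qed auto

lemma has_integral_Ici_Ioi:
  fixes f :: "real \<Rightarrow> real"
  shows "(f has_integral y) {0..} \<longleftrightarrow> (f has_integral y) {0<..}"
proof (rule has_integral_spike_set_eq)
  show "negligible {x \<in> {0..} - {0<..}. f x \<noteq> 0}" "negligible {x \<in> {0<..} - {0..}. f x \<noteq> 0}"
    by (rule negligible_subset[of "{0}"]; auto)+
qed

lemma has_integral_0_inf:
  fixes f :: "real \<Rightarrow> real"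
  assumes "set_integrable lborel {0<..} f"
  shows "(f has_integral (LINT u:{0<..}|lborel. f u)) {0..}"
  unfolding has_integral_Ici_Ioi using set_borel_integral_eq_integral[OF assms] by (simp add: has_integral_iff)

text \<open>By convexity \<open>u powr h - 1 \<ge> h * ln u\<close>, so \<open>h \<mapsto> Gamma (1 + h) - 1 - h * (\<integral> ln u exp (- u))\<close> has a
  minimum at \<open>0\<close>; its derivative there vanishes.\<close>

lemma integral_ln_exp: "(LINT u:{0<..}|lborel. ln u * exp (- u)) = - (euler_mascheroni::real)"
proof -
  define l where "l = (LINT u:{0<..}|lborel. ln u * exp (- u :: real))"
  have hl: "((\<lambda>u. ln u * exp (- u)) has_integral l) {0..}"
    unfolding l_def by (rule has_integral_0_inf[OF set_integrable_ln_exp])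
  have h1: "((\<lambda>u::real. exp (- u)) has_integral 1) {0..}"
    using has_integral_exp_minus_to_infinity[of 1 0] by simp
  define f where "f h = Gamma (1 + h) - 1 - h * l" for h :: real
  have pos: "f h \<ge> 0" if "\<bar>h\<bar> < 1" for h
  proof -
    have "((\<lambda>u. u powr (1 + h - 1) / exp u) has_integral Gamma (1 + h)) {0..}"
      using that by (intro Gamma_integral_real) auto
    then have "((\<lambda>u. u powr (1 + h - 1) / exp u - exp (- u) - h * (ln u * exp (- u))) has_integral f h) {0..}"
      unfolding f_def by (intro has_integral_diff h1 has_integral_mult_right hl)
    then have "((\<lambda>u. u powr (1 + h - 1) / exp u - exp (- u) - h * (ln u * exp (- u))) has_integral f h) {0<..}"
      by (simp only: has_integral_Ici_Ioi)
    then show "f h \<ge> 0"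
    proof (rule has_integral_nonneg)
      fix u :: real assume "u \<in> {0<..}"
      then have u: "u > 0" by simp
      have "1 + h * ln u \<le> exp (h * ln u)" by (rule exp_ge_add_one_self)
      then have "(1 + h * ln u) * exp (- u) \<le> u powr h * exp (- u)"
        using u by (intro mult_right_mono) (auto simp: powr_def)
      then show "0 \<le> u powr (1 + h - 1) / exp u - exp (- u) - h * (ln u * exp (- u))"
        by (simp add: exp_minus field_simps)
    qed
  qed
  have "(f has_real_derivative Gamma 1 * Digamma 1 - l) (at 0)"
    unfolding f_def[abs_def]
    by (auto intro!: derivative_eq_intros simp: nonpos_Ints_def)
  then have "(f has_real_derivative - euler_mascheroni - l) (at 0)" by (simp add: Digamma_1)
  then have "- euler_mascheroni - l = 0"
    by (rule DERIV_local_min[of _ _ _ 1]) (use pos in \<open>auto simp: f_def\<close>)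
  then show ?thesis by (simp add: l_def)
qed

text \<open>By \<open>macdonald_1_ln\<close> the first limit is twice the integral of
  \<open>ln u * exp (- u)\<close>, which is where the Euler constant enters. The limits coincide
  with those of \<open>log_solution\<close> and, up to sign, of its flux.\<close>

lemma macdonald_limits:
  "((\<lambda>y. macdonald 1 y + ln y) \<longlongrightarrow> - 2 * euler_mascheroni) (at_right 0)" "(macdonald 0 \<longlongrightarrow> 1) (at_right 0)"
proof -
  define K where "K = (LINT u:{0<..}|lborel. u powr (- 1 / 2) * exp (- u :: real))"
  have e1: "set_integrable lborel {0<..} (\<lambda>u::real. exp (- u))" "(LINT u:{0<..}|lborel. exp (- u :: real)) = 1"
  proof -
    show "set_integrable lborel {0<..} (\<lambda>u::real. exp (- u))"
      by (rule set_integrable_subset[OF set_integral_exp_minus(1)[of 1 0, simplified]]) auto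
    then have "((\<lambda>u::real. exp (- u)) has_integral (LINT u:{0<..}|lborel. exp (- u :: real))) {0..}"
      by (rule has_integral_0_inf)
    moreover have "((\<lambda>u::real. exp (- u)) has_integral 1) {0..}"
      using has_integral_exp_minus_to_infinity[of 1 0] by simp
    ultimately show "(LINT u:{0<..}|lborel. exp (- u :: real)) = 1" by (rule has_integral_unique)
  qed
  \<comment> \<open>Convergence alone would not suffice: this difference is later multiplied by
    \<open>ln y\<close>, and the rate \<open>sqrt y\<close> beats the logarithm. It comes from
    \<open>1 - exp (- x) \<le> sqrt x\<close> at \<open>x = y / u\<close>.\<close>
  have bound: "norm (1 - macdonald 0 y) \<le> K * sqrt y" if y: "y > 0" for y
  proof -
    have "1 - macdonald 0 y = (LINT u:{0<..}|lborel. exp (- u) - exp (- u - y / u) / u ^ 0)"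
      unfolding macdonald_def e1(2)[symmetric]
      by (rule set_integral_diff(2)[symmetric, OF e1(1) set_integrable_macdonald[OF y]])
    moreover have "\<bar>LINT u:{0<..}|lborel. exp (- u) - exp (- u - y / u) / u ^ 0\<bar> \<le> (LINT u:{0<..}|lborel. sqrt y * (u powr (- 1 / 2) * exp (- u)))"
    proof -
      have ub: "\<bar>exp (- u) - exp (- u - y / u) / u ^ 0\<bar> \<le> sqrt y * (u powr (- 1 / 2) * exp (- u))" if u: "u > 0" for u
      proof -
        define x where "x = y / u"
        have x: "x > 0" using y u by (simp add: x_def)
        have "1 - exp (- x) \<le> sqrt x"
        proof (cases "x \<le> 1")
          case True
          have "1 - exp (- x) \<le> x" using exp_ge_add_one_self[of "- x"] by linarith
          also have "x \<le> sqrt x" using True x by (intro real_le_rsqrt) (simp add: power2_eq_square mult_left_le)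
          finally show ?thesis .
        next
          case False
          have "1 - exp (- x) \<le> 1" by simp
          also have "1 \<le> sqrt x" using False by simp
          finally show ?thesis .
        qed
        then have "(1 - exp (- x)) * exp (- u) \<le> sqrt x * exp (- u)" by (intro mult_right_mono) auto
        also have "sqrt x = sqrt y * u powr (- 1 / 2)"
          using u by (simp add: x_def real_sqrt_divide powr_minus powr_half_sqrt field_simps)
        finally have "(1 - exp (- x)) * exp (- u) \<le> sqrt y * (u powr (- 1 / 2) * exp (- u))" by simp
        moreover have "exp (- u) - exp (- u - y / u) / u ^ 0 = (1 - exp (- x)) * exp (- u)"
          by (simp add: x_def algebra_simps flip: exp_add)
        moreover have "0 \<le> (1 - exp (- x)) * exp (- u)" using x by (intro mult_nonneg_nonneg) auto
        ultimately show ?thesis by simp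
      qed
      have int: "set_integrable lborel {0<..} (\<lambda>u. exp (- u) - exp (- u - y / u) / u ^ 0)"
        by (rule set_integral_diff(1)[OF e1(1) set_integrable_macdonald[OF y]])
      have "\<bar>LINT u:{0<..}|lborel. exp (- u) - exp (- u - y / u) / u ^ 0\<bar> \<le> (LINT u:{0<..}|lborel. \<bar>exp (- u) - exp (- u - y / u) / u ^ 0\<bar>)"
        using set_integral_norm_bound[OF int] by simp
      also have "\<dots> \<le> (LINT u:{0<..}|lborel. sqrt y * (u powr (- 1 / 2) * exp (- u)))"
        by (rule set_integral_mono) (use ub set_integrable_norm[OF int] set_integrable_powr_exp in auto)
      finally show ?thesis .
    qed
    ultimately show ?thesis by (simp add: K_def mult.commute)
  qed
  have s0: "((\<lambda>y. K * sqrt y) \<longlongrightarrow> 0) (at_right 0)" by (auto intro!: tendsto_eq_intros)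
  have "((\<lambda>y. 1 - macdonald 0 y) \<longlongrightarrow> 0) (at_right 0)"
    by (rule Lim_null_comparison[OF _ s0], rule eventually_at_rightI[of 0 1]) (use bound in auto)
  then have "((\<lambda>y. 1 - (1 - macdonald 0 y)) \<longlongrightarrow> 1 - 0) (at_right 0)" by (intro tendsto_intros)
  then show "(macdonald 0 \<longlongrightarrow> 1) (at_right 0)" by simp
  have L: "((\<lambda>y. LINT u:{0<..}|lborel. ln u * exp (- u - y / u :: real)) \<longlongrightarrow> (LINT u:{0<..}|lborel. ln u * exp (- u :: real))) (at_right 0)"
    unfolding set_lebesgue_integral_def
  proof (rule tendsto_integral_at_right[of 0 1])
    show "integrable lborel (\<lambda>u::real. indicator {0<..} u *\<^sub>R \<bar>ln u * exp (- u)\<bar>)"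
      using integrable_norm[OF set_integrable_ln_exp[unfolded set_integrable_def]] by (simp add: abs_mult)
    show "norm (indicator {0<..} u *\<^sub>R (ln u * exp (- u - d / u))) \<le> indicator {0<..} u *\<^sub>R \<bar>ln u * exp (- u)\<bar>" if "0 < d" for d u :: real
      using that by (auto simp: indicator_def abs_mult intro!: mult_left_mono)
    show "((\<lambda>d. indicator {0<..} u *\<^sub>R (ln u * exp (- u - d / u))) \<longlongrightarrow> indicator {0<..} u *\<^sub>R (ln u * exp (- u))) (at_right 0)" for u :: real
      by (cases "u > 0") (auto intro!: tendsto_eq_intros)
  qed auto
  have "((\<lambda>y. (1 - macdonald 0 y) * ln y) \<longlongrightarrow> 0) (at_right 0)"
  proof (rule Lim_null_comparison)
    show "((\<lambda>y. K * (sqrt y * \<bar>ln y\<bar>)) \<longlongrightarrow> 0) (at_right 0)"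
    proof -
      have "((\<lambda>y::real. sqrt y * \<bar>ln y\<bar>) \<longlongrightarrow> 0) (at_right 0)" by real_asymp
      then show ?thesis by (rule tendsto_mult_right_zero)
    qed
    show "\<forall>\<^sub>F y in at_right 0. norm ((1 - macdonald 0 y) * ln y) \<le> K * (sqrt y * \<bar>ln y\<bar>)"
    proof (rule eventually_at_rightI[of 0 1])
      fix y :: real assume "y \<in> {0<..<1}"
      then show "norm ((1 - macdonald 0 y) * ln y) \<le> K * (sqrt y * \<bar>ln y\<bar>)"
        using mult_right_mono[OF bound[of y], of "\<bar>ln y\<bar>"] by (simp add: abs_mult mult.assoc)
    qed auto
  qed
  then have "((\<lambda>y. 2 * (LINT u:{0<..}|lborel. ln u * exp (- u - y / u :: real)) + (1 - macdonald 0 y) * ln y) \<longlongrightarrow> 2 * (- euler_mascheroni) + 0) (at_right 0)"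
    by (intro tendsto_intros L[unfolded integral_ln_exp])
  then have "((\<lambda>y. 2 * (LINT u:{0<..}|lborel. ln u * exp (- u - y / u :: real)) + (1 - macdonald 0 y) * ln y) \<longlongrightarrow> - 2 * euler_mascheroni) (at_right 0)"
    by simp
  then show "((\<lambda>y. macdonald 1 y + ln y) \<longlongrightarrow> - 2 * euler_mascheroni) (at_right 0)"
    by (rule Lim_transform_eventually) (rule eventually_at_rightI[of 0 1], use macdonald_1_ln in \<open>auto simp: algebra_simps\<close>)
qed

text \<open>Both functions solve the same first-order system, with fluxes
  \<open>- macdonald 0\<close> and \<open>log_solution_flux\<close>, and the differences tend to 0
  at the origin. The range \<open>y < 1\<close> is that of the contraction argument and is enough
  for analytic continuation.\<close>

lemma macdonald_eq_log_solution:
  assumes "0 < y" "y < 1"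
  shows "macdonald 1 y = log_solution y"
proof -
  have "macdonald 1 y - log_solution y = 0"
  proof (rule bessel_system_unique[where D = "\<lambda>y. macdonald 1 y - log_solution y" and P = "\<lambda>y. - macdonald 0 y - log_solution_flux y"])
    fix x :: real assume x: "x > 0"
    have "((\<lambda>y. macdonald 1 y - log_solution y) has_real_derivative - macdonald (Suc 1) x - log_solution_flux x / x) (at x)"
      by (intro DERIV_diff DERIV_macdonald DERIV_log_solution x)
    also have "- macdonald (Suc 1) x - log_solution_flux x / x = (- macdonald 0 x - log_solution_flux x) / x"
      using x macdonald_0_2[OF x] by (simp add: numeral_2_eq_2 field_simps)
    finally show "((\<lambda>y. macdonald 1 y - log_solution y) has_real_derivative (- macdonald 0 x - log_solution_flux x) / x) (at x)" .
    have "((\<lambda>y. - macdonald 0 y - log_solution_flux y) has_real_derivative - (- macdonald (Suc 0) x) - log_solution x) (at x)"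
      by (intro DERIV_diff DERIV_minus DERIV_macdonald DERIV_log_solution x)
    then show "((\<lambda>y. - macdonald 0 y - log_solution_flux y) has_real_derivative macdonald 1 x - log_solution x) (at x)" by simp
  next
    show "((\<lambda>y. macdonald 1 y - log_solution y) \<longlongrightarrow> 0) (at_right 0)"
      using tendsto_diff[OF macdonald_limits(1) log_solution_limits(1)] by simp
    show "((\<lambda>y. - macdonald 0 y - log_solution_flux y) \<longlongrightarrow> 0) (at_right 0)"
      using tendsto_diff[OF tendsto_minus[OF macdonald_limits(2)] log_solution_limits(2)] by simp
  qed (use assms in auto)
  then show ?thesis by simp
qed

lemma holomorphic_entire_series [holomorphic_intros]:
  assumes "entire_coeffs c" "f holomorphic_on S"
  shows "(\<lambda>z. entire_series c (f z)) holomorphic_on S"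
proof -
  have "entire_series c holomorphic_on UNIV"
    using DERIV_entire_series[OF assms(1)] by (auto simp: holomorphic_on_def field_differentiable_def)
  then show ?thesis
    using holomorphic_on_compose_gen[OF assms(2), of "entire_series c" UNIV] by (simp add: comp_def)
qed

text \<open>The formula holds for real \<open>t\<close> with
  \<open>t * (norm x)\<^sup>2 / 4 < 1\<close> by \<open>macdonald_eq_log_solution\<close>, and both
  sides are holomorphic on the slit plane.\<close>

lemma green_2:
  fixes x :: "real^2"
  assumes x: "x \<noteq> 0" and t: "t \<notin> \<real>\<^sub>\<le>\<^sub>0"
  shows "green x t = (- (Ln t + of_real (ln ((norm x)\<^sup>2 / 4) + 2 * euler_mascheroni)) * entire_series bessel_coeff (t * of_real ((norm x)\<^sup>2 / 4))
     + 2 * entire_series bessel_harm_coeff (t * of_real ((norm x)\<^sup>2 / 4))) / of_real (4 * pi)"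
proof -
  define c where "c = (norm x)\<^sup>2 / 4"
  have c: "c > 0" using x by (simp add: c_def)
  have "green x t = (- (Ln t + of_real (ln c + 2 * euler_mascheroni)) * entire_series bessel_coeff (t * of_real c) + 2 * entire_series bessel_harm_coeff (t * of_real c)) / of_real (4 * pi)"
  proof (rule green_eqI[OF x _ _ _ t, where T = "1 / c"])
    show "(\<lambda>t. (- (Ln t + of_real (ln c + 2 * euler_mascheroni)) * entire_series bessel_coeff (t * of_real c) + 2 * entire_series bessel_harm_coeff (t * of_real c)) / of_real (4 * pi))
        holomorphic_on - \<real>\<^sub>\<le>\<^sub>0"
      by (intro holomorphic_intros entire_bessel_coeff entire_bessel_harm_coeff) auto
    fix t :: real assume t: "0 < t" "t < 1 / c"
    then have tc: "0 < t * c" "t * c < 1" using c by (auto simp: field_simps)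
    have "(- (Ln (of_real t) + of_real (ln c + 2 * euler_mascheroni)) * entire_series bessel_coeff (of_real t * of_real c) + 2 * entire_series bessel_harm_coeff (of_real t * of_real c)) / of_real (4 * pi)
      = complex_of_real (log_solution (t * c) / (4 * pi))"
      using t c entire_series_of_real[OF entire_bessel_coeff, of "t * c", where 'a = complex] entire_series_of_real[OF entire_bessel_harm_coeff, of "t * c", where 'a = complex]
      by (simp add: log_solution_def Ln_of_real ln_mult algebra_simps)
    also have "log_solution (t * c) = macdonald 1 (t * (norm x)\<^sup>2 / 4)"
      using macdonald_eq_log_solution[OF tc] by (simp add: c_def)
    also have "macdonald 1 (t * (norm x)\<^sup>2 / 4) / (4 * pi) = yukawa DIM(real^2) (norm x) t"
      using yukawa_2[of "norm x" t] x t by simp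
    finally show "(- (Ln (of_real t) + of_real (ln c + 2 * euler_mascheroni)) * entire_series bessel_coeff (of_real t * of_real c) + 2 * entire_series bessel_harm_coeff (of_real t * of_real c)) / of_real (4 * pi)
      = complex_of_real (yukawa DIM(real^2) (norm x) t)" .
  qed (use c in auto)
  then show ?thesis by (simp only: c_def)
qed

subsection \<open>The Helmholtz part\<close>

text \<open>This choice of branch makes the solution outgoing: the root with nonnegative real part
  is \<open>- \<i> * csqrt w\<close>, so the decaying exponential in \<open>csqrt (- w)\<close>
  turns into \<open>exp (\<i> * k * r)\<close> in the limit.\<close>

lemma csqrt_minus_upper:
  assumes "Im w > 0"
  shows "csqrt (- w) = - \<i> * csqrt w"
proof (rule csqrt_unique)
  show "(- \<i> * csqrt w)\<^sup>2 = - w" by (simp add: power_mult_distrib)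
  have "w = csqrt w ^ 2" by simp
  then have "Im w = 2 * Re (csqrt w) * Im (csqrt w)" by (metis Im_power2)
  moreover have "Re (csqrt w) \<ge> 0" by (rule Re_csqrt)
  ultimately have "Im (csqrt w) > 0" using assms by (metis zero_less_mult_iff mult_nonneg_nonpos not_less zero_le_numeral mult_nonneg_nonneg)
  then show "0 < Re (- \<i> * csqrt w) \<or> Re (- \<i> * csqrt w) = 0 \<and> 0 \<le> Im (- \<i> * csqrt w)" by simp
qed

context symbol begin

context
  fixes k :: real
  assumes k: "k > 0" and ak: "a = k powr (2 * s)"
begin

lemma spectral_point_tendsto: "(spectral_point \<longlongrightarrow> of_real (k\<^sup>2)) (at_right 0)"
proof -
  have c: "((\<lambda>e. Complex a e) \<longlongrightarrow> Complex a 0) (at_right 0)"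
    unfolding Complex_eq by (auto intro!: tendsto_eq_intros)
  have "((\<lambda>e. exp (Ln (Complex a e) / of_real s)) \<longlongrightarrow> exp (Ln (Complex a 0) / of_real s)) (at_right 0)"
    using s a by (intro tendsto_intros c) (auto simp: complex_nonpos_Reals_iff)
  also have "exp (Ln (Complex a 0) / of_real s) = of_real (k\<^sup>2)"
  proof -
    have "Ln (Complex a 0) = of_real (ln a)" using a by (simp add: Ln_of_real flip: complex_of_real_def)
    moreover have "ln a / s = 2 * ln k" using s k by (simp add: ak ln_powr)
    ultimately have "exp (Ln (Complex a 0) / of_real s) = of_real (exp (2 * ln k))"
      by (metis exp_of_real of_real_divide)
    also have "exp (2 * ln k) = k\<^sup>2" using k by (simp add: exp_double)
    finally show ?thesis .
  qed
  finally show ?thesis by (simp add: spectral_point_def[abs_def])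
qed

text \<open>The limit \<open>k\<^sup>2 / (s * k powr (2 * s))\<close> is the factor by which the
  Helmholtz parts here differ from the classical outgoing solutions.\<close>

lemma residue_tendsto:
  "((\<lambda>e. spectral_point e / (of_real s * Complex a e)) \<longlongrightarrow> of_real (k powr (2 - 2 * s) / s)) (at_right 0)"
proof -
  have c: "((\<lambda>e. Complex a e) \<longlongrightarrow> Complex a 0) (at_right 0)"
    unfolding Complex_eq by (auto intro!: tendsto_eq_intros)
  have "((\<lambda>e. spectral_point e / (of_real s * Complex a e)) \<longlongrightarrow> of_real (k\<^sup>2) / (of_real s * Complex a 0)) (at_right 0)"
    using s a by (intro tendsto_intros c spectral_point_tendsto) (auto simp: complex_eq_iff)
  also have "of_real (k\<^sup>2) / (of_real s * Complex a 0) = of_real (k\<^sup>2 / (s * a))"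
    by (simp flip: complex_of_real_def)
  also have "k\<^sup>2 / (s * a) = k powr (2 - 2 * s) / s"
    using k by (simp add: ak powr_diff)
  finally show ?thesis .
qed

lemma eventually_upper: "eventually (\<lambda>e. Im (spectral_point e) > 0) (at_right 0)"
proof (rule eventually_at_rightI)
  show "(0::real) < sin (pi * s) * a / 4" using sin_pos a by (intro divide_pos_pos mult_pos_pos) auto
qed (auto intro!: Im_spectral_point)

lemma csqrt_tendsto: "((\<lambda>e. csqrt (- spectral_point e)) \<longlongrightarrow> - \<i> * of_real k) (at_right 0)"
proof -
  have "((\<lambda>e. - \<i> * csqrt (spectral_point e)) \<longlongrightarrow> - \<i> * csqrt (of_real (k\<^sup>2))) (at_right 0)"
    using k by (intro tendsto_mult tendsto_const isCont_tendsto_compose[OF _ spectral_point_tendsto] continuous_at_csqrt)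
      (auto simp: complex_nonpos_Reals_iff simp flip: of_real_power)
  also have "csqrt (of_real (k\<^sup>2)) = of_real k" using k by (subst csqrt_of_real_nonneg) auto
  finally show ?thesis
    by (rule Lim_transform_eventually) (rule eventually_mono[OF eventually_upper], simp add: csqrt_minus_upper)
qed

lemma slit_of_upper: "Im w > 0 \<Longrightarrow> - w \<notin> \<real>\<^sub>\<le>\<^sub>0"
  by (auto simp: complex_nonpos_Reals_iff)

lemma helm_1:
  assumes x: "(x::real) \<noteq> 0"
  shows "((\<lambda>e. spectral_point e / (of_real s * Complex a e) * green x (- spectral_point e)) \<longlongrightarrow> G1_helm s k x) (at_right 0)"
proof -
  have "((\<lambda>e. spectral_point e / (of_real s * Complex a e) * (exp (- (csqrt (- spectral_point e) * of_real \<bar>x\<bar>)) / (2 * csqrt (- spectral_point e))))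
     \<longlongrightarrow> of_real (k powr (2 - 2 * s) / s) * (exp (- (- \<i> * of_real k * of_real \<bar>x\<bar>)) / (2 * (- \<i> * of_real k)))) (at_right 0)"
    using k by (intro tendsto_intros residue_tendsto csqrt_tendsto) auto
  also have "of_real (k powr (2 - 2 * s) / s) * (exp (- (- \<i> * of_real k * of_real \<bar>x\<bar>)) / (2 * (- \<i> * of_real k))) = G1_helm s k x"
  proof -
    have "k powr (2 - 2 * s) = k powr (1 - (2 * s - 1))" by simp
    also have "\<dots> = k / k powr (2 * s - 1)" using k by (simp only: powr_diff powr_one)
    finally have "k powr (2 - 2 * s) = k / k powr (2 * s - 1)" .
    then have C: "complex_of_real (k powr (2 - 2 * s)) = of_real k / of_real (k powr (2 * s - 1))"
      by (simp only: of_real_divide)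
    have "complex_of_real (k powr (2 * s - 1)) \<noteq> 0" using k by simp
    then show ?thesis
      using k s unfolding G1_helm_def of_real_divide C by (simp add: field_simps)
  qed
  finally show ?thesis
    by (rule Lim_transform_eventually)
      (rule eventually_mono[OF eventually_upper], use green_1[OF x slit_of_upper] in simp)
qed

lemma helm_3:
  assumes x: "(x::real^3) \<noteq> 0"
  shows "((\<lambda>e. spectral_point e / (of_real s * Complex a e) * green x (- spectral_point e)) \<longlongrightarrow> G3_helm s k x) (at_right 0)"
proof -
  have "((\<lambda>e. spectral_point e / (of_real s * Complex a e) * (exp (- (csqrt (- spectral_point e) * of_real (norm x))) / of_real (4 * pi * norm x)))
     \<longlongrightarrow> of_real (k powr (2 - 2 * s) / s) * (exp (- (- \<i> * of_real k * of_real (norm x))) / of_real (4 * pi * norm x))) (at_right 0)"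
    using x by (intro tendsto_intros residue_tendsto csqrt_tendsto) auto
  also have "of_real (k powr (2 - 2 * s) / s) * (exp (- (- \<i> * of_real k * of_real (norm x))) / of_real (4 * pi * norm x)) = G3_helm s k x"
    by (simp add: G3_helm_def mult.assoc)
  finally show ?thesis
    by (rule Lim_transform_eventually)
      (rule eventually_mono[OF eventually_upper], use green_3[OF x slit_of_upper] in simp)
qed

lemma besselJ0_entire_series: "besselJ0 z = entire_series bessel_coeff (- (z / 2)\<^sup>2)"
  unfolding besselJ0_def entire_series_def bessel_coeff_def
  by (rule suminf_cong) (simp add: power_mult power_minus[of "(z / 2)\<^sup>2"])

text \<open>The defining series starts at index 1; since \<open>harm 0 = 0\<close>, it can be
  completed to a full power series. Its sign \<open>(-1) ^ m\<close> belongs to the power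
  \<open>m + 1\<close>, hence the minus sign here.\<close>

lemma besselY0_entire_series: "besselY0 z = 2 / pi * (ln (z / 2) + euler_mascheroni) * entire_series bessel_coeff (- (z / 2)\<^sup>2) - 2 / pi * entire_series bessel_harm_coeff (- (z / 2)\<^sup>2)"
proof -
  define q where "q = (z / 2)\<^sup>2"
  have "entire_series bessel_harm_coeff (- q) = (\<Sum>n. bessel_harm_coeff (Suc n) * (- q) ^ Suc n) + bessel_harm_coeff 0"
    using suminf_split_head[OF summable_entire_series[OF entire_bessel_harm_coeff, of "- q"]] by (simp add: entire_series_def)
  also have "(\<lambda>n. bessel_harm_coeff (Suc n) * (- q) ^ Suc n) = (\<lambda>n. - ((-1) ^ n * harm (n + 1) * (z / 2) ^ (2 * (n + 1)) / (fact (n + 1))\<^sup>2))"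
    by (rule ext) (simp only: q_def bessel_harm_coeff_def power_mult power_minus[of "(z / 2)\<^sup>2"] Suc_eq_plus1, simp)
  also have "(\<Sum>n. - ((-1) ^ n * harm (n + 1) * (z / 2) ^ (2 * (n + 1)) / (fact (n + 1))\<^sup>2))
      = - (\<Sum>n. (-1) ^ n * harm (n + 1) * (z / 2) ^ (2 * (n + 1)) / (fact (n + 1))\<^sup>2)"
  proof (rule suminf_minus)
    have "summable (\<lambda>n. - (bessel_harm_coeff (Suc n) * (- q) ^ Suc n))"
      using summable_minus[OF summable_Suc_iff[THEN iffD2, OF summable_entire_series[OF entire_bessel_harm_coeff, of "- q"]]] by simp
    also have "(\<lambda>n. - (bessel_harm_coeff (Suc n) * (- q) ^ Suc n)) = (\<lambda>n. (-1) ^ n * harm (n + 1) * (z / 2) ^ (2 * (n + 1)) / (fact (n + 1))\<^sup>2)"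
      by (rule ext) (simp only: q_def bessel_harm_coeff_def power_mult power_minus[of "(z / 2)\<^sup>2"] Suc_eq_plus1, simp)
    finally show "summable (\<lambda>n. (-1) ^ n * harm (n + 1) * (z / 2) ^ (2 * (n + 1)) / (fact (n + 1))\<^sup>2)" .
  qed
  finally have "(\<Sum>n. (-1) ^ n * harm (n + 1) * (z / 2) ^ (2 * (n + 1)) / (fact (n + 1))\<^sup>2) = - entire_series bessel_harm_coeff (- q)"
    by (simp add: bessel_harm_coeff_def[of 0] harm_def[of 0])
  then show ?thesis
    unfolding besselY0_def besselJ0_entire_series q_def[symmetric] by (simp only:)
qed

text \<open>For \<open>w\<close> in the upper half-plane \<open>Ln (- w) = Ln w - \<i> * pi\<close>.
  The shift by \<open>- \<i> * pi\<close> multiplies the regular Bessel series and produces the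
  \<open>J_0\<close> part of the Hankel function, while the real logarithm produces
  \<open>Y_0\<close>.\<close>

lemma helm_2:
  assumes x: "(x::real^2) \<noteq> 0"
  shows "((\<lambda>e. spectral_point e / (of_real s * Complex a e) * green x (- spectral_point e)) \<longlongrightarrow> G2_helm s k x) (at_right 0)"
proof -
  define c where "c = (norm x)\<^sup>2 / 4"
  have c: "c > 0" using x by (simp add: c_def)
  let ?E = "\<lambda>w. (- (Ln w - \<i> * of_real pi + of_real (ln c + 2 * euler_mascheroni)) * entire_series bessel_coeff (- w * of_real c) + 2 * entire_series bessel_harm_coeff (- w * of_real c)) / of_real (4 * pi)"
  note pt = isCont_tendsto_compose[OF isCont_entire_series]
  have "((\<lambda>e. spectral_point e / (of_real s * Complex a e) * ?E (spectral_point e)) \<longlongrightarrow> of_real (k powr (2 - 2 * s) / s) * ?E (of_real (k\<^sup>2))) (at_right 0)"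
    using k by (intro tendsto_intros residue_tendsto spectral_point_tendsto pt[OF entire_bessel_coeff] pt[OF entire_bessel_harm_coeff])
      (auto simp: complex_nonpos_Reals_iff simp flip: of_real_power)
  also have "of_real (k powr (2 - 2 * s) / s) * ?E (of_real (k\<^sup>2)) = G2_helm s k x"
  proof -
    define q where "q = (k * norm x / 2)\<^sup>2"
    have q: "- of_real (k\<^sup>2) * complex_of_real c = of_real (- q)" by (simp add: q_def c_def power_mult_distrib power_divide)
    have l: "ln (k * norm x / 2) = (ln (k\<^sup>2) + ln c) / 2"
    proof -
      have "c = (norm x / 2)\<^sup>2" by (simp add: c_def power_divide)
      then have "ln c = 2 * ln (norm x / 2)" using x ln_realpow[of "norm x / 2" 2] by simp
      then show ?thesis using k x by (simp add: ln_mult ln_div ln_realpow)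
    qed
    have "?E (of_real (k\<^sup>2)) = (- (of_real (ln (k\<^sup>2)) - \<i> * of_real pi + of_real (ln c + 2 * euler_mascheroni)) * of_real (entire_series bessel_coeff (- q)) + 2 * of_real (entire_series bessel_harm_coeff (- q))) / of_real (4 * pi)"
      unfolding q entire_series_of_real[OF entire_bessel_coeff] entire_series_of_real[OF entire_bessel_harm_coeff] using k by (subst Ln_of_real) auto
    also have "\<dots> = \<i> / 4 * hankel1_0 (k * norm x)"
      unfolding hankel1_0_def besselJ0_entire_series besselY0_entire_series q_def[symmetric] l
      by (simp add: complex_eq_iff field_simps del: of_real_euler_mascheroni)
    finally have E: "?E (of_real (k\<^sup>2)) = \<i> / 4 * hankel1_0 (k * norm x)" .
    show ?thesis unfolding E G2_helm_def by (simp add: mult_ac)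
  qed
  finally show ?thesis
  proof (rule Lim_transform_eventually)
    show "\<forall>\<^sub>F e in at_right 0. spectral_point e / (of_real s * Complex a e) * ?E (spectral_point e) = spectral_point e / (of_real s * Complex a e) * green x (- spectral_point e)"
      using eventually_upper
    proof eventually_elim
      case (elim e)
      have "Ln (- spectral_point e) = Ln (spectral_point e) - \<i> * of_real pi"
        using elim by (subst Ln_minus) auto
      then show ?case using green_2[OF x slit_of_upper[OF elim]] by (simp add: c_def)
    qed
  qed
qed

end

end

subsection \<open>Estimates for the remaining part\<close>

lemma powr_exp_bounded:
  fixes q c :: real
  assumes "q > 0" "c > 0"
  obtains K where "K > 0" "\<And>v. v > 0 \<Longrightarrow> v powr q * exp (- c * v) \<le> K"
proof
  show "exp (q * ln (q / c) - q) > 0" by simp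
  fix v :: real assume v: "v > 0"
  have "ln (c * v / q) \<le> c * v / q - 1" using assms v by (intro ln_le_minus_one) auto
  then have "q * ln (c * v / q) \<le> q * (c * v / q - 1)" using assms by (intro mult_left_mono) auto
  then have "q * ln v - c * v \<le> q * ln (q / c) - q" using assms v by (simp add: ln_div ln_mult algebra_simps)
  then show "v powr q * exp (- c * v) \<le> exp (q * ln (q / c) - q)"
    using v by (simp add: powr_def flip: exp_add)
qed

lemma set_integral_Gamma:
  fixes p c :: real
  assumes p: "p > 0" and c: "c > 0"
  shows "set_integrable lborel {0<..} (\<lambda>t. t powr (p - 1) * exp (- c * t))"
    and "(LINT t:{0<..}|lborel. t powr (p - 1) * exp (- c * t)) = Gamma p * c powr (- p)"
proof -
  have hi: "((\<lambda>t. t powr (p - 1) * exp (- t)) has_integral Gamma p) {0<..}"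
    using Gamma_integral_real[OF p] by (simp only: has_integral_Ici_Ioi exp_minus divide_inverse)
  then have "(\<lambda>t. t powr (p - 1) * exp (- t)) absolutely_integrable_on {0<..}"
    by (intro nonnegative_absolutely_integrable_1) (auto simp: integrable_on_def)
  then have i1: "set_integrable lborel {0<..} (\<lambda>t. t powr (p - 1) * exp (- t))"
    unfolding set_integrable_def by (subst (asm) integrable_completion) auto
  have v1: "(LINT t:{0<..}|lborel. t powr (p - 1) * exp (- t)) = Gamma p"
    using set_borel_integral_eq_integral(2)[OF i1] hi by (simp add: integral_unique)
  have eq: "indicator {0<..} (0 + c * t) *\<^sub>R ((0 + c * t) powr (p - 1) * exp (- (0 + c * t)))
     = c powr (p - 1) * (indicator {0<..} t *\<^sub>R (t powr (p - 1) * exp (- c * t)))" for t :: real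
    using c by (cases "t > 0") (auto simp: powr_mult zero_less_mult_iff)
  have "integrable lborel (\<lambda>t. c powr (p - 1) * (indicator {0<..} t *\<^sub>R (t powr (p - 1) * exp (- c * t))))"
    unfolding eq[symmetric] by (rule lborel_integrable_real_affine[OF i1[unfolded set_integrable_def]]) (use c in auto)
  from integrable_mult_right[OF this, of "1 / c powr (p - 1)"]
  show "set_integrable lborel {0<..} (\<lambda>t. t powr (p - 1) * exp (- c * t))"
    unfolding set_integrable_def using c by simp
  have "Gamma p = c * (LINT t|lborel. c powr (p - 1) * (indicator {0<..} t *\<^sub>R (t powr (p - 1) * exp (- c * t))))"
    unfolding v1[symmetric] set_lebesgue_integral_def
    by (subst lborel_integral_real_affine[of c _ 0]) (use c in \<open>simp_all only: eq, simp_all\<close>)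
  also have "\<dots> = c powr p * (LINT t:{0<..}|lborel. t powr (p - 1) * exp (- c * t))"
  proof -
    have "c * c powr (p - 1) = c powr p" using c by (simp add: powr_diff)
    then show ?thesis by (simp only: integral_mult_right_zero set_lebesgue_integral_def mult.assoc[symmetric])
  qed
  finally show "(LINT t:{0<..}|lborel. t powr (p - 1) * exp (- c * t)) = Gamma p * c powr (- p)"
    using c by (simp add: powr_minus field_simps)
qed

text \<open>The Gamma integral after the inversion \<open>u -> 1 / u\<close>.\<close>

lemma set_integral_heat_powr:
  fixes q c :: real
  assumes q: "q > 0" and c: "c > 0"
  shows "set_integrable lborel {0<..} (\<lambda>u. u powr (- q - 1) * exp (- c / u))"
    and "(LINT u:{0<..}|lborel. u powr (- q - 1) * exp (- c / u)) = Gamma q * c powr (- q)"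
proof -
  obtain K where K: "K > 0" "\<And>v. v > 0 \<Longrightarrow> v powr (q + 1) * exp (- c * v) \<le> K"
    using powr_exp_bounded[of "q + 1" c] q c by auto
  show int: "set_integrable lborel {0<..} (\<lambda>u. u powr (- q - 1) * exp (- c / u))"
  proof (rule set_integrable_two_powers[where p = 0 and q = "- q - 1" and A = K and B = 1])
    show "norm (u powr (- q - 1) * exp (- c / u)) \<le> K * u powr 0" if "0 < u" for u
    proof -
      have "(1 / u) powr (q + 1) = u powr (- q - 1)"
        using that by (simp add: powr_divide powr_minus_divide[symmetric])
      then show ?thesis using K(2)[of "1 / u"] that by (simp add: abs_mult)
    qed
    show "norm (u powr (- q - 1) * exp (- c / u)) \<le> 1 * u powr (- q - 1)" if "1 \<le> u" for u
      using that c by (simp add: abs_mult mult_left_le)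
  qed (use q in auto)
  have inv: "1 / u\<^sup>2 * ((1 / u) powr (q - 1) * exp (- c * (1 / u))) = u powr (- q - 1) * exp (- c / u)" if "u > 0" for u
  proof -
    have "(1 / u) powr (q - 1) = u powr (1 - q)"
      using that by (simp add: powr_divide powr_minus_divide[symmetric])
    moreover have "u powr (1 - q) = u powr (- q - 1) * u\<^sup>2"
    proof -
      have "u powr (1 - q) = u powr ((- q - 1) + 2)" by simp
      also have "\<dots> = u powr (- q - 1) * u\<^sup>2" unfolding powr_add using that by simp
      finally show ?thesis .
    qed
    ultimately show ?thesis using that by simp
  qed
  have "(LINT u:{0<..}|lborel. u powr (q - 1) * exp (- c * u)) = (LINT u:{0<..}|lborel. 1 / u\<^sup>2 * ((1 / u) powr (q - 1) * exp (- c * (1 / u))))"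
  proof (rule set_integral_inversion[OF zero_less_one _ set_integral_Gamma(1)[OF q c]])
    show "isCont (\<lambda>u. u powr (q - 1) * exp (- c * u)) u" if "u > 0" for u
      using that by (intro continuous_intros) auto
    show "set_integrable lborel {0<..} (\<lambda>u. 1 / u\<^sup>2 * ((1 / u) powr (q - 1) * exp (- c * (1 / u))))"
      by (rule iffD2[OF set_integrable_cong, OF refl refl _ int]) (simp only: inv greaterThan_iff)
  qed
  also have "\<dots> = (LINT u:{0<..}|lborel. u powr (- q - 1) * exp (- c / u))"
    using inv by (intro set_lebesgue_integral_cong) auto
  finally show "(LINT u:{0<..}|lborel. u powr (- q - 1) * exp (- c / u)) = Gamma q * c powr (- q)"
    using set_integral_Gamma(2)[OF q c] by simp
qed

text \<open>All integrands are nonnegative, so the order may be exchanged. The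
  \<open>t\<close>-integral yields \<open>Gamma (1 - \<alpha>) * u powr (\<alpha> - 1)\<close> and
  needs \<open>\<alpha> < 1\<close> near \<open>t = 0\<close>; the remaining
  \<open>u\<close>-integral yields the second Gamma factor and needs \<open>\<alpha> < n / 2\<close>
  at large times.\<close>

lemma yukawa_moment:
  fixes \<alpha> :: real
  assumes r: "r > 0" and al: "\<alpha> < 1" "\<alpha> < real n / 2"
  shows "set_integrable lborel {0<..} (\<lambda>t. t powr (- \<alpha>) * yukawa n r t)"
    and "(LINT t:{0<..}|lborel. t powr (- \<alpha>) * yukawa n r t) =
      Gamma (1 - \<alpha>) * Gamma (real n / 2 - \<alpha>) / (4 powr \<alpha> * pi powr (real n / 2)) * r powr (2 * \<alpha> - real n)"
proof -
  define q where "q = real n / 2 - \<alpha>"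
  define c where "c = r\<^sup>2 / 4"
  have q: "q > 0" and c: "c > 0" using al r by (auto simp: q_def c_def)
  define D where "D = Gamma (1 - \<alpha>) * (4 * pi) powr (- real n / 2)"
  define f where "f u t = (indicator {0<..} u *\<^sub>R heat n r u) * (indicator {0<..} t *\<^sub>R (t powr ((1 - \<alpha>) - 1) * exp (- u * t)))" for u t
  have f0: "f u t \<ge> 0" for u t by (simp add: f_def)
  have [measurable]: "case_prod f \<in> borel_measurable (lborel \<Otimes>\<^sub>M lborel)"
    unfolding f_def heat_def by measurable
  have int_t: "(LINT t|lborel. f u t) = D * (indicator {0<..} u *\<^sub>R (u powr (- q - 1) * exp (- c / u)))" for u
  proof (cases "u > 0")
    case True
    have "(LINT t|lborel. f u t) = heat n r u * (LINT t:{0<..}|lborel. t powr ((1 - \<alpha>) - 1) * exp (- u * t))"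
      using True by (simp add: f_def set_lebesgue_integral_def)
    also have "\<dots> = heat n r u * (Gamma (1 - \<alpha>) * u powr (- (1 - \<alpha>)))"
      using al True by (subst set_integral_Gamma(2)) auto
    also have "heat n r u = (4 * pi) powr (- real n / 2) * u powr (- real n / 2) * exp (- c / u)"
      using True by (simp add: heat_def c_def powr_mult)
    also have "(4 * pi) powr (- real n / 2) * u powr (- real n / 2) * exp (- c / u) * (Gamma (1 - \<alpha>) * u powr (- (1 - \<alpha>)))
       = D * (u powr (- real n / 2) * u powr (- (1 - \<alpha>)) * exp (- c / u))"
      by (simp add: D_def)
    also have "u powr (- real n / 2) * u powr (- (1 - \<alpha>)) = u powr (- q - 1)"
      by (simp add: q_def algebra_simps flip: powr_add)
    finally show ?thesis using True by simp
  qed (simp add: f_def)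
  have int_u: "(LINT u|lborel. f u t) = indicator {0<..} t *\<^sub>R (t powr (- \<alpha>) * yukawa n r t)" for t
  proof (cases "t > 0")
    case True
    have "f u t = t powr (- \<alpha>) * (indicator {0<..} u *\<^sub>R (exp (- t * u) * heat n r u))" for u
      using True by (simp add: f_def mult_ac)
    then show ?thesis
      using True by (simp only: integral_mult_right_zero yukawa_def set_lebesgue_integral_def) simp
  qed (simp add: f_def)
  have iu: "integrable lborel (\<lambda>u. D * (indicator {0<..} u *\<^sub>R (u powr (- q - 1) * exp (- c / u))))"
    using set_integral_heat_powr(1)[OF q c] by (intro integrable_mult_right) (simp add: set_integrable_def)
  have int: "integrable (lborel \<Otimes>\<^sub>M lborel) (case_prod f)"
  proof (rule lborel_pair.Fubini_integrable)
    show "integrable lborel (\<lambda>u. LINT t|lborel. norm (case_prod f (u, t)))"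
      using iu f0 by (simp add: int_t)
    show "AE u in lborel. integrable lborel (\<lambda>t. case_prod f (u, t))"
    proof (rule AE_I2)
      fix u :: real
      show "integrable lborel (\<lambda>t. case_prod f (u, t))"
      proof (cases "u > 0")
        case True
        then show ?thesis
          using set_integral_Gamma(1)[of "1 - \<alpha>" u] al unfolding f_def set_integrable_def
          by (auto intro!: integrable_mult_right)
      qed (simp add: f_def)
    qed
  qed measurable
  show "set_integrable lborel {0<..} (\<lambda>t. t powr (- \<alpha>) * yukawa n r t)"
    unfolding set_integrable_def int_u[symmetric] using lborel_pair.integrable_snd[OF int] by simp
  have "(LINT t:{0<..}|lborel. t powr (- \<alpha>) * yukawa n r t) = (LINT t|lborel. LINT u|lborel. f u t)"
    by (simp add: int_u set_lebesgue_integral_def)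
  also have "\<dots> = (LINT u|lborel. LINT t|lborel. f u t)" by (rule lborel_pair.Fubini_integral[OF int])
  also have "\<dots> = D * (Gamma q * c powr (- q))"
    unfolding int_t using set_integral_heat_powr(2)[OF q c] by (simp add: set_lebesgue_integral_def)
  also have "\<dots> = Gamma (1 - \<alpha>) * Gamma (real n / 2 - \<alpha>) / (4 powr \<alpha> * pi powr (real n / 2)) * r powr (2 * \<alpha> - real n)"
  proof -
    have "r\<^sup>2 powr (- q) = r powr (2 * \<alpha> - real n)"
    proof -
      have "r\<^sup>2 powr (- q) = (r powr 2) powr (- q)" using r by simp
      also have "\<dots> = r powr (2 * \<alpha> - real n)" unfolding powr_powr by (simp add: q_def algebra_simps)
      finally show ?thesis .
    qed
    then have "c powr (- q) = r powr (2 * \<alpha> - real n) * 4 powr q"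
      using r by (simp add: c_def powr_divide powr_minus_divide[of 4 q])
    moreover have "4 powr q = 4 powr (real n / 2) / 4 powr \<alpha>" by (simp add: q_def powr_diff)
    moreover have "(4 * pi) powr (- real n / 2) = 1 / (4 powr (real n / 2) * pi powr (real n / 2))"
      by (simp add: powr_mult powr_minus_divide)
    ultimately show ?thesis unfolding D_def q_def[symmetric] by (simp add: mult_ac)
  qed
  finally show "(LINT t:{0<..}|lborel. t powr (- \<alpha>) * yukawa n r t) =
      Gamma (1 - \<alpha>) * Gamma (real n / 2 - \<alpha>) / (4 powr \<alpha> * pi powr (real n / 2)) * r powr (2 * \<alpha> - real n)" .
qed

text \<open>The dictionary between densities and decay: a pointwise power of \<open>t\<close> is
  integrated against the positive kernel and becomes a power of \<open>r\<close> with an explicit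
  constant.\<close>

lemma yukawa_transform_bound:
  fixes \<alpha> :: real and g :: "real \<Rightarrow> complex"
  assumes [measurable]: "g \<in> borel_measurable borel" and g: "\<And>t. t > 0 \<Longrightarrow> norm (g t) \<le> C * t powr (- \<alpha>)"
    and al: "\<alpha> < 1" "\<alpha> < real n / 2" and r: "r > 0"
  shows "set_integrable lborel {0<..} (\<lambda>t. g t * of_real (yukawa n r t))"
    and "norm (LINT t:{0<..}|lborel. g t * of_real (yukawa n r t))
      \<le> C * (Gamma (1 - \<alpha>) * Gamma (real n / 2 - \<alpha>) / (4 powr \<alpha> * pi powr (real n / 2))) * r powr (2 * \<alpha> - real n)"
proof -
  have int: "set_integrable lborel {0<..} (\<lambda>t. C * (t powr (- \<alpha>) * yukawa n r t))"
    by (intro set_integrable_mult_right yukawa_moment r al)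
  have b: "norm (g t * of_real (yukawa n r t)) \<le> C * (t powr (- \<alpha>) * yukawa n r t)" if "t > 0" for t
    using mult_right_mono[OF g[OF that] yukawa_nonneg[of n r t]] yukawa_nonneg[of n r t] by (simp add: norm_mult mult.assoc)
  show i: "set_integrable lborel {0<..} (\<lambda>t. g t * of_real (yukawa n r t))"
    by (rule set_integrable_bound[OF int]) (auto simp: set_borel_measurable_def intro!: order_trans[OF b abs_ge_self])
  have "norm (LINT t:{0<..}|lborel. g t * of_real (yukawa n r t)) \<le> (LINT t:{0<..}|lborel. norm (g t * of_real (yukawa n r t)))"
    by (rule set_integral_norm_bound[OF i])
  also have "\<dots> \<le> (LINT t:{0<..}|lborel. C * (t powr (- \<alpha>) * yukawa n r t))"
    by (rule set_integral_mono) (use b set_integrable_norm[OF i] int in auto)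
  also have "\<dots> = C * (Gamma (1 - \<alpha>) * Gamma (real n / 2 - \<alpha>) / (4 powr \<alpha> * pi powr (real n / 2))) * r powr (2 * \<alpha> - real n)"
    unfolding set_integral_mult_right yukawa_moment(2)[OF r al] by simp
  finally show "norm (LINT t:{0<..}|lborel. g t * of_real (yukawa n r t))
      \<le> C * (Gamma (1 - \<alpha>) * Gamma (real n / 2 - \<alpha>) / (4 powr \<alpha> * pi powr (real n / 2))) * r powr (2 * \<alpha> - real n)" .
qed

lemma Gamma_reflection_real: "Gamma z * Gamma (1 - z :: real) = pi / sin (pi * z)"
proof -
  have "complex_of_real (Gamma z * Gamma (1 - z)) = Gamma (of_real z) * Gamma (1 - of_real z)"
    by (simp only: of_real_mult Gamma_complex_of_real[symmetric] of_real_diff of_real_1)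
  also have "\<dots> = complex_of_real (pi / sin (pi * z))"
    unfolding Gamma_reflection_complex by (simp only: of_real_mult[symmetric] sin_of_real of_real_divide)
  finally have "complex_of_real (Gamma z * Gamma (1 - z)) = complex_of_real (pi / sin (pi * z))" .
  then show ?thesis by (simp only: of_real_eq_iff)
qed

lemma inverse_geometric_expansion:
  fixes z a :: "'a::field"
  assumes "z \<noteq> 0" "z \<noteq> a"
  shows "1 / (z - a) = (\<Sum>j<m. a ^ j / z ^ Suc j) + (a / z) ^ m / (z - a)"
proof (induction m)
  case (Suc m)
  have "(a / z) ^ m / (z - a) = a ^ m / z ^ Suc m + (a / z) ^ Suc m / (z - a)"
    using assms by (simp add: field_simps)
  with Suc show ?case by (simp add: add.assoc)
qed simp

section \<open>Expansion of the density in inverse powers\<close>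

context symbol begin

text \<open>The subtracted sum comes from the geometric expansion of \<open>1 / (z - a)\<close> at
  the two points \<open>t powr s * cis (\<plusminus> pi * s)\<close>; the sine is the imaginary part
  of \<open>z\<close> to the power \<open>- (j + 1)\<close> at the lower of the two.\<close>

definition remainder :: "nat \<Rightarrow> real \<Rightarrow> complex" where
  "remainder m t = spectral_density s (of_real a) t
     - of_real (\<Sum>j<m. a ^ j * sin (pi * (s * real (j + 1))) / pi * t powr (- (s * real (j + 1))))"

lemma remainder_measurable [measurable]: "remainder m \<in> borel_measurable borel"
  unfolding remainder_def by measurable

text \<open>The density is the difference of \<open>1 / (z - a)\<close> at \<open>z\<close> and
  \<open>cnj z\<close>, divided by \<open>2 pi i\<close>. Expanding both terms to order
  \<open>m\<close> leaves the two geometric tails.\<close>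

lemma remainder_eq:
  assumes t: "t > 0"
  defines "z \<equiv> of_real (t powr s) * cis (- (pi * s))"
  shows "remainder m t = ((of_real a / z) ^ m / (z - of_real a) - (of_real a / cnj z) ^ m / (cnj z - of_real a)) / (2 * \<i> * of_real pi)"
proof -
  define v where "v = t powr s"
  have v: "v > 0" using t by (simp add: v_def)
  define y where "y = cnj z"
  have cz: "y = of_real v * cis (pi * s)" by (simp add: y_def z_def v_def cis_cnj)
  have z: "z = of_real v * cis (- (pi * s))" by (simp add: z_def v_def)
  have a0: "complex_of_real a = Complex a 0" by (rule complex_of_real_def)
  have nz1: "z - of_real a \<noteq> 0"
    unfolding z a0 by (rule denominator_nonzero(2)) (use v sin_pos a in auto)
  have nz2: "y - of_real a \<noteq> 0"
    unfolding cz a0 by (rule denominator_nonzero(1)) (use v sin_pos a in auto)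
  note nz = nz1 nz2
  have z0: "z \<noteq> 0" "y \<noteq> 0" using v by (auto simp: z cz)
  have dc: "y - z = 2 * \<i> * of_real (v * sin (pi * s))"
    unfolding z cz by (simp add: complex_eq_iff)
  have "spectral_density s (of_real a) t = of_real (sin (pi * s) / pi * v) / ((y - of_real a) * (z - of_real a))"
    unfolding spectral_density_def z cz v_def ..
  also have "\<dots> = (y - z) / ((y - of_real a) * (z - of_real a)) / (2 * \<i> * of_real pi)"
  proof -
    have "complex_of_real (sin (pi * s) / pi * v) / D = 2 * \<i> * of_real (v * sin (pi * s)) / D / (2 * \<i> * of_real pi)" for D
      by (simp add: mult.commute)
    then show ?thesis unfolding dc .
  qed
  also have "(y - z) / ((y - of_real a) * (z - of_real a)) = 1 / (z - of_real a) - 1 / (y - of_real a)"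
    proof -
    have "(p - q) / (p * q) = 1 / q - 1 / p" if "p \<noteq> 0" "q \<noteq> 0" for p q :: complex
      using that by (simp add: field_simps)
    from this[OF nz(2,1)] show ?thesis by simp
  qed
  also have "\<dots> = ((\<Sum>j<m. of_real a ^ j / z ^ Suc j) - (\<Sum>j<m. of_real a ^ j / y ^ Suc j))
      + ((of_real a / z) ^ m / (z - of_real a) - (of_real a / y) ^ m / (y - of_real a))"
  proof -
    have "z \<noteq> of_real a" "y \<noteq> of_real a" using nz by auto
    note E = inverse_geometric_expansion[OF z0(1) this(1), of m] inverse_geometric_expansion[OF z0(2) this(2), of m]
    show ?thesis unfolding E by (rule add_diff_add)
  qed
  also have "(\<Sum>j<m. of_real a ^ j / z ^ Suc j) - (\<Sum>j<m. of_real a ^ j / y ^ Suc j)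
      = (2 * \<i> * of_real pi) * of_real (\<Sum>j<m. a ^ j * sin (pi * (s * real (j + 1))) / pi * t powr (- (s * real (j + 1))))"
  proof -
    have T: "of_real a ^ j / z ^ Suc j - of_real a ^ j / y ^ Suc j = (2 * \<i> * of_real pi) * of_real (a ^ j * sin (pi * (s * real (j + 1))) / pi * t powr (- (s * real (j + 1))))" for j
    proof -
      define \<theta> where "\<theta> = pi * (s * real (j + 1))"
      have vp: "v ^ Suc j = t powr (s * real (j + 1))"
      proof -
        have "v ^ Suc j = v powr real (Suc j)" using v by (rule powr_realpow[symmetric])
        then show ?thesis by (simp add: v_def powr_powr)
      qed
      have zp: "1 / z ^ Suc j = of_real (t powr (- (s * real (j + 1)))) * cis \<theta>" "1 / y ^ Suc j = of_real (t powr (- (s * real (j + 1)))) * cis (- \<theta>)"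
      proof -
        have m1: "real (Suc j) * - (pi * s) = - \<theta>" "real (Suc j) * (pi * s) = \<theta>" by (simp_all add: \<theta>_def algebra_simps)
        have D: "(of_real v * cis \<phi>) ^ Suc j = of_real (v ^ Suc j) * cis (real (Suc j) * \<phi>)" for \<phi>
          unfolding power_mult_distrib Complex.DeMoivre by (simp only: of_real_power)
        have Z: "z ^ Suc j = of_real (t powr (s * real (j + 1))) * cis (- \<theta>)" "y ^ Suc j = of_real (t powr (s * real (j + 1))) * cis \<theta>"
          unfolding z cz D vp m1 by (rule refl)+
        have C: "1 / cis (- \<theta>) = cis \<theta>" "1 / cis \<theta> = cis (- \<theta>)" by (simp_all add: divide_inverse)
        have M: "1 / (p * q) = 1 / p * (1 / q)" for p q :: complex by simp
        show "1 / z ^ Suc j = of_real (t powr (- (s * real (j + 1)))) * cis \<theta>" "1 / y ^ Suc j = of_real (t powr (- (s * real (j + 1)))) * cis (- \<theta>)"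
          unfolding Z M C by (simp_all only: powr_minus_divide of_real_divide of_real_1)
      qed
      have "of_real a ^ j / z ^ Suc j - of_real a ^ j / y ^ Suc j = of_real a ^ j * (1 / z ^ Suc j - 1 / y ^ Suc j)"
        by (simp only: right_diff_distrib times_divide_eq_right mult_1_right)
      also have "\<dots> = of_real a ^ j * of_real (t powr (- (s * real (j + 1)))) * (cis \<theta> - cis (- \<theta>))"
        unfolding zp by (simp only: right_diff_distrib mult.assoc)
      also have "cis \<theta> - cis (- \<theta>) = 2 * \<i> * of_real (sin \<theta>)" by (simp add: complex_eq_iff)
      finally show ?thesis
        unfolding of_real_mult of_real_divide of_real_power \<theta>_def[symmetric] by simp
    qed
    show ?thesis unfolding sum_subtractf[symmetric] T of_real_sum sum_distrib_left ..
  qed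
  finally have E: "spectral_density s (of_real a) t = ((2 * \<i> * of_real pi) * of_real (\<Sum>j<m. a ^ j * sin (pi * (s * real (j + 1))) / pi * t powr (- (s * real (j + 1))))
      + ((of_real a / z) ^ m / (z - of_real a) - (of_real a / y) ^ m / (y - of_real a))) / (2 * \<i> * of_real pi)" .
  have "spectral_density s (of_real a) t = of_real (\<Sum>j<m. a ^ j * sin (pi * (s * real (j + 1))) / pi * t powr (- (s * real (j + 1))))
      + ((of_real a / z) ^ m / (z - of_real a) - (of_real a / y) ^ m / (y - of_real a)) / (2 * \<i> * of_real pi)"
  proof -
    have "2 * \<i> * complex_of_real pi \<noteq> 0" by simp
    from nonzero_mult_div_cancel_left[OF this] show ?thesis unfolding E by (simp only: add_divide_distrib)
  qed
  then show ?thesis unfolding remainder_def y_def by (simp only: add_diff_cancel_left')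
qed

text \<open>The two tails are complex conjugates, and with \<open>v = t powr s\<close> each is at
  most a multiple of \<open>1 / (v ^ m * (v + a))\<close>. This is of size
  \<open>t powr (- s * m)\<close> near 0 and \<open>t powr (- s * (m + 1))\<close> at infinity, so
  every exponent in between is admissible.\<close>

lemma remainder_bound:
  assumes al: "s * real m \<le> \<alpha>" "\<alpha> \<le> s * real (m + 1)"
  obtains C where "C > 0" "\<And>t. t > 0 \<Longrightarrow> norm (remainder m t) \<le> C * t powr (- \<alpha>)"
proof
  define S where "S = sin (pi * s)"
  have S: "S > 0" using sin_pos by (simp add: S_def)
  let ?C = "a ^ m * (4 / S) / pi * max 1 (1 / a)"
  show "?C > 0" using S a by (intro mult_pos_pos divide_pos_pos) auto
  fix t :: real assume t: "t > 0"
  define v where "v = t powr s"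
  have v: "v > 0" using t by (simp add: v_def)
  define z where "z = of_real (t powr s) * cis (- (pi * s))"
  have a0: "complex_of_real a = Complex a 0" by (rule complex_of_real_def)
  have nzz: "norm z = v" using v by (simp add: z_def v_def norm_mult)
  have lb: "S / 4 * (v + a) \<le> norm (z - of_real a)"
    unfolding z_def a0 S_def v_def by (rule denominator_bound(2)) (use sin_pos a in auto)
  have pos: "0 < S / 4 * (v + a)" using S a v by (intro mult_pos_pos) auto
  define W where "W = (of_real a / z) ^ m / (z - of_real a)"
  have cW: "(of_real a / cnj z) ^ m / (cnj z - of_real a) = cnj W" by (simp add: W_def)
  have nW: "norm W \<le> (a / v) ^ m / (S / 4 * (v + a))"
    unfolding W_def norm_divide norm_power nzz using a v lb pos by (intro frac_le) auto
  have "norm (remainder m t) = norm (W - cnj W) / (2 * pi)"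
    using remainder_eq[OF t, of m] unfolding z_def[symmetric] cW W_def[symmetric] by (simp add: norm_divide norm_mult)
  also have "\<dots> \<le> (2 * norm W) / (2 * pi)"
    using norm_triangle_ineq4[of W "cnj W"] by (intro divide_right_mono) auto
  also have "\<dots> = norm W / pi" by simp
  also have "\<dots> \<le> (a / v) ^ m / (S / 4 * (v + a)) / pi" using nW by (intro divide_right_mono) auto
  also have "\<dots> = a ^ m * (4 / S) / pi * (1 / (v ^ m * (v + a)))"
    using S by (simp add: power_divide field_simps)
  also have "\<dots> \<le> a ^ m * (4 / S) / pi * (max 1 (1 / a) * t powr (- \<alpha>))"
  proof (rule mult_left_mono)
    have vm: "v ^ m = t powr (s * real m)" using t by (simp add: v_def powr_powr flip: powr_realpow)
    show "1 / (v ^ m * (v + a)) \<le> max 1 (1 / a) * t powr (- \<alpha>)"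
    proof (cases "t \<le> 1")
      case True
      have "1 / (v ^ m * (v + a)) \<le> 1 / (v ^ m * a)"
        using v a by (intro divide_left_mono mult_left_mono) auto
      also have "\<dots> = 1 / a * t powr (- (s * real m))" using t by (simp add: vm powr_minus_divide)
      also have "\<dots> \<le> max 1 (1 / a) * t powr (- \<alpha>)"
        using True t al a by (intro mult_mono powr_mono') auto
      finally show ?thesis .
    next
      case False
      have "1 / (v ^ m * (v + a)) \<le> 1 / (v ^ m * v)"
        using v a by (intro divide_left_mono mult_left_mono) auto
      also have "v ^ m * v = t powr (s * real (m + 1))"
        using t unfolding vm unfolding v_def by (simp add: algebra_simps flip: powr_add)
      also have "1 / t powr (s * real (m + 1)) = 1 * t powr (- (s * real (m + 1)))" by (simp only: powr_minus_divide mult_1)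
      also have "\<dots> \<le> max 1 (1 / a) * t powr (- \<alpha>)"
        using False t al a by (intro mult_mono powr_mono) auto
      finally show ?thesis .
    qed
  qed (use a S in auto)
  finally show "norm (remainder m t) \<le> ?C * t powr (- \<alpha>)" by (simp only: mult.assoc)
qed

text \<open>The reflection formula turns the sine of the expansion and the factor
  \<open>Gamma (1 - \<sigma>)\<close> of the moment into \<open>1 / Gamma \<sigma>\<close>, which is
  the denominator of the Riesz constant.\<close>

lemma riesz_term:
  assumes r: "r > 0" and ak: "a = k powr (2 * s)" and k: "k > 0"
    and j: "s * real (j + 1) < 1" "s * real (j + 1) < real n / 2"
  shows "a ^ j * sin (pi * (s * real (j + 1))) / pi * (LINT t:{0<..}|lborel. t powr (- (s * real (j + 1))) * yukawa n r t)
      = riesz_c n s j * k powr (2 * s * real j) / r powr (real n - 2 * s * real (j + 1))"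
proof -
  define \<sigma> where "\<sigma> = s * real (j + 1)"
  have sg: "\<sigma> > 0" "\<sigma> < 1" "\<sigma> < real n / 2" using s j by (auto simp: \<sigma>_def)
  have aj: "a ^ j = k powr (2 * s * real j)" using k by (simp add: ak powr_powr flip: powr_realpow)
  have "sin (pi * \<sigma>) > 0" using sg by (intro sin_gt_zero) auto
  moreover have "Gamma \<sigma> > 0" using sg by (intro Gamma_real_pos) auto
  ultimately have refl: "sin (pi * \<sigma>) / pi * Gamma (1 - \<sigma>) = 1 / Gamma \<sigma>"
    using Gamma_reflection_real[of \<sigma>] by (simp add: field_simps)
  have rp: "r powr (2 * \<sigma> - real n) = 1 / r powr (real n - 2 * \<sigma>)"
    by (simp add: powr_minus_divide[symmetric])
  have "a ^ j * sin (pi * \<sigma>) / pi * (LINT t:{0<..}|lborel. t powr (- \<sigma>) * yukawa n r t)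
     = a ^ j * (sin (pi * \<sigma>) / pi * Gamma (1 - \<sigma>)) * Gamma (real n / 2 - \<sigma>) / (4 powr \<sigma> * pi powr (real n / 2)) / r powr (real n - 2 * \<sigma>)"
    unfolding yukawa_moment(2)[OF r sg(2,3)] rp by simp
  also have "\<dots> = riesz_c n s j * k powr (2 * s * real j) / r powr (real n - 2 * \<sigma>)"
    unfolding refl aj riesz_c_def \<sigma>_def[symmetric] by (simp add: mult_ac)
  also have "real n - 2 * \<sigma> = real n - 2 * s * real (j + 1)" by (simp add: \<sigma>_def)
  finally show ?thesis by (simp only: \<sigma>_def)
qed

text \<open>For \<open>j < m\<close> the exponent \<open>s * (j + 1)\<close> is at most
  \<open>s * m\<close>, so the conditions on \<open>m\<close> make every subtracted moment finite;
  \<open>\<alpha>\<close> only serves the integrability of the remainder.\<close>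

lemma density_transform_expansion:
  assumes r: "r > 0" and ak: "a = k powr (2 * s)" and k: "k > 0"
    and m: "s * real m < 1" "s * real m < real n / 2"
    and al: "s * real m \<le> \<alpha>" "\<alpha> \<le> s * real (m + 1)" "\<alpha> < 1" "\<alpha> < real n / 2"
  shows "(LINT t:{0<..}|lborel. spectral_density s (of_real a) t * of_real (yukawa n r t))
      - of_real (\<Sum>j<m. riesz_c n s j * k powr (2 * s * real j) / r powr (real n - 2 * s * real (j + 1)))
     = (LINT t:{0<..}|lborel. remainder m t * of_real (yukawa n r t))"
proof -
  obtain C where C: "\<And>t. t > 0 \<Longrightarrow> norm (remainder m t) \<le> C * t powr (- \<alpha>)"
    using remainder_bound[OF al(1,2)] by blast
  define c where "c j = a ^ j * sin (pi * (s * real (j + 1))) / pi" for j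
  define y where "y j t = t powr (- (s * real (j + 1))) * yukawa n r t" for j t
  have small: "s * real (j + 1) < 1" "s * real (j + 1) < real n / 2" if "j < m" for j
  proof -
    have "s * real (j + 1) \<le> s * real m" using that s by (intro mult_left_mono) auto
    then show "s * real (j + 1) < 1" "s * real (j + 1) < real n / 2" using m by auto
  qed
  have iR: "set_integrable lborel {0<..} (\<lambda>t. remainder m t * of_real (yukawa n r t))"
    by (rule yukawa_transform_bound(1)[OF remainder_measurable C al(3,4) r])
  have iy: "set_integrable lborel {0<..} (\<lambda>t. complex_of_real (c j * y j t))" if "j < m" for j
  proof -
    have "set_integrable lborel {0<..} (\<lambda>t. c j * y j t)"
      unfolding y_def by (intro set_integrable_mult_right yukawa_moment(1)[OF r small[OF that]])
    then have "integrable lborel (\<lambda>t. complex_of_real (indicator {0<..} t *\<^sub>R (c j * y j t)))"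
      unfolding set_integrable_def by (rule integrable_of_real)
    then show ?thesis unfolding set_integrable_def by (simp only: scaleR_conv_of_real of_real_mult of_real_eq_id id_apply)
  qed
  have "spectral_density s (of_real a) t * of_real (yukawa n r t) = remainder m t * of_real (yukawa n r t) + (\<Sum>j<m. complex_of_real (c j * y j t))" for t
    by (simp add: remainder_def c_def y_def left_diff_distrib sum_distrib_right mult.assoc)
  then have "(LINT t:{0<..}|lborel. spectral_density s (of_real a) t * of_real (yukawa n r t))
      = (LINT t:{0<..}|lborel. remainder m t * of_real (yukawa n r t) + (\<Sum>j<m. complex_of_real (c j * y j t)))"
    by (simp only:)
  also have "\<dots> = (LINT t:{0<..}|lborel. remainder m t * of_real (yukawa n r t)) + (\<Sum>j<m. LINT t:{0<..}|lborel. complex_of_real (c j * y j t))"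
  proof -
    have isum: "set_integrable lborel {0<..} (\<lambda>t. \<Sum>j<m. complex_of_real (c j * y j t))"
      using iy unfolding set_integrable_def scaleR_sum_right by (intro Bochner_Integration.integrable_sum) auto
    have "(LINT t:{0<..}|lborel. (\<Sum>j<m. complex_of_real (c j * y j t))) = (\<Sum>j<m. LINT t:{0<..}|lborel. complex_of_real (c j * y j t))"
      using iy unfolding set_integrable_def set_lebesgue_integral_def scaleR_sum_right by (intro Bochner_Integration.integral_sum) auto
    then show ?thesis using set_integral_add(2)[OF iR isum] by simp
  qed
  also have "(\<Sum>j<m. LINT t:{0<..}|lborel. complex_of_real (c j * y j t)) = of_real (\<Sum>j<m. riesz_c n s j * k powr (2 * s * real j) / r powr (real n - 2 * s * real (j + 1)))"
    unfolding of_real_sum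
  proof (rule sum.cong[OF refl])
    fix j assume "j \<in> {..<m}"
    then have j: "j < m" by simp
    have "(LINT t:{0<..}|lborel. complex_of_real (c j * y j t)) = of_real (c j * (LINT t:{0<..}|lborel. y j t))"
      by (simp only: set_integral_complex_of_real set_integral_mult_right)
    also have "c j * (LINT t:{0<..}|lborel. y j t) = riesz_c n s j * k powr (2 * s * real j) / r powr (real n - 2 * s * real (j + 1))"
      unfolding c_def y_def by (rule riesz_term[OF r ak k small[OF j]])
    finally show "(LINT t:{0<..}|lborel. complex_of_real (c j * y j t)) = of_real (riesz_c n s j * k powr (2 * s * real j) / r powr (real n - 2 * s * real (j + 1)))" .
  qed
  finally show ?thesis by simp
qed

end

text \<open>Together with the companion for large arguments this restates bounds found separately on
  \<open>norm x \<le> 1\<close> and \<open>norm x \<ge> 1\<close> with a single bracket, using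
  \<open>jbr x \<le> 2\<close> and \<open>jbr x \<le> 2 * norm x\<close> respectively.\<close>

lemma jbr_powr_small:
  assumes "p \<ge> 0" "norm x \<le> 1"
  shows "1 \<le> 2 powr p * jbr x powr (- p)"
proof -
  have "(norm x)\<^sup>2 \<le> 1" using assms by (simp add: power_le_one)
  then have "jbr x \<le> sqrt 4" unfolding jbr_def by (intro real_sqrt_le_mono) auto
  then have j: "jbr x \<le> 2" by simp
  have "jbr x > 0" by (simp add: jbr_def add_pos_nonneg)
  then have "2 powr (- p) \<le> jbr x powr (- p)" using j assms by (intro powr_mono2') auto
  then have "2 powr p * 2 powr (- p) \<le> 2 powr p * jbr x powr (- p)" by (intro mult_left_mono) auto
  then show ?thesis by (simp flip: powr_add)
qed

lemma jbr_powr_large: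
  assumes "p \<ge> 0" "norm x \<ge> 1"
  shows "norm x powr (- p) \<le> 2 powr p * jbr x powr (- p)"
proof -
  have "1 \<le> (norm x)\<^sup>2" using assms by (simp add: one_le_power)
  then have "jbr x \<le> sqrt (4 * (norm x)\<^sup>2)" unfolding jbr_def by (intro real_sqrt_le_mono) auto
  then have j: "jbr x \<le> 2 * norm x" by (simp add: real_sqrt_mult)
  have "jbr x > 0" by (simp add: jbr_def add_pos_nonneg)
  then have "(2 * norm x) powr (- p) \<le> jbr x powr (- p)" using j assms by (intro powr_mono2') auto
  then have "2 powr p * (2 powr (- p) * norm x powr (- p)) \<le> 2 powr p * jbr x powr (- p)"
    using assms by (intro mult_left_mono) (auto simp: powr_mult)
  then show ?thesis by (simp flip: powr_add mult.assoc)
qed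

section \<open>Bounds for the transform of the density\<close>

context symbol begin

definition transform :: "nat \<Rightarrow> real \<Rightarrow> complex" where
  "transform n r = (LINT t:{0<..}|lborel. spectral_density s (of_real a) t * of_real (yukawa n r t))"

lemma norm_spectral_density_le:
  assumes "t \<ge> 0"
  shows "norm (spectral_density s (of_real a) t) \<le> envelope t"
proof -
  have a0: "complex_of_real a = Complex a 0" by (rule complex_of_real_def)
  show ?thesis unfolding a0 using sin_pos a by (intro envelope assms) auto
qed

lemma transform_bound:
  assumes al: "\<bar>\<alpha>\<bar> \<le> s" "\<alpha> < real n / 2"
  obtains C where "C > 0" "\<And>r. r > 0 \<Longrightarrow> norm (transform n r) \<le> C * r powr (2 * \<alpha> - real n)"
proof -
  have a0: "complex_of_real a = Complex a 0" by (rule complex_of_real_def)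
  obtain C where C: "C > 0" "\<And>t e. t > 0 \<Longrightarrow> \<bar>e\<bar> \<le> sin (pi * s) * a / 4 \<Longrightarrow> norm (spectral_density s (Complex a e) t) \<le> C * t powr (- \<alpha>)"
    using spectral_density_bound_powr[of "- \<alpha>"] al(1) by (metis abs_minus_cancel)
  have b: "norm (spectral_density s (of_real a) t) \<le> C * t powr (- \<alpha>)" if "t > 0" for t
    unfolding a0 using that sin_pos a by (intro C) auto
  have al1: "\<alpha> < 1" using al s by auto
  define K where "K = Gamma (1 - \<alpha>) * Gamma (real n / 2 - \<alpha>) / (4 powr \<alpha> * pi powr (real n / 2))"
  have K: "K > 0" unfolding K_def using al al1 by (intro divide_pos_pos mult_pos_pos Gamma_real_pos) auto
  have "norm (transform n r) \<le> C * K * r powr (2 * \<alpha> - real n)" if "r > 0" for r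
    unfolding transform_def K_def by (rule yukawa_transform_bound(2)[OF spectral_density_measurable b al1 al(2) that])
  with that[of "C * K"] C(1) K show ?thesis by simp
qed

lemma transform_expansion_bound:
  assumes m: "s * real m < 1" "s * real m < real n / 2"
    and al: "s * real m \<le> \<alpha>" "\<alpha> \<le> s * real (m + 1)" "\<alpha> < 1" "\<alpha> < real n / 2"
    and ak: "a = k powr (2 * s)" and k: "k > 0"
  obtains C where "C > 0" "\<And>r. r > 0 \<Longrightarrow> norm (transform n r
      - of_real (\<Sum>j<m. riesz_c n s j * k powr (2 * s * real j) / r powr (real n - 2 * s * real (j + 1)))) \<le> C * r powr (2 * \<alpha> - real n)"
proof -
  obtain C where C: "C > 0" "\<And>t. t > 0 \<Longrightarrow> norm (remainder m t) \<le> C * t powr (- \<alpha>)"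
    using remainder_bound[OF al(1,2)] by blast
  define K where "K = Gamma (1 - \<alpha>) * Gamma (real n / 2 - \<alpha>) / (4 powr \<alpha> * pi powr (real n / 2))"
  have K: "K > 0" unfolding K_def using al by (intro divide_pos_pos mult_pos_pos Gamma_real_pos) auto
  have "norm (transform n r - of_real (\<Sum>j<m. riesz_c n s j * k powr (2 * s * real j) / r powr (real n - 2 * s * real (j + 1))))
      \<le> C * K * r powr (2 * \<alpha> - real n)" if "r > 0" for r
    unfolding transform_def density_transform_expansion[OF that ak k m al] K_def
    by (rule yukawa_transform_bound(2)[OF remainder_measurable C(2) al(3,4) that])
  with that[of "C * K"] C(1) K show ?thesis by simp
qed

text \<open>The exponent \<open>\<alpha> = s\<close> is used for \<open>norm x \<le> 1\<close> and
  \<open>\<alpha> = - s\<close> beyond. The resulting powers differ by \<open>4 * s\<close>, which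
  the bracket accounts for. The choice \<open>\<alpha> = s\<close> is what requires
  \<open>s < n / 2\<close>.\<close>

lemma transform_bound_two_sided:
  assumes "s < real n / 2"
  obtains C where "C > 0" "\<And>x::'a::real_normed_vector. x \<noteq> 0 \<Longrightarrow> norm (transform n (norm x)) \<le> C * norm x powr (- (real n - 2 * s)) * jbr x powr (- 4 * s)"
proof -
  obtain C1 where C1: "C1 > 0" "\<And>r. r > 0 \<Longrightarrow> norm (transform n r) \<le> C1 * r powr (2 * s - real n)"
    using transform_bound[of s n] s assms by auto
  obtain C2 where C2: "C2 > 0" "\<And>r. r > 0 \<Longrightarrow> norm (transform n r) \<le> C2 * r powr (2 * (- s) - real n)"
    using transform_bound[of "- s" n] s by auto
  define C where "C = (C1 + C2) * 2 powr (4 * s)"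
  have "norm (transform n (norm x)) \<le> C * norm x powr (- (real n - 2 * s)) * jbr x powr (- 4 * s)" if x: "x \<noteq> 0" for x :: 'a
  proof -
    define r where "r = norm x"
    have r: "r > 0" using x by (simp add: r_def)
    have s4: "- 4 * s = - (4 * s)" by simp
    have "norm (transform n r) \<le> (C1 + C2) * r powr (- (real n - 2 * s)) * (2 powr (4 * s) * jbr x powr (- (4 * s)))"
    proof (cases "r \<le> 1")
      case True
      have "norm (transform n r) \<le> C1 * r powr (- (real n - 2 * s)) * 1" using C1(2)[OF r] by simp
      also have "\<dots> \<le> (C1 + C2) * r powr (- (real n - 2 * s)) * (2 powr (4 * s) * jbr x powr (- (4 * s)))"
        using jbr_powr_small[of "4 * s" x] True C1(1) C2(1) s by (intro mult_mono) (auto simp: r_def)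
      finally show ?thesis .
    next
      case False
      have "r powr (2 * (- s) - real n) = r powr (- (real n - 2 * s)) * r powr (- (4 * s))"
        by (simp flip: powr_add)
      then have "norm (transform n r) \<le> C2 * r powr (- (real n - 2 * s)) * r powr (- (4 * s))"
        using C2(2)[OF r] by (simp add: mult.assoc)
      also have "\<dots> \<le> (C1 + C2) * r powr (- (real n - 2 * s)) * (2 powr (4 * s) * jbr x powr (- (4 * s)))"
        using jbr_powr_large[of "4 * s" x] False C1(1) C2(1) s by (intro mult_mono) (auto simp: r_def)
      finally show ?thesis .
    qed
    then show ?thesis unfolding s4 by (simp add: C_def r_def mult_ac)
  qed
  moreover have "C > 0" using C1(1) C2(1) by (simp add: C_def)
  ultimately show ?thesis using that by blast
qed

text \<open>For \<open>n = 1\<close> and \<open>s \<ge> 1 / 2\<close> the moment with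
  \<open>\<alpha> = s\<close> is infinite. The small-\<open>r\<close> bounds then come from
  integrating the envelope against the explicit one-dimensional kernel.\<close>

lemma transform_1_le:
  assumes r: "r > 0" and int: "set_integrable lborel {0<..} w"
    and w: "\<And>t. t > 0 \<Longrightarrow> envelope t * (exp (- (sqrt t * r)) / (2 * sqrt t)) \<le> w t"
  shows "norm (transform 1 r) \<le> (LINT t:{0<..}|lborel. w t)"
proof -
  have b: "norm (spectral_density s (of_real a) t * of_real (yukawa 1 r t)) \<le> w t" if t: "t > 0" for t
  proof -
    have "norm (spectral_density s (of_real a) t * of_real (yukawa 1 r t)) \<le> envelope t * yukawa 1 r t"
      using norm_spectral_density_le[of t] t yukawa_nonneg[of 1 r t] by (simp add: norm_mult mult_right_mono)
    also have "\<dots> \<le> w t" unfolding yukawa_1_3(1)[OF r t] by (rule w[OF t])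
    finally show ?thesis .
  qed
  have i: "set_integrable lborel {0<..} (\<lambda>t. spectral_density s (of_real a) t * of_real (yukawa 1 r t))"
  proof (rule set_integrable_bound[OF int])
    show "set_borel_measurable lborel {0<..} (\<lambda>t. spectral_density s (of_real a) t * of_real (yukawa 1 r t))"
      unfolding set_borel_measurable_def by measurable
  qed (rule AE_I2, rule impI, simp only: greaterThan_iff real_norm_def, rule order_trans[OF b abs_ge_self])
  have "norm (transform 1 r) \<le> (LINT t:{0<..}|lborel. norm (spectral_density s (of_real a) t * of_real (yukawa 1 r t)))"
    unfolding transform_def by (rule set_integral_norm_bound[OF i])
  also have "\<dots> \<le> (LINT t:{0<..}|lborel. w t)"
    by (rule set_integral_mono) (use b set_integrable_norm[OF i] int in auto)
  finally show ?thesis .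
qed

text \<open>Dropping the exponential leaves the envelope divided by \<open>sqrt t\<close>, which
  decays like \<open>t powr (- s - 1 / 2)\<close>; for \<open>s > 1 / 2\<close> this is integrable
  at infinity, uniformly in \<open>r\<close>.\<close>

lemma transform_1_bounded:
  assumes "s > 1 / 2"
  obtains C where "C > 0" "\<And>r. r > 0 \<Longrightarrow> norm (transform 1 r) \<le> C"
proof -
  define w where "w = (\<lambda>t. envelope t * t powr (- 1 / 2))"
  have w0: "w t \<ge> 0" for t using envelope_nonneg by (simp add: w_def)
  have int: "set_integrable lborel {0<..} w"
  proof (rule set_integrable_two_powers)
    show "norm (w t) \<le> 16 / (pi * sin (pi * s)) / a\<^sup>2 * t powr (s - 1 / 2)" if "0 < t" for t
    proof -
      have "w t \<le> 16 / (pi * sin (pi * s)) / a\<^sup>2 * t powr s * t powr (- 1 / 2)"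
        unfolding w_def by (intro mult_right_mono envelope_bounds that) auto
      also have "\<dots> = 16 / (pi * sin (pi * s)) / a\<^sup>2 * (t powr s * t powr (- 1 / 2))" by (simp only: mult.assoc)
      also have "t powr s * t powr (- 1 / 2) = t powr (s - 1 / 2)" by (simp flip: powr_add)
      finally show ?thesis using w0[of t] by simp
    qed
    show "norm (w t) \<le> 16 / (pi * sin (pi * s)) * t powr (- s - 1 / 2)" if "1 \<le> t" for t
    proof -
      have "w t \<le> 16 / (pi * sin (pi * s)) * t powr (- s) * t powr (- 1 / 2)"
        unfolding w_def using that by (intro mult_right_mono envelope_bounds) auto
      also have "\<dots> = 16 / (pi * sin (pi * s)) * (t powr (- s) * t powr (- 1 / 2))" by (simp only: mult.assoc)
      also have "t powr (- s) * t powr (- 1 / 2) = t powr (- s - 1 / 2)" by (simp flip: powr_add)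
      finally show ?thesis using w0[of t] by simp
    qed
  qed (use s assms in \<open>auto simp: w_def\<close>)
  have "norm (transform 1 r) \<le> (LINT t:{0<..}|lborel. w t)" if r: "r > 0" for r
  proof (rule transform_1_le[OF r int])
    fix t :: real assume t: "t > 0"
    have "exp (- (sqrt t * r)) / (2 * sqrt t) \<le> 1 / sqrt t"
      using t r by (intro frac_le) auto
    also have "\<dots> = t powr (- 1 / 2)" using t by (simp add: powr_minus_divide powr_half_sqrt)
    finally show "envelope t * (exp (- (sqrt t * r)) / (2 * sqrt t)) \<le> w t"
      unfolding w_def using envelope_nonneg by (intro mult_left_mono) auto
  qed
  then have "norm (transform 1 r) \<le> max 1 (LINT t:{0<..}|lborel. w t)" if "r > 0" for r
    using that by (meson max.coboundedI2)
  with that[of "max 1 (LINT t:{0<..}|lborel. w t)"] show ?thesis by simp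
qed

text \<open>With \<open>exp (- q) \<le> 1 / (1 + q)\<close> the integrand is dominated by a multiple of the derivative of
  \<open>ln ((1 + sqrt t) / (1 + r sqrt t))\<close>, which increases from \<open>0\<close> to \<open>- ln r\<close>.\<close>

lemma transform_1_log:
  assumes "s = 1 / 2"
  obtains C where "C > 0" "\<And>r. 0 < r \<Longrightarrow> r \<le> 1 / 2 \<Longrightarrow> norm (transform 1 r) \<le> C * (- ln r)"
proof -
  define E where "E = 16 / (pi * sin (pi * s)) * max 1 (1 / a\<^sup>2)"
  have K0: "16 / (pi * sin (pi * s)) > 0" using sin_pos by simp
  have E: "E > 0" unfolding E_def using K0 by (intro mult_pos_pos) auto
  \<comment> \<open>At \<open>s = 1 / 2\<close> the two power bounds of the envelope, taken on
    either side of \<open>t = 1\<close>, merge into one rational function of \<open>sqrt t\<close>;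
    the factor 2 pays for the merging.\<close>
  have env: "envelope t \<le> 2 * E / (1 + sqrt t)" if t: "t > 0" for t
  proof (cases "t \<le> 1")
    case True
    have "envelope t \<le> 16 / (pi * sin (pi * s)) / a\<^sup>2 * t powr s" by (rule envelope_bounds[OF t])
    also have "\<dots> = 16 / (pi * sin (pi * s)) * (1 / a\<^sup>2) * t powr s" by simp
    also have "\<dots> \<le> E * 1"
      unfolding E_def using K0 True t s by (intro mult_mono) (auto intro: powr_le1)
    also have "E \<le> 2 * E / (1 + sqrt t)" using E True t by (simp add: field_simps add_pos_pos)
    finally show ?thesis by simp
  next
    case False
    have "envelope t \<le> 16 / (pi * sin (pi * s)) * t powr (- s)" by (rule envelope_bounds[OF t])
    also have "\<dots> \<le> E * t powr (- s)"
    proof (rule mult_right_mono)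
      have "16 / (pi * sin (pi * s)) * 1 \<le> E" unfolding E_def using K0 by (intro mult_left_mono) auto
      then show "16 / (pi * sin (pi * s)) \<le> E" by simp
    qed simp
    also have "t powr (- s) = 1 / sqrt t" using t by (simp add: assms powr_minus_divide powr_half_sqrt)
    also have "E * (1 / sqrt t) \<le> 2 * E / (1 + sqrt t)"
    proof -
      have "1 \<le> sqrt t" using False by simp
      then have "E * (1 + sqrt t) \<le> E * (2 * sqrt t)" using E by (intro mult_left_mono) auto
      then show ?thesis using t by (simp add: field_simps add_pos_pos)
    qed
    finally show ?thesis .
  qed
  have "norm (transform 1 r) \<le> 4 * E * (- ln r)" if r: "0 < r" "r \<le> 1 / 2" for r
  proof -
    define F where "F t = ln (1 + sqrt t) - ln (1 + r * sqrt t)" for t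
    define f where "f t = (1 - r) / (2 * sqrt t * ((1 + sqrt t) * (1 + r * sqrt t)))" for t
    have int: "set_integrable lborel {0<..} f"
    proof (rule set_integrable_two_powers[where p = "- 1 / 2" and q = "- 3 / 2" and A = 1 and B = "1 / r"])
      show "norm (f t) \<le> 1 * t powr (- 1 / 2)" if "0 < t" for t
      proof -
        have "1 * 1 \<le> (1 + sqrt t) * (1 + r * sqrt t)" using that r by (intro mult_mono) auto
        then have "1 * sqrt t * 1 \<le> 2 * sqrt t * ((1 + sqrt t) * (1 + r * sqrt t))" using that by (intro mult_mono) auto
        then have "f t \<le> 1 / sqrt t" unfolding f_def using that r by (intro frac_le) auto
        moreover have "f t \<ge> 0" unfolding f_def using that r by auto
        ultimately show ?thesis using that by (simp add: powr_minus_divide powr_half_sqrt)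
      qed
      show "norm (f t) \<le> 1 / r * t powr (- 3 / 2)" if "1 \<le> t" for t
      proof -
        have "sqrt t * (r * sqrt t) \<le> (1 + sqrt t) * (1 + r * sqrt t)" using that r by (intro mult_mono) auto
        then have "1 * sqrt t * (sqrt t * (r * sqrt t)) \<le> 2 * sqrt t * ((1 + sqrt t) * (1 + r * sqrt t))" using that r by (intro mult_mono) auto
        then have "f t \<le> 1 / (sqrt t * (sqrt t * (r * sqrt t)))" unfolding f_def using that r by (intro frac_le) auto
        also have "\<dots> = 1 / r * (1 / (sqrt t * t))" using that by simp
        also have "sqrt t * t = t powr (1 / 2 + 1)" unfolding powr_add using that by (simp add: powr_half_sqrt)
        also have "1 / t powr (1 / 2 + 1) = t powr (- 3 / 2)" by (simp flip: powr_minus_divide)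
        finally have "f t \<le> 1 / r * t powr (- 3 / 2)" .
        moreover have "f t \<ge> 0" unfolding f_def using that r by auto
        ultimately show ?thesis by simp
      qed
    qed (auto simp: f_def[abs_def])
    have "norm (transform 1 r) \<le> (LINT t:{0<..}|lborel. 4 * E * f t)"
    proof (rule transform_1_le[OF r(1)])
      show "set_integrable lborel {0<..} (\<lambda>t. 4 * E * f t)" by (intro set_integrable_mult_right int)
      fix t :: real assume t: "t > 0"
      define q where "q = sqrt t"
      have q: "q > 0" using t by (simp add: q_def)
      have "1 + r * q \<le> exp (r * q)" using exp_ge_add_one_self[of "r * q"] by simp
      moreover have "0 < 1 + r * q" using r q by (simp add: add_pos_pos)
      ultimately have e: "exp (- (q * r)) \<le> 1 / (1 + r * q)"
        by (simp add: exp_minus field_simps)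
      have "envelope t * (exp (- (q * r)) / (2 * q)) \<le> 2 * E / (1 + q) * (1 / (1 + r * q) / (2 * q))"
        using env[OF t] e envelope_nonneg q r E unfolding q_def[symmetric] by (intro mult_mono divide_right_mono) auto
      also have "\<dots> = 2 * E * 1 / (2 * q * ((1 + q) * (1 + r * q)))" by (simp add: mult_ac)
      \<comment> \<open>Here \<open>r \<le> 1 / 2\<close> enters: it gives
        \<open>1 \<le> 2 * (1 - r)\<close>, and the factor \<open>1 - r\<close> completes the exact
        derivative \<open>f\<close>.\<close>
      also have "\<dots> \<le> 2 * E * (2 * (1 - r)) / (2 * q * ((1 + q) * (1 + r * q)))"
        using r q E by (intro divide_right_mono mult_left_mono) auto
      also have "\<dots> = 4 * E * f t" by (simp add: f_def q_def)
      finally show "envelope t * (exp (- (sqrt t * r)) / (2 * sqrt t)) \<le> 4 * E * f t" by (simp add: q_def)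
    qed
    also have "(LINT t:{0<..}|lborel. 4 * E * f t) = 4 * E * (LINT t:{0<..}|lborel. f t)" by simp
    also have "(LINT t:{0<..}|lborel. f t) = - ln r - 0"
    proof (rule set_integral_FTC_0_inf[where F = F])
      show "(F has_real_derivative f t) (at t)" if "t > 0" for t
      proof -
        have p: "1 + sqrt t > 0" "1 + r * sqrt t > 0" using that r by (auto intro: add_pos_pos)
        have "(F has_real_derivative (inverse (sqrt t) / 2) / (1 + sqrt t) - (r * (inverse (sqrt t) / 2)) / (1 + r * sqrt t)) (at t)"
          unfolding F_def[abs_def] using that p by (auto intro!: derivative_eq_intros simp: mult.commute)
        also have "(inverse (sqrt t) / 2) / (1 + sqrt t) - (r * (inverse (sqrt t) / 2)) / (1 + r * sqrt t)
            = ((1 + r * sqrt t) - r * (1 + sqrt t)) / (2 * sqrt t * ((1 + sqrt t) * (1 + r * sqrt t)))"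
          using that p by (simp add: divide_simps) (simp add: algebra_simps)?
        also have "\<dots> = f t" by (simp add: f_def algebra_simps)
        finally show ?thesis .
      qed
      show "isCont f t" if "t > 0" for t
      proof -
        have p: "1 + sqrt t > 0" "1 + r * sqrt t > 0" using that r by (auto intro: add_pos_pos)
        show ?thesis unfolding f_def[abs_def] using that p by (intro continuous_intros) auto
      qed
      show "(F \<longlongrightarrow> 0) (at_right 0)" unfolding F_def[abs_def] by (auto intro!: tendsto_eq_intros)
      show "(F \<longlongrightarrow> - ln r) at_top" unfolding F_def[abs_def] using r(1) by real_asymp
    qed (rule int)
    finally show ?thesis by simp
  qed
  with that[of "4 * E"] E show ?thesis by simp
qed


section \<open>The estimates in each dimension and range of \<open>s\<close>\<close>

context
  fixes k :: real
  assumes k: "k > 0" and ak: "a = k powr (2 * s)"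
begin

lemma G_out_transform:
  "(x1::real) \<noteq> 0 \<Longrightarrow> G_out s k x1 - G1_helm s k x1 = transform 1 (norm x1)"
  "(x2::real^2) \<noteq> 0 \<Longrightarrow> G_out s k x2 - G2_helm s k x2 = transform 2 (norm x2)"
  "(x3::real^3) \<noteq> 0 \<Longrightarrow> G_out s k x3 - G3_helm s k x3 = transform 3 (norm x3)"
  using G_out_eq[OF ak _ helm_1[OF k ak], of x1] G_out_eq[OF ak _ helm_2[OF k ak], of x2] G_out_eq[OF ak _ helm_3[OF k ak], of x3]
  by (simp_all add: transform_def)

text \<open>Boundedness covers \<open>norm x \<le> 1\<close>; for larger arguments the exponent
  \<open>\<alpha> = - s\<close> gives the decay \<open>norm x powr (- 1 - 2 * s)\<close>.\<close>

lemma bound_1_high: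
  assumes "1 / 2 < s"
  obtains C where "C > 0" "\<And>x::real. x \<noteq> 0 \<Longrightarrow> cmod (G_out s k x - G1_helm s k x) \<le> C * jbr x powr (- 1 - 2 * s)"
proof -
  obtain C1 where C1: "C1 > 0" "\<And>r. r > 0 \<Longrightarrow> norm (transform 1 r) \<le> C1"
    using transform_1_bounded[OF assms] by blast
  obtain C2 where C2: "C2 > 0" "\<And>r. r > 0 \<Longrightarrow> norm (transform 1 r) \<le> C2 * r powr (2 * (- s) - real 1)"
    using transform_bound[of "- s" 1] s by auto
  define p where "p = 1 + 2 * s"
  have p: "p \<ge> 0" "- 1 - 2 * s = - p" "2 * (- s) - real 1 = - p" using s by (auto simp: p_def)
  have "cmod (G_out s k x - G1_helm s k x) \<le> (C1 + C2) * 2 powr p * jbr x powr (- 1 - 2 * s)" if x: "x \<noteq> 0" for x :: real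
  proof -
    have r: "norm x > 0" using x by simp
    have "norm (transform 1 (norm x)) \<le> (C1 + C2) * (2 powr p * jbr x powr (- p))"
    proof (cases "norm x \<le> 1")
      case True
      have "norm (transform 1 (norm x)) \<le> C1 * 1" using C1(2)[OF r] by simp
      also have "\<dots> \<le> (C1 + C2) * (2 powr p * jbr x powr (- p))"
        using jbr_powr_small[OF p(1) True] C1(1) C2(1) by (intro mult_mono) auto
      finally show ?thesis .
    next
      case False
      have "norm (transform 1 (norm x)) \<le> C2 * norm x powr (- p)" using C2(2)[OF r] unfolding p(3) .
      also have "\<dots> \<le> (C1 + C2) * (2 powr p * jbr x powr (- p))"
        using jbr_powr_large[OF p(1), of x] False C1(1) C2(1) by (intro mult_mono) auto
      finally show ?thesis .
    qed
    then show ?thesis unfolding G_out_transform(1)[OF x] p(2) by (simp only: mult.assoc)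
  qed
  moreover have "(C1 + C2) * 2 powr p > 0" using C1(1) C2(1) by simp
  ultimately show ?thesis using that by blast
qed

lemma bound_1_critical:
  assumes "s = 1 / 2"
  obtains C where "C > 0" "\<And>x::real. x \<noteq> 0 \<Longrightarrow> cmod (G_out s k x - G1_helm s k x)
    \<le> C * (- ln \<bar>x\<bar> * indicator {0<..<1} \<bar>x\<bar> + 1) * jbr x powr (- 1 - 2 * s)"
proof -
  obtain C1 where C1: "C1 > 0" "\<And>r. 0 < r \<Longrightarrow> r \<le> 1 / 2 \<Longrightarrow> norm (transform 1 r) \<le> C1 * (- ln r)"
    using transform_1_log[OF assms] by blast
  obtain C2 where C2: "C2 > 0" "\<And>r. r > 0 \<Longrightarrow> norm (transform 1 r) \<le> C2 * r powr (2 * (- s) - real 1)"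
    using transform_bound[of "- s" 1] s by auto
  have p2: "2 * (- s) - real 1 = - 2" "- 1 - 2 * s = - 2" using assms by auto
  define C where "C = (C1 + 4 * C2) * 2 powr 2"
  have "cmod (G_out s k x - G1_helm s k x) \<le> C * (- ln \<bar>x\<bar> * indicator {0<..<1} \<bar>x\<bar> + 1) * jbr x powr (- 1 - 2 * s)"
    if x: "x \<noteq> 0" for x :: real
  proof -
    have r: "norm x > 0" using x by simp
    define L where "L = - ln \<bar>x\<bar> * indicator {0<..<1} \<bar>x\<bar> + (1::real)"
    have L1: "L \<ge> 1" using x by (auto simp: L_def indicator_def)
    have "norm (transform 1 (norm x)) \<le> (C1 + 4 * C2) * L * (2 powr 2 * jbr x powr (- 2))"
    proof (cases "norm x \<le> 1")
      case True
      have "norm (transform 1 (norm x)) \<le> (C1 + 4 * C2) * L"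
      proof (cases "norm x \<le> 1 / 2")
        case True
        have "norm (transform 1 (norm x)) \<le> C1 * (- ln (norm x))" using C1(2)[OF r True] .
        also have "\<dots> \<le> (C1 + 4 * C2) * L"
        proof (rule mult_mono)
          show "- ln (norm x) \<le> L" using True x by (simp add: L_def)
          show "0 \<le> - ln (norm x)" using True x by simp
        qed (use C1(1) C2(1) in auto)
        finally show ?thesis .
      next
        case False
        \<comment> \<open>Close to 1 the logarithm is too small to serve as a bound. The estimate
          with \<open>\<alpha> = - s\<close> costs at most \<open>(1 / 2) powr (- 2) = 4\<close> on
          this range, whence the factor 4 in \<open>C\<close>, and the summand 1 in \<open>L\<close>
          absorbs it.\<close>
        have "norm (transform 1 (norm x)) \<le> C2 * norm x powr (- 2)" using C2(2)[OF r] unfolding p2 .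
        also have "\<dots> \<le> C2 * (1 / 2) powr (- 2)" using False C2(1) by (intro mult_left_mono powr_mono2') auto
        also have "\<dots> = 4 * C2 * 1" by (simp add: powr_minus_divide power2_eq_square)
        also have "\<dots> \<le> (C1 + 4 * C2) * L" using C1(1) C2(1) L1 by (intro mult_mono) auto
        finally show ?thesis .
      qed
      also have "\<dots> = (C1 + 4 * C2) * L * 1" by simp
      also have "\<dots> \<le> (C1 + 4 * C2) * L * (2 powr 2 * jbr x powr (- 2))"
        using jbr_powr_small[of 2 x] True C1(1) C2(1) L1 by (intro mult_left_mono) auto
      finally show ?thesis .
    next
      case False
      have "norm (transform 1 (norm x)) \<le> C2 * norm x powr (- 2)" using C2(2)[OF r] unfolding p2 .
      also have "\<dots> = C2 * 1 * norm x powr (- 2)" by simp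
      also have "\<dots> \<le> (C1 + 4 * C2) * L * (2 powr 2 * jbr x powr (- 2))"
        using jbr_powr_large[of 2 x] False C1(1) C2(1) L1 by (intro mult_mono) auto
      finally show ?thesis .
    qed
    then show ?thesis unfolding G_out_transform(1)[OF x] p2 L_def[symmetric] C_def by (simp only: mult_ac)
  qed
  moreover have "C > 0" using C1(1) C2(1) by (simp add: C_def)
  ultimately show ?thesis using that by blast
qed

lemma bound_1_low:
  assumes "s < 1 / 2"
  obtains C where "C > 0" "\<And>x::real. x \<noteq> 0 \<Longrightarrow> cmod (G_out s k x - G1_helm s k x)
    \<le> C * \<bar>x\<bar> powr (- (1 - 2 * s)) * jbr x powr (- 4 * s)"
proof -
  obtain C where "C > 0" "\<And>x::real. x \<noteq> 0 \<Longrightarrow> norm (transform 1 (norm x)) \<le> C * norm x powr (- (real 1 - 2 * s)) * jbr x powr (- 4 * s)"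
    using transform_bound_two_sided[of 1, where 'a = real] assms by auto
  with that[of C] show ?thesis by (simp add: G_out_transform(1))
qed

lemma bound_3_high:
  obtains C where "C > 0" "\<And>x::real^3. x \<noteq> 0 \<Longrightarrow> cmod (G_out s k x - G3_helm s k x)
    \<le> C * norm x powr (- (3 - 2 * s)) * jbr x powr (- 4 * s)"
proof -
  obtain C where "C > 0" "\<And>x::real^3. x \<noteq> 0 \<Longrightarrow> norm (transform 3 (norm x)) \<le> C * norm x powr (- (real 3 - 2 * s)) * jbr x powr (- 4 * s)"
    using transform_bound_two_sided[of 3, where 'a = "real^3"] s by auto
  with that[of C] show ?thesis by (simp add: G_out_transform(3))
qed

text \<open>The number \<open>m\<close> is the one for which \<open>1 / 2\<close> lies between
  \<open>s * m\<close> and \<open>s * (m + 1)\<close>, so that \<open>\<alpha> = 1 / 2\<close> is an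
  admissible exponent for the remainder of order \<open>m\<close>.\<close>

lemma order_bounds:
  assumes "s \<le> 1 / 2"
  defines "m \<equiv> nat \<lfloor>1 / (2 * s)\<rfloor>"
  shows "s * real m \<le> 1 / 2" "1 / 2 \<le> s * real (m + 1)"
proof -
  have pos: "1 / (2 * s) \<ge> 0" using s by simp
  have m: "real m = of_int \<lfloor>1 / (2 * s)\<rfloor>" unfolding m_def using pos by simp
  have "real m \<le> 1 / (2 * s)" "1 / (2 * s) \<le> real m + 1" unfolding m by linarith+
  then show "s * real m \<le> 1 / 2" "1 / 2 \<le> s * real (m + 1)" using s by (auto simp: field_simps)
qed

text \<open>For \<open>1 / 2 < s\<close> the exponent \<open>\<alpha> = 1 / 2\<close> is already
  allowed for the density itself, and \<open>2 * \<alpha> - 2 = - 1\<close>.\<close>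

lemma bound_2_high:
  assumes "1 / 2 < s"
  obtains C where "C > 0" "\<And>x::real^2. x \<noteq> 0 \<Longrightarrow> cmod (G_out s k x - G2_helm s k x) \<le> C * norm x powr (- 1)"
proof -
  obtain C where "C > 0" "\<And>r. r > 0 \<Longrightarrow> norm (transform 2 r) \<le> C * r powr (2 * (1 / 2) - real 2)"
    using transform_bound[of "1 / 2" 2] assms by auto
  with that[of C] show ?thesis by (simp add: G_out_transform(2))
qed

text \<open>The exponent \<open>\<alpha> = 1 / 2\<close> is kept, but the density must first be
  corrected by \<open>m\<close> terms for it to be admissible.\<close>

lemma bound_2_low:
  assumes "s \<le> 1 / 2"
  defines "m \<equiv> nat \<lfloor>1 / (2 * s)\<rfloor>"
  obtains C where "C > 0" "\<And>x::real^2. x \<noteq> 0 \<Longrightarrow> cmod (G_out s k x - G2_helm s k x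
      - complex_of_real (\<Sum>j<m. riesz_c 2 s j * k powr (2 * s * real j) / norm x powr (2 - 2 * s * real (j + 1))))
    \<le> C * norm x powr (- 1)"
proof -
  note ob = order_bounds[OF assms(1), folded m_def]
  obtain C where "C > 0" "\<And>r. r > 0 \<Longrightarrow> norm (transform 2 r
      - of_real (\<Sum>j<m. riesz_c 2 s j * k powr (2 * s * real j) / r powr (real 2 - 2 * s * real (j + 1)))) \<le> C * r powr (2 * (1 / 2) - real 2)"
    using transform_expansion_bound[of m 2 "1 / 2" k] ob k ak by auto
  with that[of C] show ?thesis by (simp add: G_out_transform(2))
qed

text \<open>Here \<open>\<alpha>\<close> is the lower end \<open>s * m\<close> of the admissible
  interval, which produces the exponent \<open>2 * s * m - 3\<close> of the claim.\<close>

lemma bound_3_low: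
  assumes "s \<le> 1 / 2"
  defines "m \<equiv> nat \<lfloor>1 / (2 * s)\<rfloor>"
  obtains C where "C > 0" "\<And>x::real^3. x \<noteq> 0 \<Longrightarrow> cmod (G_out s k x - G3_helm s k x
      - complex_of_real (\<Sum>j<m. riesz_c 3 s j * k powr (2 * s * real j) / norm x powr (3 - 2 * s * real (j + 1))))
    \<le> C * norm x powr (- (3 - 2 * s * real m))"
proof -
  note ob = order_bounds[OF assms(1), folded m_def]
  have le: "s * real m \<le> s * real (m + 1)" using s by (intro mult_left_mono) auto
  obtain C where C: "C > 0" "\<And>r. r > 0 \<Longrightarrow> norm (transform 3 r
      - of_real (\<Sum>j<m. riesz_c 3 s j * k powr (2 * s * real j) / r powr (real 3 - 2 * s * real (j + 1)))) \<le> C * r powr (2 * (s * real m) - real 3)"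
    using transform_expansion_bound[of m 3 "s * real m" k] ob(1) le k ak by auto
  have E: "2 * (s * real m) - real 3 = - (3 - 2 * s * real m)" by simp
  from that[of C] C(1) C(2)[unfolded E] show ?thesis by (simp add: G_out_transform(3))
qed

end

end

text \<open>Each estimate provides its constant only in its own range of \<open>s\<close>. Outside
  that range any positive number will do, so all constants exist simultaneously and can be
  added.\<close>

lemma conditional_constant: "(P \<Longrightarrow> \<exists>C>0::real. Q C) \<Longrightarrow> \<exists>C>0. P \<longrightarrow> Q C"
  by (cases P) (auto intro: exI[of _ 1])

theorem mainTheorem2:
  fixes k s :: real
  assumes "k > 0" and "0 < s" and "s < 1"
  defines "m \<equiv> nat \<lfloor>1 / (2 * s)\<rfloor>"
  shows "\<exists>C>0.
    (\<forall>x::real. x \<noteq> 0 \<longrightarrow>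
       (1/2 < s \<longrightarrow> cmod (G_out s k x - G1_helm s k x) \<le> C * jbr x powr (-1 - 2 * s)) \<and>
       (s = 1/2 \<longrightarrow> cmod (G_out s k x - G1_helm s k x)
            \<le> C * (- ln \<bar>x\<bar> * indicator {0<..<1} \<bar>x\<bar> + 1) * jbr x powr (-1 - 2 * s)) \<and>
       (s < 1/2 \<longrightarrow> cmod (G_out s k x - G1_helm s k x)
            \<le> C * \<bar>x\<bar> powr (-(1 - 2 * s)) * jbr x powr (-4 * s))) \<and>
    (\<forall>x::real^2. x \<noteq> 0 \<longrightarrow>
       (1/2 < s \<longrightarrow> cmod (G_out s k x - G2_helm s k x) \<le> C * norm x powr (-1)) \<and>
       (s \<le> 1/2 \<longrightarrow> cmod (G_out s k x - G2_helm s k x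
            - complex_of_real (\<Sum>j<m. riesz_c 2 s j * k powr (2 * s * real j)
                 / norm x powr (2 - 2 * s * real (j + 1))))
            \<le> C * norm x powr (-1))) \<and>
    (\<forall>x::real^3. x \<noteq> 0 \<longrightarrow>
       (1/2 < s \<longrightarrow> cmod (G_out s k x - G3_helm s k x)
            \<le> C * norm x powr (-(3 - 2 * s)) * jbr x powr (-4 * s)) \<and>
       (s \<le> 1/2 \<longrightarrow> cmod (G_out s k x - G3_helm s k x
            - complex_of_real (\<Sum>j<m. riesz_c 3 s j * k powr (2 * s * real j)
                 / norm x powr (3 - 2 * s * real (j + 1))))
            \<le> C * norm x powr (-(3 - 2 * s * real m))))"
proof -
  define a where "a = k powr (2 * s)"
  interpret symbol s a by unfold_locales (use assms in \<open>auto simp: a_def\<close>)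
  note k = \<open>k > 0\<close> a_def
  have "\<exists>C>0. 1 / 2 < s \<longrightarrow> (\<forall>x::real. x \<noteq> 0 \<longrightarrow> cmod (G_out s k x - G1_helm s k x) \<le> C * jbr x powr (- 1 - 2 * s))"
    by (rule conditional_constant, erule bound_1_high[OF k]) blast
  then obtain C1 where C1: "C1 > 0" "\<And>x::real. 1 / 2 < s \<Longrightarrow> x \<noteq> 0 \<Longrightarrow> cmod (G_out s k x - G1_helm s k x) \<le> C1 * jbr x powr (- 1 - 2 * s)"
    by blast
  have "\<exists>C>0. s = 1 / 2 \<longrightarrow> (\<forall>x::real. x \<noteq> 0 \<longrightarrow> cmod (G_out s k x - G1_helm s k x) \<le> C * (- ln \<bar>x\<bar> * indicator {0<..<1} \<bar>x\<bar> + 1) * jbr x powr (- 1 - 2 * s))"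
    by (rule conditional_constant, erule bound_1_critical[OF k]) blast
  then obtain C2 where C2: "C2 > 0" "\<And>x::real. s = 1 / 2 \<Longrightarrow> x \<noteq> 0 \<Longrightarrow> cmod (G_out s k x - G1_helm s k x) \<le> C2 * (- ln \<bar>x\<bar> * indicator {0<..<1} \<bar>x\<bar> + 1) * jbr x powr (- 1 - 2 * s)"
    by blast
  have "\<exists>C>0. s < 1 / 2 \<longrightarrow> (\<forall>x::real. x \<noteq> 0 \<longrightarrow> cmod (G_out s k x - G1_helm s k x) \<le> C * \<bar>x\<bar> powr (- (1 - 2 * s)) * jbr x powr (- 4 * s))"
    by (rule conditional_constant, erule bound_1_low[OF k]) blast
  then obtain C3 where C3: "C3 > 0" "\<And>x::real. s < 1 / 2 \<Longrightarrow> x \<noteq> 0 \<Longrightarrow> cmod (G_out s k x - G1_helm s k x) \<le> C3 * \<bar>x\<bar> powr (- (1 - 2 * s)) * jbr x powr (- 4 * s)"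
    by blast
  have "\<exists>C>0. 1 / 2 < s \<longrightarrow> (\<forall>x::real^2. x \<noteq> 0 \<longrightarrow> cmod (G_out s k x - G2_helm s k x) \<le> C * norm x powr (- 1))"
    by (rule conditional_constant, erule bound_2_high[OF k]) blast
  then obtain C4 where C4: "C4 > 0" "\<And>x::real^2. 1 / 2 < s \<Longrightarrow> x \<noteq> 0 \<Longrightarrow> cmod (G_out s k x - G2_helm s k x) \<le> C4 * norm x powr (- 1)"
    by blast
  have "\<exists>C>0. s \<le> 1 / 2 \<longrightarrow> (\<forall>x::real^2. x \<noteq> 0 \<longrightarrow> cmod (G_out s k x - G2_helm s k x
      - complex_of_real (\<Sum>j<m. riesz_c 2 s j * k powr (2 * s * real j) / norm x powr (2 - 2 * s * real (j + 1)))) \<le> C * norm x powr (- 1))"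
    unfolding m_def by (rule conditional_constant, erule bound_2_low[OF k]) blast
  then obtain C5 where C5: "C5 > 0" "\<And>x::real^2. s \<le> 1 / 2 \<Longrightarrow> x \<noteq> 0 \<Longrightarrow> cmod (G_out s k x - G2_helm s k x
      - complex_of_real (\<Sum>j<m. riesz_c 2 s j * k powr (2 * s * real j) / norm x powr (2 - 2 * s * real (j + 1)))) \<le> C5 * norm x powr (- 1)"
    by blast
  have "\<exists>C>0. 1 / 2 < s \<longrightarrow> (\<forall>x::real^3. x \<noteq> 0 \<longrightarrow> cmod (G_out s k x - G3_helm s k x) \<le> C * norm x powr (- (3 - 2 * s)) * jbr x powr (- 4 * s))"
    by (rule conditional_constant, rule bound_3_high[OF k]) blast
  then obtain C6 where C6: "C6 > 0" "\<And>x::real^3. 1 / 2 < s \<Longrightarrow> x \<noteq> 0 \<Longrightarrow> cmod (G_out s k x - G3_helm s k x) \<le> C6 * norm x powr (- (3 - 2 * s)) * jbr x powr (- 4 * s)"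
    by blast
  have "\<exists>C>0. s \<le> 1 / 2 \<longrightarrow> (\<forall>x::real^3. x \<noteq> 0 \<longrightarrow> cmod (G_out s k x - G3_helm s k x
      - complex_of_real (\<Sum>j<m. riesz_c 3 s j * k powr (2 * s * real j) / norm x powr (3 - 2 * s * real (j + 1)))) \<le> C * norm x powr (- (3 - 2 * s * real m)))"
    unfolding m_def by (rule conditional_constant, erule bound_3_low[OF k]) blast
  then obtain C7 where C7: "C7 > 0" "\<And>x::real^3. s \<le> 1 / 2 \<Longrightarrow> x \<noteq> 0 \<Longrightarrow> cmod (G_out s k x - G3_helm s k x
      - complex_of_real (\<Sum>j<m. riesz_c 3 s j * k powr (2 * s * real j) / norm x powr (3 - 2 * s * real (j + 1)))) \<le> C7 * norm x powr (- (3 - 2 * s * real m))"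
    by blast
  \<comment> \<open>A larger constant preserves a bound as long as the weight is nonnegative. This
    is evident for the powers; the logarithmic weight needs the sign argument in
    \<open>log_nonneg\<close>.\<close>
  have weaken: "u \<le> C * w" if "u \<le> c * w" "c \<le> C" "0 \<le> w" for u c C w :: real
    using that by (meson mult_right_mono order_trans)
  have weaken2: "u \<le> C * w * z" if "u \<le> c * w * z" "c \<le> C" "0 \<le> w" "0 \<le> z" for u c C w z :: real
    using that by (meson mult_right_mono order_trans)
  have log_nonneg: "0 \<le> - ln \<bar>x\<bar> * indicator {0<..<1} \<bar>x\<bar> + 1" for x :: real
  proof (cases "\<bar>x\<bar> \<in> {0<..<1}")
    case True
    then have "ln \<bar>x\<bar> < 0" by simp
    then have "ln \<bar>x\<bar> \<le> 1" by linarith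
    with True show ?thesis by simp
  qed simp
  show ?thesis
  proof (intro exI[of _ "C1 + C2 + C3 + C4 + C5 + C6 + C7"] conjI allI impI)
    show "0 < C1 + C2 + C3 + C4 + C5 + C6 + C7" using C1(1) C2(1) C3(1) C4(1) C5(1) C6(1) C7(1) by simp
  next
    fix x :: real assume x: "x \<noteq> 0"
    show "cmod (G_out s k x - G1_helm s k x) \<le> (C1 + C2 + C3 + C4 + C5 + C6 + C7) * jbr x powr (-1 - 2 * s)" if "1 / 2 < s"
      by (rule weaken[OF C1(2)[OF that x]]) (use C2(1) C3(1) C4(1) C5(1) C6(1) C7(1) in auto)
    show "cmod (G_out s k x - G1_helm s k x) \<le> (C1 + C2 + C3 + C4 + C5 + C6 + C7) * (- ln \<bar>x\<bar> * indicator {0<..<1} \<bar>x\<bar> + 1) * jbr x powr (-1 - 2 * s)" if "s = 1 / 2"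
      by (rule weaken2[OF C2(2)[OF that x] _ log_nonneg]) (use C1(1) C3(1) C4(1) C5(1) C6(1) C7(1) in auto)
    show "cmod (G_out s k x - G1_helm s k x) \<le> (C1 + C2 + C3 + C4 + C5 + C6 + C7) * \<bar>x\<bar> powr (-(1 - 2 * s)) * jbr x powr (-4 * s)" if "s < 1 / 2"
      by (rule weaken2[OF C3(2)[OF that x]]) (use C1(1) C2(1) C4(1) C5(1) C6(1) C7(1) in auto)
  next
    fix x :: "real^2" assume x: "x \<noteq> 0"
    show "cmod (G_out s k x - G2_helm s k x) \<le> (C1 + C2 + C3 + C4 + C5 + C6 + C7) * norm x powr (-1)" if "1 / 2 < s"
      by (rule weaken[OF C4(2)[OF that x]]) (use C1(1) C2(1) C3(1) C5(1) C6(1) C7(1) in auto)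
    show "cmod (G_out s k x - G2_helm s k x
            - complex_of_real (\<Sum>j<m. riesz_c 2 s j * k powr (2 * s * real j)
                 / norm x powr (2 - 2 * s * real (j + 1))))
            \<le> (C1 + C2 + C3 + C4 + C5 + C6 + C7) * norm x powr (-1)" if "s \<le> 1 / 2"
      by (rule weaken[OF C5(2)[OF that x]]) (use C1(1) C2(1) C3(1) C4(1) C6(1) C7(1) in auto)
  next
    fix x :: "real^3" assume x: "x \<noteq> 0"
    show "cmod (G_out s k x - G3_helm s k x) \<le> (C1 + C2 + C3 + C4 + C5 + C6 + C7) * norm x powr (-(3 - 2 * s)) * jbr x powr (-4 * s)" if "1 / 2 < s"
      by (rule weaken2[OF C6(2)[OF that x]]) (use C1(1) C2(1) C3(1) C4(1) C5(1) C7(1) in auto)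
    show "cmod (G_out s k x - G3_helm s k x
            - complex_of_real (\<Sum>j<m. riesz_c 3 s j * k powr (2 * s * real j)
                 / norm x powr (3 - 2 * s * real (j + 1))))
            \<le> (C1 + C2 + C3 + C4 + C5 + C6 + C7) * norm x powr (-(3 - 2 * s * real m))" if "s \<le> 1 / 2"
      by (rule weaken[OF C7(2)[OF that x]]) (use C1(1) C2(1) C3(1) C4(1) C5(1) C6(1) in auto)
  qed
qed

end
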